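(* Let $d\in\mathbb{N}$, let $R,S$ be finite subsets of $\mathbb{N}_0^d\setminus\{\mathbf 0\}$, let $(\phi_{\mathbf n})_{\mathbf n\in R},(\theta_{\mathbf n})_{\mathbf n\in S}\subset\mathbb{C}$, and let $(Z_{\mathbf t})_{\mathbf t\in\mathbb{Z}^d}$ be an i.i.d. nondeterministic symmetric complex-valued random field. Then the ARMA equation $$Y_{\mathbf t}-\sum_{\mathbf n\in R}\phi_{\mathbf n}Y_{\mathbf t-\mathbf n}=Z_{\mathbf t}+\sum_{\mathbf n\in S}\theta_{\mathbf n}Z_{\mathbf t-\mathbf n},\qquad \mathbf t\in\mathbb{Z}^d,$$ admits a causal solution $(Y_{\mathbf t})_{\mathbf t\in\mathbb{Z}^d}$ if and only if $$\frac{\Theta(\mathbf z)}{\Phi(\mathbf z)}\in H^2,\qquad \mathbf z\in\mathbb{D}^d,$$ and $\sum_{\mathbf k\in\mathbb{N}_0^d}\alpha_{\mathbf k}Z_{\mathbf t-\mathbf k}$ converges almost surely in the rectangular sense, where $(\alpha_{\mathbf k})_{\mathbf k\in\mathbb{N}_0^d}$ are the coefficients of the power series expansion $\Theta(\mathbf z)/\Phi(\mathbf z)=\sum_{\mathbf k\in\mathbb{N}_0^d}\alpha_{\mathbf k}\mathbf z^{\mathbf k}$, $\mathbf z\in\mathbb{D}^d$. In that case, $Y_{\mathbf t}:=\sum_{\mathbf k\in\mathbb{N}_0^d}\alpha_{\mathbf k}Z_{\mathbf t-\mathbf k}$, $\mathbf t\in\mathbb{Z}^d$, defines the unique symmetric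 causal solution.
   Context: Notation: $\mathbf z^{\mathbf n}=z_1^{n_1}\cdots z_d^{n_d}$; $\Phi(\mathbf z)=1-\sum_{\mathbf n\in R}\phi_{\mathbf n}\mathbf z^{\mathbf n}$, $\Theta(\mathbf z)=1+\sum_{\mathbf n\in S}\theta_{\mathbf n}\mathbf z^{\mathbf n}$; $\mathbb{D}^d=\{\mathbf z\in\mathbb{C}^d:|z_i|<1,\ i=1,\dots,d\}$. A random field $(Z_{\mathbf t})$ is deterministic if there is a constant $K$ with $\mathbb{P}(Z_{\mathbf t}=K)=1$ for all $\mathbf t$, and nondeterministic otherwise. The noise is symmetric if $Z_{\mathbf 0}$ and $-Z_{\mathbf 0}$ have the same distribution; a solution $(Y_{\mathbf t})$ is symmetric if $Y_{\mathbf 0}$ and $-Y_{\mathbf 0}$ have the same distribution. Uniqueness is understood up to almost sure equality. For $\mathbf s,\mathbf t\in\mathbb{Z}^d$, $\mathbf s\le\mathbf t$ means $s_i\le t_i$ for all $i$. A strictly stationary complex-valued random field $(Y_{\mathbf t})_{\mathbf t\in\mathbb{Z}^d}$ fulfilling the ARMA equation is called a causal solution if $Y_{\mathbf t}$ is measurable with respect to $\sigma(Z_{\mathbf s}:\mathbf s\le\mathbf t)$ for each $\mathbf t\in\mathbb{Z}^d$. $H^2$ is the Hardy space of all holomorphic $f:\mathbb{D}^d\to\mathbb{C}$ with $\sup_{0\le r<1}\frac{1}{(2\pi)^d}\int_{(-\pi,\pi]^d}|f(re^{-i\mathbf t})|^2\,d\lambda^d(\mathbf t)<\infty$, where $e^{-i\mathbf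 t}=(e^{-it_1},\dots,e^{-it_d})$; equivalently $f(\mathbf z)=\sum_{\mathbf k\in\mathbb{N}_0^d}a_{\mathbf k}\mathbf z^{\mathbf k}$ on $\mathbb{D}^d$ with $\sum|a_{\mathbf k}|^2<\infty$. "$\Theta/\Phi\in H^2$" means that there is $f\in H^2$ with $\Phi f=\Theta$ on $\mathbb{D}^d$ (this $f$ is then unique and is denoted $\Theta/\Phi$). A multiple series $\sum_{\mathbf k\in\mathbb{N}_0^d}X_{\mathbf k}$ of random variables converges almost surely in the rectangular sense if the limits $\lim_{k\to\infty}\sum_{k_1=0}^{N_{1k}}\cdots\sum_{k_d=0}^{N_{dk}}X_{\mathbf k}$, for all sequences $(N_{1k},\dots,N_{dk})_{k\in\mathbb{N}}\subset\mathbb{N}_0^d$ with $\min(N_{1k},\dots,N_{dk})\to\infty$ as $k\to\infty$, almost surely exist and coincide; the limit is the value of the series. *)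

theory Defs
  imports "HOL-Probability.Probability"
begin

text \<open>
  The dimension \<open>d\<close> is the cardinality of a finite type \<open>'d\<close>; the index sets
  are \<open>int ^ 'd\<close> and \<open>nat ^ 'd\<close>, whose order is componentwise.
\<close>

definition int_vec :: "nat ^ 'd \<Rightarrow> int ^ 'd::finite" where
  "int_vec n = (\<chi> i. int (n $ i))"

definition mpow :: "complex ^ 'd \<Rightarrow> nat ^ 'd \<Rightarrow> complex" where
  "mpow z n = (\<Prod>i\<in>(UNIV :: 'd::finite set). z $ i ^ (n $ i))"

definition ar_poly :: "(nat ^ 'd) set \<Rightarrow> (nat ^ 'd \<Rightarrow> complex) \<Rightarrow> complex ^ 'd::finite \<Rightarrow> complex" where
  "ar_poly R \<phi> z = 1 - (\<Sum>n\<in>R. \<phi> n * mpow z n)"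

definition ma_poly :: "(nat ^ 'd) set \<Rightarrow> (nat ^ 'd \<Rightarrow> complex) \<Rightarrow> complex ^ 'd::finite \<Rightarrow> complex" where
  "ma_poly S \<theta> z = 1 + (\<Sum>n\<in>S. \<theta> n * mpow z n)"

definition polydisc :: "(complex ^ 'd::finite) set" where
  "polydisc = {z. \<forall>i. norm (z $ i) < 1}"


text \<open>Holomorphy in several variables, on an open set: complex differentiability,
  i.e. the real Frechet derivative exists and is complex linear at every point.\<close>

definition mholomorphic_on :: "(complex ^ 'd::finite \<Rightarrow> complex) \<Rightarrow> (complex ^ 'd) set \<Rightarrow> bool" where
  "mholomorphic_on f U \<longleftrightarrow>
     (\<forall>z\<in>U. \<exists>f'. (f has_derivative f') (at z) \<and> (\<forall>c v. f' (c *s v) = c * f' v))"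

definition hardy_mean :: "(complex ^ 'd::finite \<Rightarrow> complex) \<Rightarrow> real \<Rightarrow> real" where
  "hardy_mean f r =
     1 / (2 * pi) ^ CARD('d) *
     (LINT t:{t :: real ^ 'd. \<forall>i. - pi < t $ i \<and> t $ i \<le> pi}|lborel.
        (norm (f (\<chi> i. of_real r * exp (- \<i> * of_real (t $ i)))))\<^sup>2)"

text \<open>Only the values on the polydisc matter; elements are total functions with
  arbitrary values outside of it.\<close>

definition hardy_H2 :: "(complex ^ 'd::finite \<Rightarrow> complex) set" where
  "hardy_H2 = {f. mholomorphic_on f polydisc \<and> bdd_above (hardy_mean f ` {0..<1})}"

definition power_series_on_polydisc ::
    "(nat ^ 'd \<Rightarrow> complex) \<Rightarrow> (complex ^ 'd::finite \<Rightarrow> complex) \<Rightarrow> bool" where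
  "power_series_on_polydisc \<alpha> f \<longleftrightarrow>
     (\<forall>z\<in>polydisc. ((\<lambda>k. \<alpha> k * mpow z k) has_sum f z) UNIV)"


definition rect_sums :: "(nat ^ 'd::finite \<Rightarrow> complex) \<Rightarrow> complex \<Rightarrow> bool" where
  "rect_sums x L \<longleftrightarrow>
     (\<forall>N :: nat \<Rightarrow> nat ^ 'd.
        filterlim (\<lambda>k. Min (range (\<lambda>i. N k $ i))) at_top sequentially \<longrightarrow>
        (\<lambda>k. \<Sum>j\<in>{j. j \<le> N k}. x j) \<longlonglongrightarrow> L)"

text \<open>As with \<open>suminf\<close>, the value is a fixed unspecified number if there is no convergence.\<close>

definition rect_suminf :: "(nat ^ 'd::finite \<Rightarrow> complex) \<Rightarrow> complex" where
  "rect_suminf x = (THE L. rect_sums x L)"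

definition AE_rect_convergent :: "'a measure \<Rightarrow> (nat ^ 'd::finite \<Rightarrow> 'a \<Rightarrow> complex) \<Rightarrow> bool" where
  "AE_rect_convergent M X \<longleftrightarrow> (AE \<omega> in M. \<exists>L. rect_sums (\<lambda>k. X k \<omega>) L)"


definition iid_field :: "'a measure \<Rightarrow> (int ^ 'd::finite \<Rightarrow> 'a \<Rightarrow> complex) \<Rightarrow> bool" where
  "iid_field M Z \<longleftrightarrow>
     prob_space.indep_vars M (\<lambda>_. borel) Z UNIV \<and>
     (\<forall>t. distr M borel (Z t) = distr M borel (Z 0))"

definition deterministic_field :: "'a measure \<Rightarrow> (int ^ 'd::finite \<Rightarrow> 'a \<Rightarrow> complex) \<Rightarrow> bool" where
  "deterministic_field M Z \<longleftrightarrow> (\<exists>K. \<forall>t. AE \<omega> in M. Z t \<omega> = K)"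

definition symmetric_field :: "'a measure \<Rightarrow> (int ^ 'd::finite \<Rightarrow> 'a \<Rightarrow> complex) \<Rightarrow> bool" where
  "symmetric_field M Z \<longleftrightarrow> distr M borel (Z 0) = distr M borel (\<lambda>\<omega>. - Z 0 \<omega>)"

definition strictly_stationary :: "'a measure \<Rightarrow> (int ^ 'd::finite \<Rightarrow> 'a \<Rightarrow> complex) \<Rightarrow> bool" where
  "strictly_stationary M Y \<longleftrightarrow>
     (\<forall>t. Y t \<in> borel_measurable M) \<and>
     (\<forall>h. distr M (PiM UNIV (\<lambda>_. borel)) (\<lambda>\<omega> t. Y (t + h) \<omega>) =
          distr M (PiM UNIV (\<lambda>_. borel)) (\<lambda>\<omega> t. Y t \<omega>))"

definition past_sigma :: "'a measure \<Rightarrow> (int ^ 'd::finite \<Rightarrow> 'a \<Rightarrow> complex) \<Rightarrow> int ^ 'd \<Rightarrow> 'a measure" where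
  "past_sigma M Z t = sigma (space M) {Z s -` A \<inter> space M | s A. s \<le> t \<and> A \<in> sets borel}"

text \<open>The ARMA equation is an equation between random variables, i.e. it holds almost surely.\<close>

definition arma_equation ::
    "'a measure \<Rightarrow> (nat ^ 'd) set \<Rightarrow> (nat ^ 'd \<Rightarrow> complex) \<Rightarrow> (nat ^ 'd) set \<Rightarrow> (nat ^ 'd \<Rightarrow> complex) \<Rightarrow>
     (int ^ 'd::finite \<Rightarrow> 'a \<Rightarrow> complex) \<Rightarrow> (int ^ 'd \<Rightarrow> 'a \<Rightarrow> complex) \<Rightarrow> bool" where
  "arma_equation M R \<phi> S \<theta> Z Y \<longleftrightarrow>
     (\<forall>t. AE \<omega> in M.
        Y t \<omega> - (\<Sum>n\<in>R. \<phi> n * Y (t - int_vec n) \<omega>) =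
        Z t \<omega> + (\<Sum>n\<in>S. \<theta> n * Z (t - int_vec n) \<omega>))"

definition causal_solution ::
    "'a measure \<Rightarrow> (nat ^ 'd) set \<Rightarrow> (nat ^ 'd \<Rightarrow> complex) \<Rightarrow> (nat ^ 'd) set \<Rightarrow> (nat ^ 'd \<Rightarrow> complex) \<Rightarrow>
     (int ^ 'd::finite \<Rightarrow> 'a \<Rightarrow> complex) \<Rightarrow> (int ^ 'd \<Rightarrow> 'a \<Rightarrow> complex) \<Rightarrow> bool" where
  "causal_solution M R \<phi> S \<theta> Z Y \<longleftrightarrow>
     strictly_stationary M Y \<and>
     arma_equation M R \<phi> S \<theta> Z Y \<and>
     (\<forall>t. Y t \<in> borel_measurable (past_sigma M Z t))"

end

(*
  Let alpha be the coefficients of the formal power series Theta/Phi.  Multiplying the ARMA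
  equation by truncations of 1/Phi splits a causal solution, for every box, as
  Y_t = A_N + W_N, where A_N is the sum of alpha_k Z_(t-k) over k <= N and W_N depends only on
  noise outside the box, so A_N and W_N are independent.  Since Y_t is a function of the noise,
  it is approximately a function of the noise in a large box, and a random variable that is
  independent of W_N and close to W_N forces W_N to be close to a constant; symmetry of the
  noise forces the increments A_N' - A_N to be small in probability.  A multi-parameter Levy
  inequality (reflection in one coordinate after the other) upgrades this to almost sure
  rectangular convergence.  Square summability of alpha, i.e. Theta/Phi in H^2, follows from
  tightness of the sums after truncating the noise symmetrically, by comparing characteristic
  functions; the link with H^2 is Parseval's identity on the torus.  Uniqueness: Y_t minus the
  limit of A_N is almost surely constant, and symmetry makes the constant vanish.
*)
theory Submission
  imports Defs
begin

section \<open>Box sums and the ARMA recursion\<close>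

text \<open>The coefficients therefore come from a formal recursion, solvable because Phi(0) = 1;
  once they are known to be square summable, hence bounded, their series converges on the polydisc
  and satisfies Phi f = Theta. Conversely, a given pair f, \<alpha> satisfies the same recursion by
  uniqueness of power series coefficients. The substitute is the invariance of the law of the whole
  noise field under sign changes that depend on the index or on the modulus. Averaging a sum with
  its sign-changed copy deletes chosen terms or truncates large values, at the price of a factor 2
  in probability. This single device yields the Levy inequality (a factor 2 per coordinate), the
  passage from boxes to arbitrary finite index sets, and the symmetric truncation.\<close>

lemma finite_atMost_nat_vec: "finite {k :: nat ^ 'd::finite. k \<le> N}"
proof (rule finite_subset)
  show "{k. k \<le> N} \<subseteq> vec_lambda ` (PiE UNIV (\<lambda>i. {..N $ i}))"
  proof
    fix k :: "nat ^ 'd" assume "k \<in> {k. k \<le> N}"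
    then have "vec_nth k \<in> PiE UNIV (\<lambda>i. {..N $ i})" by (auto simp: less_eq_vec_def)
    then have "vec_lambda (vec_nth k) \<in> vec_lambda ` (PiE UNIV (\<lambda>i. {..N $ i}))" by blast
    then show "k \<in> vec_lambda ` (PiE UNIV (\<lambda>i. {..N $ i}))" by simp
  qed
  show "finite (vec_lambda ` (PiE UNIV (\<lambda>i. {..N $ i})))"
    by (intro finite_imageI finite_PiE) auto
qed

lemma int_vec_0 [simp]: "int_vec 0 = 0"
  by (simp add: int_vec_def vec_eq_iff)

lemma int_vec_nth [simp]: "int_vec n $ i = int (n $ i)"
  by (simp add: int_vec_def)

lemma int_vec_add: "int_vec (m + n) = int_vec m + int_vec n"
  by (simp add: vec_eq_iff)

lemma inj_int_vec: "inj int_vec"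
  by (auto simp: inj_def vec_eq_iff)

lemma finite_box_index: "finite {k :: nat ^ 'd::finite. p \<le> t - int_vec k}"
proof (rule finite_subset)
  show "{k. p \<le> t - int_vec k} \<subseteq> {k. k \<le> (\<chi> i. nat (t $ i - p $ i))}"
  proof safe
    fix k assume "p \<le> t - int_vec k"
    then have "int (k $ i) \<le> t $ i - p $ i" for i by (simp add: less_eq_vec_def algebra_simps)
    then have "k $ i \<le> nat (t $ i - p $ i)" for i by (metis nat_int nat_mono)
    then show "k \<le> (\<chi> i. nat (t $ i - p $ i))" by (simp add: less_eq_vec_def)
  qed
qed (rule finite_atMost_nat_vec)

lemma box_index_eq: "{k. t - int_vec N \<le> t - int_vec k} = {k. k \<le> N}"
  by (auto simp: less_eq_vec_def)

text \<open>The coefficient family of Theta, with its constant term 1 included, so that the right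
  side of the ARMA equation becomes one convolution.\<close>

definition ma_coeff :: "(nat ^ 'd::finite) set \<Rightarrow> (nat ^ 'd \<Rightarrow> complex) \<Rightarrow> nat ^ 'd \<Rightarrow> complex" where
  "ma_coeff S \<theta> n = (if n = 0 then 1 else if n \<in> S then \<theta> n else 0)"

text \<open>Comparison of the coefficients of z^k in Phi * (sum of \<alpha>_k z^k) = Theta. The
  guard \<open>n \<le> k\<close> is essential because subtraction on \<open>nat\<close> is
  truncated.\<close>

definition arma_recursion :: "(nat ^ 'd::finite) set \<Rightarrow> (nat ^ 'd \<Rightarrow> complex) \<Rightarrow> (nat ^ 'd) set \<Rightarrow>
    (nat ^ 'd \<Rightarrow> complex) \<Rightarrow> (nat ^ 'd \<Rightarrow> complex) \<Rightarrow> bool" where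
  "arma_recursion R \<phi> S \<theta> \<alpha> \<longleftrightarrow>
     (\<forall>k. \<alpha> k = ma_coeff S \<theta> k + (\<Sum>n | n \<in> R \<and> n \<le> k. \<phi> n * \<alpha> (k - n)))"

text \<open>The formal power series Theta/Phi. The condition \<open>n \<noteq> 0\<close> makes the
  recursion terminate for every \<open>R\<close>: the sum of the coordinates of \<open>k\<close>
  drops in each call.\<close>

function arma_coeff :: "(nat ^ 'd::finite) set \<Rightarrow> (nat ^ 'd \<Rightarrow> complex) \<Rightarrow> (nat ^ 'd) set \<Rightarrow>
    (nat ^ 'd \<Rightarrow> complex) \<Rightarrow> nat ^ 'd \<Rightarrow> complex" where
  "arma_coeff R \<phi> S \<theta> k = ma_coeff S \<theta> k +
     (\<Sum>n | n \<in> R \<and> n \<noteq> 0 \<and> n \<le> k. \<phi> n * arma_coeff R \<phi> S \<theta> (k - n))"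
  by auto
termination
proof (relation "Wellfounded.measure (\<lambda>(R, \<phi>, S, \<theta>, k). \<Sum>i\<in>UNIV. k $ i)", simp)
  fix R S :: "(nat ^ 'd) set" and \<phi> \<theta> k n
  assume "n \<in> {n \<in> R. n \<noteq> 0 \<and> n \<le> k}"
  then have le: "\<And>i. n $ i \<le> k $ i" and nz: "n \<noteq> 0" by (auto simp: less_eq_vec_def)
  then obtain i where i: "n $ i > 0" by (auto simp: vec_eq_iff)
  have "(\<Sum>i\<in>UNIV. (k - n) $ i) < (\<Sum>i\<in>UNIV. k $ i)"
  proof (rule sum_strict_mono_ex1)
    show "\<exists>a\<in>UNIV. (k - n) $ a < k $ a" using i le[of i] by (intro bexI[of _ i]) auto
  qed auto
  then show "((R, \<phi>, S, \<theta>, k - n), R, \<phi>, S, \<theta>, k) \<in> Wellfounded.measure (\<lambda>(R, \<phi>, S, \<theta>, k). \<Sum>i\<in>UNIV. k $ i)"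
    by simp
qed

declare arma_coeff.simps [simp del]

lemma arma_recursion_arma_coeff:
  assumes "0 \<notin> R"
  shows "arma_recursion R \<phi> S \<theta> (arma_coeff R \<phi> S \<theta>)"
proof -
  have "{n. n \<in> R \<and> n \<noteq> 0 \<and> n \<le> k} = {n. n \<in> R \<and> n \<le> k}" for k using assms by auto
  then show ?thesis unfolding arma_recursion_def by (subst arma_coeff.simps) simp
qed

text \<open>The box is given by its lower corner \<open>p\<close> rather than by its size. Replacing
  \<open>t\<close> by \<open>t - int_vec n\<close> then keeps the corner fixed, so all terms of the
  ARMA equation are truncated at the same place.\<close>

definition box_sum :: "(nat ^ 'd::finite \<Rightarrow> complex) \<Rightarrow> (int ^ 'd \<Rightarrow> complex) \<Rightarrow> int ^ 'd \<Rightarrow> int ^ 'd \<Rightarrow> complex" where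
  "box_sum \<alpha> x p t = (\<Sum>k | p \<le> t - int_vec k. \<alpha> k * x (t - int_vec k))"

lemma box_sum_eq: "box_sum \<alpha> x (t - int_vec N) t = (\<Sum>k | k \<le> N. \<alpha> k * x (t - int_vec k))"
  by (simp add: box_sum_def box_index_eq)

lemma box_sum_empty: "\<not> p \<le> t \<Longrightarrow> box_sum \<alpha> x p t = 0"
proof -
  assume a: "\<not> p \<le> t"
  have "{k. p \<le> t - int_vec k} = {}"
  proof (safe, goal_cases)
    case (1 k)
    have "p \<le> t" unfolding less_eq_vec_def
    proof
      fix i have "p $ i \<le> t $ i - int (k $ i)" using 1 by (simp add: less_eq_vec_def)
      then show "p $ i \<le> t $ i" by simp
    qed
    then show ?case using a by simp
  qed
  then show ?thesis by (simp add: box_sum_def)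
qed

text \<open>With \<open>j = n + k\<close> the condition for a term of the shifted sum reads
  \<open>p \<le> t - int_vec j\<close>, the same for every \<open>n\<close>. Hence no boundary terms
  arise, and the coefficient of each noise variable is the one computed by the recursion.\<close>

lemma box_sum_arma:
  assumes R: "finite R" and rec: "arma_recursion R \<phi> S \<theta> \<alpha>"
  shows "box_sum \<alpha> x p t - (\<Sum>n\<in>R. \<phi> n * box_sum \<alpha> x p (t - int_vec n)) = box_sum (ma_coeff S \<theta>) x p t"
proof -
  let ?K = "{k. p \<le> t - int_vec k}"
  have fin: "finite ?K" by (rule finite_box_index)
  have one: "\<phi> n * box_sum \<alpha> x p (t - int_vec n) =
      (\<Sum>j\<in>?K. if n \<le> j then \<phi> n * \<alpha> (j - n) * x (t - int_vec j) else 0)" for n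
  proof -
    have "\<phi> n * box_sum \<alpha> x p (t - int_vec n) =
       (\<Sum>k | p \<le> t - int_vec n - int_vec k. \<phi> n * \<alpha> k * x (t - int_vec n - int_vec k))"
      by (simp add: box_sum_def sum_distrib_left mult.assoc)
    also have "\<dots> = (\<Sum>j | p \<le> t - int_vec j \<and> n \<le> j. \<phi> n * \<alpha> (j - n) * x (t - int_vec j))"
    proof (rule sum.reindex_bij_witness[where j = "\<lambda>k. n + k" and i = "\<lambda>j. j - n"], goal_cases)
      case (3 b) then show ?case by (auto simp: vec_eq_iff less_eq_vec_def)
    next
      case (4 b)
      then have "int_vec (b - n) = int_vec b - int_vec n" by (auto simp: vec_eq_iff less_eq_vec_def of_nat_diff)
      then show ?case using 4 by simp
    qed (auto simp: vec_eq_iff less_eq_vec_def int_vec_add algebra_simps)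
    also have "\<dots> = (\<Sum>j\<in>?K. if n \<le> j then \<phi> n * \<alpha> (j - n) * x (t - int_vec j) else 0)"
      using sum.inter_filter[OF fin, of "\<lambda>j. \<phi> n * \<alpha> (j - n) * x (t - int_vec j)" "\<lambda>j. n \<le> j"]
      by simp
    finally show ?thesis .
  qed
  have "(\<Sum>n\<in>R. \<phi> n * box_sum \<alpha> x p (t - int_vec n)) =
    (\<Sum>j\<in>?K. \<Sum>n\<in>R. if n \<le> j then \<phi> n * \<alpha> (j - n) * x (t - int_vec j) else 0)"
    unfolding one by (rule sum.swap)
  also have "\<dots> = (\<Sum>j\<in>?K. (\<alpha> j - ma_coeff S \<theta> j) * x (t - int_vec j))"
  proof (rule sum.cong[OF refl])
    fix j
    have "(\<Sum>n\<in>R. if n \<le> j then \<phi> n * \<alpha> (j - n) * x (t - int_vec j) else 0) =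
      (\<Sum>n | n \<in> R \<and> n \<le> j. \<phi> n * \<alpha> (j - n)) * x (t - int_vec j)"
      using sum.inter_filter[OF R, of "\<lambda>n. \<phi> n * \<alpha> (j - n) * x (t - int_vec j)" "\<lambda>n. n \<le> j"]
      by (simp add: sum_distrib_right)
    also have "(\<Sum>n | n \<in> R \<and> n \<le> j. \<phi> n * \<alpha> (j - n)) = \<alpha> j - ma_coeff S \<theta> j"
      by (subst rec[unfolded arma_recursion_def, rule_format, of j]) simp
    finally show "(\<Sum>n\<in>R. if n \<le> j then \<phi> n * \<alpha> (j - n) * x (t - int_vec j) else 0) =
      (\<alpha> j - ma_coeff S \<theta> j) * x (t - int_vec j)" .
  qed
  finally show ?thesis
    by (simp add: box_sum_def left_diff_distrib sum_subtractf)
qed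

lemma ma_sum_eq:
  assumes S: "finite S" "0 \<notin> S"
  shows "x t + (\<Sum>n\<in>S. \<theta> n * x (t - int_vec n)) =
     (\<Sum>j\<in>insert 0 S. ma_coeff S \<theta> j * x (t - int_vec j))"
proof -
  have "(\<Sum>n\<in>S. ma_coeff S \<theta> n * x (t - int_vec n)) = (\<Sum>n\<in>S. \<theta> n * x (t - int_vec n))"
    using S by (intro sum.cong) (auto simp: ma_coeff_def)
  then show ?thesis using S by (simp add: ma_coeff_def)
qed

lemma box_sum_ma_coeff:
  assumes S: "finite S"
  shows "box_sum (ma_coeff S \<theta>) x p t =
     (\<Sum>j | j \<in> insert 0 S \<and> p \<le> t - int_vec j. ma_coeff S \<theta> j * x (t - int_vec j))"
  unfolding box_sum_def
proof (rule sum.mono_neutral_right[OF finite_box_index], goal_cases)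
  case 2
  then show ?case by (auto simp: ma_coeff_def)
qed blast

section \<open>Rectangular convergence: epsilon form, uniqueness, Cauchy criterion and
  measurability\<close>

lemma rect_sums_iff:
  fixes x :: "nat ^ 'd::finite \<Rightarrow> complex"
  shows "rect_sums x L \<longleftrightarrow> (\<forall>e>0. \<exists>m. \<forall>N\<ge>m. norm ((\<Sum>j | j \<le> N. x j) - L) < e)"
    (is "_ \<longleftrightarrow> ?R")
proof
  assume rs: "rect_sums x L"
  show ?R
  proof (rule ccontr)
    assume "\<not> ?R"
    then obtain e where e: "e > 0" and "\<And>m. \<exists>N\<ge>m. \<not> norm ((\<Sum>j | j \<le> N. x j) - L) < e" by auto
    then obtain F where F: "\<And>m. F m \<ge> m" "\<And>m. \<not> norm ((\<Sum>j | j \<le> F m. x j) - L) < e" by metis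
    \<comment> \<open>Bad boxes taken above the cubes of side \<open>k\<close> form an admissible
      sequence: the smallest coordinate of \<open>N k\<close> is at least \<open>k\<close>.\<close>
    define N where "N k = F (\<chi> i. k)" for k
    have "filterlim (\<lambda>k. Min (range (\<lambda>i. N k $ i))) at_top sequentially"
    proof (rule filterlim_at_top_mono[OF filterlim_ident])
      show "\<forall>\<^sub>F k in sequentially. k \<le> Min (range (\<lambda>i. N k $ i))"
      proof (intro always_eventually allI Min.boundedI)
        fix k a assume "a \<in> range (\<lambda>i. N k $ i)"
        then show "k \<le> a" using F(1)[of "\<chi> i. k"] by (auto simp: N_def less_eq_vec_def)
      qed auto
    qed
    then have "(\<lambda>k. \<Sum>j\<in>{j. j \<le> N k}. x j) \<longlonglongrightarrow> L" using rs unfolding rect_sums_def by blast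
    then have "eventually (\<lambda>k. dist (\<Sum>j\<in>{j. j \<le> N k}. x j) L < e) sequentially"
      using e by (simp add: tendsto_iff)
    then obtain k where "dist (\<Sum>j\<in>{j. j \<le> N k}. x j) L < e"
      by (meson eventually_happens trivial_limit_sequentially)
    then show False using F(2) by (simp add: N_def dist_norm)
  qed
next
  assume R: ?R
  show "rect_sums x L" unfolding rect_sums_def
  proof (intro allI impI)
    fix N :: "nat \<Rightarrow> nat ^ 'd"
    assume lim: "filterlim (\<lambda>k. Min (range (\<lambda>i. N k $ i))) at_top sequentially"
    show "(\<lambda>k. \<Sum>j\<in>{j. j \<le> N k}. x j) \<longlonglongrightarrow> L"
      unfolding tendsto_iff
    proof (intro allI impI)
      fix e :: real assume "e > 0"
      then obtain m where m: "\<And>N. N \<ge> m \<Longrightarrow> norm ((\<Sum>j | j \<le> N. x j) - L) < e" using R by blast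
      have "eventually (\<lambda>k. Max (range (\<lambda>i. m $ i)) \<le> Min (range (\<lambda>i. N k $ i))) sequentially"
        using lim unfolding filterlim_at_top by blast
      then show "eventually (\<lambda>k. dist (\<Sum>j\<in>{j. j \<le> N k}. x j) L < e) sequentially"
      proof eventually_elim
        case (elim k)
        have "m \<le> N k" unfolding less_eq_vec_def
        proof
          fix i
          have "m $ i \<le> Max (range (\<lambda>i. m $ i))" by simp
          also note elim
          also have "Min (range (\<lambda>i. N k $ i)) \<le> N k $ i" by simp
          finally show "m $ i \<le> N k $ i" .
        qed
        then show ?case using m by (simp add: dist_norm)
      qed
    qed
  qed
qed

lemma vec_sup_exists: "\<exists>n::nat^'d::finite. a \<le> n \<and> b \<le> n"
  by (rule exI[of _ "\<chi> i. max (a $ i) (b $ i)"]) (simp add: less_eq_vec_def)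

lemma rect_sums_unique: "rect_sums x L \<Longrightarrow> rect_sums x L' \<Longrightarrow> L = L'"
proof (rule ccontr)
  assume a: "rect_sums x L" "rect_sums x L'" and ne: "L \<noteq> L'"
  define e where "e = norm (L - L') / 2"
  have e: "e > 0" using ne by (simp add: e_def)
  obtain m where m: "\<And>N. N \<ge> m \<Longrightarrow> norm ((\<Sum>j | j \<le> N. x j) - L) < e" using a(1) e unfolding rect_sums_iff by blast
  obtain m' where m': "\<And>N. N \<ge> m' \<Longrightarrow> norm ((\<Sum>j | j \<le> N. x j) - L') < e" using a(2) e unfolding rect_sums_iff by blast
  obtain n where "m \<le> n" "m' \<le> n" using vec_sup_exists by blast
  then show False using m[of n] m'[of n] norm_triangle_ineq4[of "(\<Sum>j | j \<le> n. x j) - L'" "(\<Sum>j | j \<le> n. x j) - L"]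
    by (simp add: e_def)
qed

lemma rect_suminf_eqI: "rect_sums x L \<Longrightarrow> rect_suminf x = L"
  unfolding rect_suminf_def by (rule the_equality) (auto intro: rect_sums_unique)

lemma rect_sums_uminus: "rect_sums x L \<Longrightarrow> rect_sums (\<lambda>k. - x k) (- L)"
  unfolding rect_sums_def by (auto simp: sum_negf intro: tendsto_minus)

lemma rect_sums_diagonal:
  "rect_sums x L \<Longrightarrow> (\<lambda>m. \<Sum>j | j \<le> (\<chi> i. m). x j) \<longlonglongrightarrow> L"
proof -
  assume "rect_sums x L"
  moreover have "filterlim (\<lambda>k::nat. Min (range (\<lambda>i::'a. (\<chi> i. k) $ i))) at_top sequentially"
    by (simp add: filterlim_ident)
  ultimately show ?thesis unfolding rect_sums_def by (auto dest!: spec[of _ "\<lambda>m. (\<chi> i. m)"])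
qed

text \<open>All quantifiers run over countable sets and no limit is mentioned, so the criterion
  shows that convergence is a measurable event. The box \<open>m\<close> serves both as threshold
  and as reference point.\<close>

lemma rect_convergent_iff_Cauchy:
  fixes x :: "nat ^ 'd::finite \<Rightarrow> complex"
  shows "(\<exists>L. rect_sums x L) \<longleftrightarrow>
    (\<forall>e::nat. \<exists>m. \<forall>N\<ge>m. norm ((\<Sum>j | j \<le> N. x j) - (\<Sum>j | j \<le> m. x j)) \<le> 1 / real (Suc e))"
    (is "_ \<longleftrightarrow> ?R")
proof
  assume "\<exists>L. rect_sums x L"
  then obtain L where L: "rect_sums x L" ..
  define s where "s N = (\<Sum>j | j \<le> N. x j)" for N
  show ?R
  proof
    fix e :: nat
    define c where "c = 1 / real (Suc e)"
    have "c / 2 > 0" by (simp add: c_def)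
    then obtain m where m: "\<And>N. N \<ge> m \<Longrightarrow> norm ((\<Sum>j | j \<le> N. x j) - L) < c / 2"
      using L unfolding rect_sums_iff by blast
    show "\<exists>m. \<forall>N\<ge>m. norm ((\<Sum>j | j \<le> N. x j) - (\<Sum>j | j \<le> m. x j)) \<le> 1 / real (Suc e)"
    proof (intro exI[of _ m] allI impI)
      fix N assume "N \<ge> m"
      then show "norm ((\<Sum>j | j \<le> N. x j) - (\<Sum>j | j \<le> m. x j)) \<le> 1 / real (Suc e)"
        using m[of N, folded s_def] m[OF order_refl, folded s_def] norm_triangle_ineq4[of "s N - L" "s m - L"]
        unfolding s_def[symmetric] c_def[symmetric] by simp
    qed
  qed
next
  assume R: ?R
  define s where "s N = (\<Sum>j | j \<le> N. x j)" for N
  obtain m where m: "\<And>e N. N \<ge> m e \<Longrightarrow> norm (s N - s (m e)) \<le> 1 / real (Suc e)"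
    using R unfolding s_def by metis
  \<comment> \<open>Coordinatewise sums dominate all of \<open>m 0\<close>, ..., \<open>m k\<close>,
    which turns the thresholds into a single sequence of boxes with Cauchy sums.\<close>
  define c where "c k = (\<chi> i. \<Sum>e\<le>k. m e $ i)" for k
  have c: "m e \<le> c k" if "e \<le> k" for e k
  proof -
    have "m e $ i \<le> (\<Sum>e\<le>k. m e $ i)" for i using that by (intro member_le_sum) auto
    then show ?thesis by (simp add: c_def less_eq_vec_def)
  qed
  have near: "norm (s N - s N') \<le> 2 / real (Suc e)" if "N \<ge> m e" "N' \<ge> m e" for N N' e
    using add_mono[OF m[OF that(1)] m[OF that(2)]] norm_triangle_ineq4[of "s N - s (m e)" "s N' - s (m e)"] by simp
  have inv: "\<exists>k. 2 / real (Suc k) < e" if "e > 0" for e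
  proof -
    obtain k where "inverse (real (Suc k)) < e / 2" using reals_Archimedean[of "e/2"] \<open>e > 0\<close> by auto
    then show ?thesis by (intro exI[of _ k]) (simp add: field_simps)
  qed
  have "Cauchy (\<lambda>k. s (c k))"
  proof (rule metric_CauchyI)
    fix e :: real assume "e > 0"
    then obtain k where k: "2 / real (Suc k) < e" using inv by blast
    show "\<exists>M. \<forall>m\<ge>M. \<forall>n\<ge>M. dist (s (c m)) (s (c n)) < e"
      using order_le_less_trans[OF near[OF c c, of k] k] by (intro exI[of _ k]) (simp add: dist_norm)
  qed
  then obtain L where L: "(\<lambda>k. s (c k)) \<longlonglongrightarrow> L" using Cauchy_convergent_iff convergentD by blast
  have "norm (s N - L) \<le> 2 / real (Suc e)" if N: "N \<ge> m e" for N e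
  proof (rule tendsto_upperbound)
    show "(\<lambda>k. norm (s N - s (c k))) \<longlonglongrightarrow> norm (s N - L)" by (intro tendsto_intros L)
    show "\<forall>\<^sub>F k in sequentially. norm (s N - s (c k)) \<le> 2 / real (Suc e)"
      using near[OF N c] by (auto intro: eventually_sequentiallyI[of e])
  qed auto
  then have "\<forall>e>0. \<exists>m. \<forall>N\<ge>m. norm (s N - L) < e" using inv by (meson order_le_less_trans)
  then have "rect_sums x L" unfolding rect_sums_iff s_def .
  then show "\<exists>L. rect_sums x L" ..
qed

text \<open>On the convergence event the value is a limit along cubes; off it the description has an
  empty predicate and is one fixed number. Both branches are measurable, so the sum is measurable
  for the uncompleted sigma-algebra, as causality demands.\<close>

lemma rect_suminf_eq_lim:
  "rect_suminf x = (if \<exists>L. rect_sums x L then lim (\<lambda>m. \<Sum>j | j \<le> (\<chi> i. m). x j) else (THE L. False))"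
proof (cases "\<exists>L. rect_sums x L")
  case True
  then obtain L where L: "rect_sums x L" ..
  then show ?thesis using rect_suminf_eqI[OF L] limI[OF rect_sums_diagonal[OF L]] by auto
next
  case False
  then have "rect_sums x = (\<lambda>L. False)" by auto
  then show ?thesis unfolding rect_suminf_def by simp
qed

lemma measurable_rect_convergent:
  fixes X :: "nat ^ 'd::finite \<Rightarrow> 'a \<Rightarrow> complex"
  assumes [measurable]: "\<And>k. X k \<in> borel_measurable K"
  shows "Measurable.pred K (\<lambda>\<omega>. \<exists>L. rect_sums (\<lambda>k. X k \<omega>) L)"
proof -
  define s where "s N \<omega> = (\<Sum>j | j \<le> N. X j \<omega>)" for N \<omega>
  have [measurable]: "s N \<in> borel_measurable K" for N
    unfolding s_def by (intro borel_measurable_sum assms)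
  have "Measurable.pred K (\<lambda>\<omega>. norm (s N \<omega> - s m \<omega>) \<le> c)" for N m c
    by measurable
  then show ?thesis
    unfolding rect_convergent_iff_Cauchy s_def[symmetric]
    by (intro pred_intros_countable pred_intros_imp')
qed

lemma borel_measurable_rect_suminf:
  fixes X :: "nat ^ 'd::finite \<Rightarrow> 'a \<Rightarrow> complex"
  assumes [measurable]: "\<And>k. X k \<in> borel_measurable K"
  shows "(\<lambda>\<omega>. rect_suminf (\<lambda>k. X k \<omega>)) \<in> borel_measurable K"
proof -
  note measurable_rect_convergent[measurable]
  show ?thesis unfolding rect_suminf_eq_lim
    by (intro measurable_If borel_measurable_lim_metric measurable_const) auto
qed

section \<open>Power series on the polydisc\<close>

text \<open>A finite index set lies in the product of its coordinate projections, and over such a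
  product the sum factorizes.\<close>

lemma summable_on_prod_vec:
  fixes a :: "'d::finite \<Rightarrow> nat \<Rightarrow> real"
  assumes nn: "\<And>i n. a i n \<ge> 0" and sm: "\<And>i. summable (a i)"
  shows "(\<lambda>k :: nat ^ 'd. \<Prod>i\<in>UNIV. a i (k $ i)) summable_on UNIV"
proof (rule nonneg_bdd_above_summable_on)
  show "(\<Prod>i\<in>UNIV. a i (k $ i)) \<ge> 0" for k by (intro prod_nonneg) (auto simp: nn)
  show "bdd_above (sum (\<lambda>k :: nat ^ 'd. \<Prod>i\<in>UNIV. a i (k $ i)) ` {F. F \<subseteq> UNIV \<and> finite F})"
  proof (rule bdd_aboveI2)
    fix F :: "(nat ^ 'd) set" assume "F \<in> {F. F \<subseteq> UNIV \<and> finite F}"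
    then have fin: "finite F" by simp
    define B where "B i = (\<lambda>k. k $ i) ` F" for i
    have "(\<Sum>k\<in>F. \<Prod>i\<in>UNIV. a i (k $ i)) = (\<Sum>g\<in>vec_nth ` F. \<Prod>i\<in>UNIV. a i (g i))"
      by (subst sum.reindex) (auto simp: inj_on_def vec_eq_iff)
    also have "\<dots> \<le> (\<Sum>g\<in>PiE UNIV B. \<Prod>i\<in>UNIV. a i (g i))"
      by (rule sum_mono2) (auto simp: B_def fin nn intro!: finite_PiE prod_nonneg)
    also have "\<dots> = (\<Prod>i\<in>UNIV. \<Sum>n\<in>B i. a i n)"
      by (rule prod_sum_PiE[symmetric]) (auto simp: B_def fin)
    also have "\<dots> \<le> (\<Prod>i\<in>UNIV. suminf (a i))"
      by (intro prod_mono conjI sum_nonneg sum_le_suminf) (auto simp: nn sm B_def fin)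
    finally show "(\<Sum>k\<in>F. \<Prod>i\<in>UNIV. a i (k $ i)) \<le> (\<Prod>i\<in>UNIV. suminf (a i))" .
  qed
qed

lemma has_sum_finite_sum:
  fixes f :: "'i \<Rightarrow> 'b \<Rightarrow> 'c::topological_comm_monoid_add"
  assumes "finite I" "\<And>i. i \<in> I \<Longrightarrow> (f i has_sum s i) A"
  shows "((\<lambda>x. \<Sum>i\<in>I. f i x) has_sum (\<Sum>i\<in>I. s i)) A"
  using assms
proof (induction I rule: finite_induct)
  case empty
  then show ?case by (simp add: has_sum_0)
next
  case (insert i I)
  then have "((\<lambda>x. f i x + (\<Sum>i\<in>I. f i x)) has_sum (s i + (\<Sum>i\<in>I. s i))) A"
    by (intro has_sum_add) auto
  then show ?case using insert by simp
qed

lemma norm_mpow: "norm (mpow z k) = (\<Prod>i\<in>UNIV. norm (z $ i) ^ (k $ i))"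
  by (simp add: mpow_def prod_norm[symmetric] norm_power)

lemma mpow_add: "mpow z (m + n) = mpow z m * mpow z n"
  by (simp add: mpow_def power_add prod.distrib)

lemma mpow_0 [simp]: "mpow z 0 = 1"
  by (simp add: mpow_def)

lemma summable_on_bounded_mult:
  fixes a :: "'b \<Rightarrow> 'c::real_normed_field" and s :: "'b \<Rightarrow> real"
  assumes "s summable_on A" "\<And>k. s k \<ge> 0" "\<And>k. norm (a k) \<le> B"
  shows "(\<lambda>k. norm (a k) * s k) summable_on A"
proof (rule summable_on_comparison_test)
  show "(\<lambda>k. B * s k) summable_on A" by (intro summable_on_cmult_right assms)
qed (auto intro: mult_right_mono mult_nonneg_nonneg assms)

lemma polydisc_series_summable:
  assumes z: "z \<in> polydisc" and B: "\<And>k. norm (\<alpha> k) \<le> B"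
  shows "(\<lambda>k. norm (\<alpha> k * mpow z k)) summable_on UNIV"
proof -
  have "(\<lambda>k. norm (mpow z k)) summable_on UNIV"
    unfolding norm_mpow using z
    by (intro summable_on_prod_vec) (auto simp: polydisc_def intro!: summable_geometric)
  then show ?thesis unfolding norm_mult by (rule summable_on_bounded_mult[where B = B]) (auto simp: B)
qed

lemma power_series_infsum:
  fixes \<alpha> :: "nat ^ 'd::finite \<Rightarrow> complex"
  assumes B: "\<And>k. norm (\<alpha> k) \<le> B"
  shows "power_series_on_polydisc \<alpha> (\<lambda>z. infsum (\<lambda>k. \<alpha> k * mpow z k) UNIV)"
  unfolding power_series_on_polydisc_def
proof
  fix z :: "complex ^ 'd" assume "z \<in> polydisc"
  then show "((\<lambda>k. \<alpha> k * mpow z k) has_sum (infsum (\<lambda>k. \<alpha> k * mpow z k) UNIV)) UNIV"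
    using has_sum_infsum[OF abs_summable_summable[OF polydisc_series_summable[where \<alpha> = \<alpha>, OF _ B]]] by blast
qed

section \<open>Termwise differentiation of power series in several variables\<close>

definition mpow_deriv :: "complex ^ 'd \<Rightarrow> nat ^ 'd \<Rightarrow> complex ^ 'd \<Rightarrow> complex" where
  "mpow_deriv z k h = (\<Sum>i\<in>(UNIV :: 'd::finite set).
     of_nat (k $ i) * h $ i * z $ i ^ (k $ i - 1) * (\<Prod>j\<in>UNIV - {i}. z $ j ^ (k $ j)))"

lemma has_derivative_mpow: "((\<lambda>z. mpow z k) has_derivative mpow_deriv z k) (at z within A)"
proof -
  have "((\<lambda>z. z $ i ^ (k $ i)) has_derivative (\<lambda>h. of_nat (k $ i) * h $ i * z $ i ^ (k $ i - 1))) (at z within A)" for i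
    by (rule has_derivative_power) (rule bounded_linear_imp_has_derivative[OF bounded_linear_vec_nth])
  from has_derivative_prod[OF this]
  show ?thesis unfolding mpow_def mpow_deriv_def .
qed

lemma mpow_deriv_smult: "mpow_deriv z k (c *s h) = c * mpow_deriv z k h"
  by (simp add: mpow_deriv_def sum_distrib_left mult_ac)

text \<open>Bounds the operator norm of \<open>mpow_deriv\<close> on the closed polydisc of radius
  \<open>r\<close>. The case distinction writes every summand as a product over all coordinates, the
  shape required by \<open>summable_on_prod_vec\<close>.\<close>

definition mpow_deriv_bound :: "real \<Rightarrow> nat ^ 'd::finite \<Rightarrow> real" where
  "mpow_deriv_bound r k = (\<Sum>i\<in>UNIV. \<Prod>j\<in>UNIV.
     (if j = i then of_nat (k $ j) * r ^ (k $ j - 1) else r ^ (k $ j)))"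

lemma summable_of_nat_geometric:
  fixes r :: real assumes "0 \<le> r" "r < 1"
  shows "summable (\<lambda>n. of_nat n * r ^ (n - 1))"
proof -
  have "summable (\<lambda>n. diffs (\<lambda>n. 1::real) n * r ^ n)"
    by (rule termdiff_converges[where K = 1]) (use assms in \<open>auto intro: summable_geometric\<close>)
  then have "summable (\<lambda>n. of_nat (Suc n) * r ^ (Suc n - 1))" by (simp add: diffs_def)
  then show ?thesis by (subst (asm) summable_Suc_iff)
qed

lemma summable_on_mpow_deriv_bound:
  assumes "0 \<le> r" "r < 1"
  shows "(mpow_deriv_bound r :: nat ^ 'd::finite \<Rightarrow> real) summable_on UNIV"
proof -
  define g where "g i k = (\<Prod>j\<in>UNIV. if j = i then of_nat (k $ j) * r ^ (k $ j - 1) else r ^ (k $ j))"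
    for i and k :: "nat ^ 'd"
  have "g i summable_on UNIV" for i
    unfolding g_def
  proof (rule summable_on_prod_vec)
    show "summable (\<lambda>n. if j = i then of_nat n * r ^ (n - 1) else r ^ n)" for j
      using assms summable_of_nat_geometric[OF assms]
      by (cases "j = i") (auto intro!: summable_geometric simp del: One_nat_def)
  qed (use assms in auto)
  then have "((\<lambda>k. \<Sum>i\<in>UNIV. g i k) has_sum (\<Sum>i\<in>UNIV. infsum (g i) UNIV)) UNIV"
    by (intro has_sum_finite_sum has_sum_infsum) auto
  then show ?thesis unfolding mpow_deriv_bound_def[abs_def] g_def summable_on_def by blast
qed

lemma norm_mpow_deriv:
  assumes r: "\<And>i. norm (z $ i) \<le> r" "0 \<le> r"
  shows "norm (mpow_deriv z k h) \<le> mpow_deriv_bound r k * norm h"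
proof -
  have "norm (mpow_deriv z k h) \<le> (\<Sum>i\<in>UNIV. norm (of_nat (k $ i) * h $ i * z $ i ^ (k $ i - 1) * (\<Prod>j\<in>UNIV - {i}. z $ j ^ (k $ j))))"
    unfolding mpow_deriv_def by (rule norm_sum)
  also have "\<dots> \<le> (\<Sum>i\<in>UNIV. (\<Prod>j\<in>UNIV.
     (if j = i then of_nat (k $ j) * r ^ (k $ j - 1) else r ^ (k $ j))) * norm h)"
  proof (rule sum_mono)
    fix i
    have eq: "(\<Prod>j\<in>UNIV. (if j = i then of_nat (k $ j) * r ^ (k $ j - 1) else r ^ (k $ j)))
      = of_nat (k $ i) * r ^ (k $ i - 1) * (\<Prod>j\<in>UNIV - {i}. r ^ (k $ j))"
      by (subst prod.remove[of _ i]) (auto intro!: prod.cong)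
    have "norm (of_nat (k $ i) * h $ i * z $ i ^ (k $ i - 1) * (\<Prod>j\<in>UNIV - {i}. z $ j ^ (k $ j)))
      = of_nat (k $ i) * norm (h $ i) * norm (z $ i) ^ (k $ i - 1) * (\<Prod>j\<in>UNIV - {i}. norm (z $ j) ^ (k $ j))"
      by (simp add: norm_mult norm_power prod_norm[symmetric])
    also have "\<dots> \<le> of_nat (k $ i) * norm h * r ^ (k $ i - 1) * (\<Prod>j\<in>UNIV - {i}. r ^ (k $ j))"
      by (intro mult_mono prod_mono power_mono mult_nonneg_nonneg prod_nonneg conjI)
         (auto simp: r Finite_Cartesian_Product.norm_nth_le)
    finally show "norm (of_nat (k $ i) * h $ i * z $ i ^ (k $ i - 1) * (\<Prod>j\<in>UNIV - {i}. z $ j ^ (k $ j)))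
      \<le> (\<Prod>j\<in>UNIV. (if j = i then of_nat (k $ j) * r ^ (k $ j - 1) else r ^ (k $ j))) * norm h"
      unfolding eq by (simp add: mult_ac)
  qed
  finally show ?thesis by (simp add: mpow_deriv_bound_def sum_distrib_right)
qed

lemma infinite_nat_vec: "infinite (UNIV :: (nat ^ 'd::finite) set)"
proof -
  have "inj (\<lambda>n::nat. (\<chi> i. n) :: nat ^ 'd)" by (auto simp: inj_def vec_eq_iff)
  then show ?thesis using finite_imageD infinite_UNIV_nat infinite_super subset_UNIV by metis
qed

lemma open_small_polydisc: "open {z :: complex ^ 'd::finite. \<forall>i. norm (z $ i) < r}"
proof -
  have "open (\<Inter>i. (\<lambda>z :: complex ^ 'd. z $ i) -` ball 0 r)"
    by (intro open_INT ballI open_vimage_vec_nth open_ball) auto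
  also have "(\<Inter>i. (\<lambda>z :: complex ^ 'd. z $ i) -` ball 0 r) = {z. \<forall>i. norm (z $ i) < r}" by auto
  finally show ?thesis .
qed

lemma convex_small_polydisc: "convex {z :: complex ^ 'd::finite. \<forall>i. norm (z $ i) < r}"
proof -
  have "convex ((\<lambda>z :: complex ^ 'd. z $ i) -` ball 0 r)" for i
    by (rule convex_linear_vimage[OF bounded_linear.linear[OF bounded_linear_vec_nth] convex_ball])
  then have "convex (\<Inter>i. (\<lambda>z :: complex ^ 'd. z $ i) -` ball 0 r)" by (intro convex_INT)
  also have "(\<Inter>i. (\<lambda>z :: complex ^ 'd. z $ i) -` ball 0 r) = {z. \<forall>i. norm (z $ i) < r}" by auto
  finally show ?thesis .
qed

text \<open>The series is enumerated over the natural numbers and differentiated term by term on a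
  convex open polydisc around the point, where \<open>c\<close> is a summable majorant of the
  derivatives. Complex linearity passes from the terms to the sum.\<close>

lemma power_series_mholomorphic:
  fixes \<alpha> :: "nat ^ 'd::finite \<Rightarrow> complex"
  assumes B: "\<And>k. norm (\<alpha> k) \<le> B" and ps: "power_series_on_polydisc \<alpha> f"
  shows "mholomorphic_on f polydisc"
  unfolding mholomorphic_on_def
proof
  fix z :: "complex ^ 'd" assume z: "z \<in> polydisc"
  obtain e :: "nat \<Rightarrow> nat ^ 'd" where e: "bij_betw e UNIV UNIV"
    using bij_betw_from_nat_into[OF _ infinite_nat_vec] by auto
  \<comment> \<open>Midway between the largest modulus of a coordinate of \<open>z\<close> and 1:
    \<open>z\<close> is interior, and the derivative bounds are still summable.\<close>
  obtain r where r: "0 \<le> r" "r < 1" and zr: "\<And>i. norm (z $ i) < r"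
  proof -
    define m where "m = Max (range (\<lambda>i. norm (z $ i)))"
    have m1: "m < 1" unfolding m_def using z by (subst Max_less_iff) (auto simp: polydisc_def)
    have "norm (z $ i) \<le> m" for i unfolding m_def by simp
    moreover from this[of undefined] have "0 \<le> m" using norm_ge_zero order_trans by blast
    moreover have "m < (m + 1) / 2" "(m + 1) / 2 < 1" using m1 by auto
    ultimately show ?thesis by (intro that[of "(m + 1) / 2"]) (linarith, linarith, metis le_less_trans)
  qed
  define S where "S = {z :: complex ^ 'd. \<forall>i. norm (z $ i) < r}"
  have S: "open S" "convex S" "z \<in> S"
    unfolding S_def using zr by (auto simp: open_small_polydisc convex_small_polydisc)
  have Sp: "S \<subseteq> polydisc" unfolding S_def polydisc_def using r by (auto intro: less_trans)
  define c where "c n = norm (\<alpha> (e n)) * mpow_deriv_bound r (e n)" for n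
  have "(\<lambda>k. norm (\<alpha> k) * mpow_deriv_bound r k) summable_on UNIV"
    by (rule summable_on_bounded_mult)
       (use r B in \<open>auto simp: mpow_deriv_bound_def intro!: sum_nonneg prod_nonneg
          summable_on_mpow_deriv_bound[unfolded mpow_deriv_bound_def]\<close>)
  then have c: "summable c"
    unfolding c_def using summable_on_reindex_bij_betw[OF e] summable_on_imp_summable by blast
  have c0: "c n \<ge> 0" for n unfolding c_def mpow_deriv_bound_def
    by (intro mult_nonneg_nonneg sum_nonneg prod_nonneg) (use r in auto)
  define D where "D n x h = \<alpha> (e n) * mpow_deriv x (e n) h" for n x h
  have D: "norm (D n x h) \<le> c n * norm h" if "x \<in> S" for n x h
  proof -
    have "norm (mpow_deriv x (e n) h) \<le> mpow_deriv_bound r (e n) * norm h"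
      by (rule norm_mpow_deriv) (use that r in \<open>auto simp: S_def intro: less_imp_le\<close>)
    then show ?thesis unfolding D_def c_def norm_mult mult.assoc by (intro mult_left_mono) auto
  qed
  have smD: "summable (\<lambda>n. norm (D n x h))" if "x \<in> S" for x h
    by (rule summable_comparison_test[OF _ summable_mult2[OF c, of "norm h"]]) (use D[OF that] in auto)
  have sums: "(\<lambda>n. \<alpha> (e n) * mpow x (e n)) sums f x" if "x \<in> S" for x
  proof -
    have "((\<lambda>k. \<alpha> k * mpow x k) has_sum f x) UNIV"
      using ps that Sp unfolding power_series_on_polydisc_def by blast
    then show ?thesis using has_sum_reindex_bij_betw[OF e, of "\<lambda>k. \<alpha> k * mpow x k"] by (intro has_sum_imp_sums) simp
  qed
  have "\<exists>g. \<forall>x\<in>S. (\<lambda>n. \<alpha> (e n) * mpow x (e n)) sums (g x) \<and>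
     (g has_derivative (\<lambda>h. \<Sum>n. D n x h)) (at x within S)"
  proof (rule has_derivative_series[OF S(2)])
    show "((\<lambda>z. \<alpha> (e n) * mpow z (e n)) has_derivative D n x) (at x within S)" for n x
      unfolding D_def by (intro has_derivative_mult_right has_derivative_mpow)
    show "z \<in> S" by fact
    show "(\<lambda>n. \<alpha> (e n) * mpow z (e n)) sums f z" by (rule sums[OF S(3)])
    fix \<epsilon> :: real assume "\<epsilon> > 0"
    from suminf_exist_split[OF this c] obtain N where N: "\<And>n. n \<ge> N \<Longrightarrow> norm (\<Sum>i. c (i + n)) < \<epsilon>" by blast
    show "\<forall>\<^sub>F n in sequentially. \<forall>x\<in>S. \<forall>h. norm ((\<Sum>i<n. D i x h) - (\<Sum>i. D i x h)) \<le> \<epsilon> * norm h"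
    proof (rule eventually_sequentiallyI[of N], intro ballI allI)
      fix n x h assume n: "n \<ge> N" and x: "x \<in> S"
      have "norm ((\<Sum>i<n. D i x h) - (\<Sum>i. D i x h)) = norm (\<Sum>i. D (i + n) x h)"
        using suminf_minus_initial_segment[OF summable_norm_cancel[OF smD[OF x, of h]], of n]
        by (simp add: norm_minus_commute)
      also have "\<dots> \<le> (\<Sum>i. norm (D (i + n) x h))"
        by (rule summable_norm) (use summable_ignore_initial_segment[OF smD[OF x]] in auto)
      also have "\<dots> \<le> (\<Sum>i. c (i + n) * norm h)"
        by (rule suminf_le) (use D[OF x] summable_ignore_initial_segment[OF smD[OF x]]
              summable_mult2[OF summable_ignore_initial_segment[OF c]] in auto)
      also have "\<dots> = (\<Sum>i. c (i + n)) * norm h"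
        by (rule suminf_mult2[symmetric]) (use summable_ignore_initial_segment[OF c] in auto)
      also have "\<dots> \<le> \<epsilon> * norm h" using N[OF n] by (intro mult_right_mono) auto
      finally show "norm ((\<Sum>i<n. D i x h) - (\<Sum>i. D i x h)) \<le> \<epsilon> * norm h" .
    qed
  qed
  then obtain g where g: "\<And>x. x \<in> S \<Longrightarrow> (\<lambda>n. \<alpha> (e n) * mpow x (e n)) sums (g x)"
     "\<And>x. x \<in> S \<Longrightarrow> (g has_derivative (\<lambda>h. \<Sum>n. D n x h)) (at x within S)" by blast
  have "(g has_derivative (\<lambda>h. \<Sum>n. D n z h)) (at z)"
    using g(2)[OF S(3)] at_within_open[OF S(3) S(1)] by simp
  then have "(f has_derivative (\<lambda>h. \<Sum>n. D n z h)) (at z)"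
    by (rule has_derivative_transform_within_open[OF _ S(1) S(3)]) (metis sums g(1) sums_unique2)
  moreover have "(\<Sum>n. D n z (a *s v)) = a * (\<Sum>n. D n z v)" for a v
    using suminf_mult[OF summable_norm_cancel[OF smD[OF S(3), of v]], of a]
    by (simp add: D_def mpow_deriv_smult mult.left_commute)
  ultimately show "\<exists>f'. (f has_derivative f') (at z) \<and> (\<forall>c v. f' (c *s v) = c * f' v)" by blast
qed

text \<open>The expansion of Phi f - Theta. Its coefficients are the defects of the recursion, so it
  serves both ways: the recursion gives Phi f = Theta, and Phi f = Theta gives the recursion once
  coefficients are known to be unique.\<close>

lemma arma_series_identity:
  fixes \<phi> \<theta> :: "nat ^ 'd::finite \<Rightarrow> complex"
  assumes R: "finite R" and S: "finite S" "0 \<notin> S"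
    and ps: "power_series_on_polydisc \<alpha> f" and z: "z \<in> polydisc"
  shows "((\<lambda>j. (\<alpha> j - (\<Sum>n | n \<in> R \<and> n \<le> j. \<phi> n * \<alpha> (j - n)) - ma_coeff S \<theta> j) * mpow z j)
    has_sum (ar_poly R \<phi> z * f z - ma_poly S \<theta> z)) UNIV"
proof -
  have f: "((\<lambda>k. \<alpha> k * mpow z k) has_sum f z) UNIV"
    using ps z unfolding power_series_on_polydisc_def by blast
  have 1: "((\<lambda>j. (if n \<le> j then \<phi> n * \<alpha> (j - n) else 0) * mpow z j) has_sum (\<phi> n * mpow z n * f z)) UNIV" for n
  proof -
    have "((\<lambda>k. \<phi> n * mpow z n * (\<alpha> k * mpow z k)) has_sum (\<phi> n * mpow z n * f z)) UNIV"
      by (intro has_sum_cmult_right f)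
    also have "(\<lambda>k. \<phi> n * mpow z n * (\<alpha> k * mpow z k)) = (\<lambda>j. \<phi> n * \<alpha> (j - n) * mpow z j) \<circ> (\<lambda>k. n + k)"
    proof
      fix k :: "nat ^ 'd"
      have "n + k - n = k" by (simp add: vec_eq_iff)
      then show "\<phi> n * mpow z n * (\<alpha> k * mpow z k) = ((\<lambda>j. \<phi> n * \<alpha> (j - n) * mpow z j) \<circ> (\<lambda>k. n + k)) k"
        by (simp add: mpow_add mult_ac)
    qed
    finally have "((\<lambda>j. \<phi> n * \<alpha> (j - n) * mpow z j) \<circ> (\<lambda>k. n + k) has_sum (\<phi> n * mpow z n * f z)) UNIV" .
    moreover have "inj (\<lambda>k. n + k)" by (simp add: inj_def)
    ultimately have "((\<lambda>j. \<phi> n * \<alpha> (j - n) * mpow z j) has_sum (\<phi> n * mpow z n * f z)) (range (\<lambda>k. n + k))"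
      using has_sum_reindex by blast
    moreover have "j \<in> range (\<lambda>k. n + k) \<longleftrightarrow> n \<le> j" for j
    proof
      assume "n \<le> j"
      then have "j = n + (j - n)" by (simp add: vec_eq_iff less_eq_vec_def)
      then show "j \<in> range (\<lambda>k. n + k)" by blast
    qed (auto simp: less_eq_vec_def)
    ultimately show ?thesis
      by (subst has_sum_cong_neutral[where T = "range (\<lambda>k. n + k)" and g = "\<lambda>j. \<phi> n * \<alpha> (j - n) * mpow z j"]) auto
  qed
  have 2: "((\<lambda>j. (\<Sum>n | n \<in> R \<and> n \<le> j. \<phi> n * \<alpha> (j - n)) * mpow z j) has_sum (\<Sum>n\<in>R. \<phi> n * mpow z n * f z)) UNIV"
  proof -
    have "((\<lambda>j. \<Sum>n\<in>R. (if n \<le> j then \<phi> n * \<alpha> (j - n) else 0) * mpow z j) has_sum (\<Sum>n\<in>R. \<phi> n * mpow z n * f z)) UNIV"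
      by (intro has_sum_finite_sum R 1)
    also have "(\<lambda>j. \<Sum>n\<in>R. (if n \<le> j then \<phi> n * \<alpha> (j - n) else 0) * mpow z j) =
      (\<lambda>j. (\<Sum>n | n \<in> R \<and> n \<le> j. \<phi> n * \<alpha> (j - n)) * mpow z j)"
      by (simp add: sum_distrib_right[symmetric] sum.inter_filter[OF R])
    finally show ?thesis .
  qed
  have 3: "((\<lambda>j. ma_coeff S \<theta> j * mpow z j) has_sum ma_poly S \<theta> z) UNIV"
  proof (subst has_sum_cong_neutral[where T = "insert 0 S" and g = "\<lambda>j. ma_coeff S \<theta> j * mpow z j"])
    have "(\<Sum>n\<in>S. ma_coeff S \<theta> n * mpow z n) = (\<Sum>n\<in>S. \<theta> n * mpow z n)"
      using S by (intro sum.cong) (auto simp: ma_coeff_def)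
    then have "(\<Sum>j\<in>insert 0 S. ma_coeff S \<theta> j * mpow z j) = ma_poly S \<theta> z"
      using S by (simp add: ma_poly_def) (simp add: ma_coeff_def)
    then show "((\<lambda>j. ma_coeff S \<theta> j * mpow z j) has_sum ma_poly S \<theta> z) (insert 0 S)"
      using S by (intro has_sum_finiteI) auto
  qed (auto simp: ma_coeff_def)
  have "ar_poly R \<phi> z * f z - ma_poly S \<theta> z = f z + - (\<Sum>n\<in>R. \<phi> n * mpow z n * f z) + - ma_poly S \<theta> z"
    by (simp add: ar_poly_def left_diff_distrib sum_distrib_right)
  then show ?thesis
    using has_sum_add[OF has_sum_add[OF f has_sum_uminusI[OF 2]] has_sum_uminusI[OF 3]]
    by (simp add: left_diff_distrib)
qed

section \<open>Parseval's identity on the torus\<close>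

text \<open>Lebesgue measure on \<open>real ^ 'd\<close> is the image of a product measure indexed
  by \<open>Basis\<close>. Identifying \<open>Basis\<close> with the coordinates reduces the claim
  to Fubini for products of one-variable functions.\<close>

lemma lborel_integral_vec_prod:
  fixes h :: "'d::finite \<Rightarrow> real \<Rightarrow> complex"
  assumes h: "\<And>i. integrable lborel (h i)"
  shows "integrable lborel (\<lambda>t :: real ^ 'd. \<Prod>i\<in>UNIV. h i (t $ i))"
    and "(LINT t|lborel. (\<Prod>i\<in>UNIV. h i ((t :: real ^ 'd) $ i))) = (\<Prod>i\<in>UNIV. integral\<^sup>L lborel (h i))"
proof -
  define ax :: "'d \<Rightarrow> real ^ 'd" where "ax i = axis i 1" for i
  have inj: "inj ax" by (auto simp: inj_def ax_def axis_eq_axis)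
  have Basis: "Basis = range ax" by (auto simp: Basis_vec_def ax_def)
  interpret product_sigma_finite "\<lambda>_ :: real ^ 'd. lborel :: real measure" ..
  define H where "H b = h (inv ax b)" for b
  have H: "integrable lborel (H b)" for b unfolding H_def by (rule h)
  let ?g = "\<lambda>f. \<Sum>b\<in>Basis. f b *\<^sub>R b :: real ^ 'd"
  have g: "?g \<in> measurable (\<Pi>\<^sub>M b\<in>Basis. lborel) borel"
    by measurable
  have comp: "(?g f) $ i = f (ax i)" for f i
  proof -
    have "(?g f) $ i = (\<Sum>j\<in>UNIV. f (ax j) * ax j $ i)"
      unfolding Basis by (subst sum.reindex[OF inj]) simp
    also have "\<dots> = (\<Sum>j\<in>UNIV. if j = i then f (ax j) else 0)"
      by (intro sum.cong) (auto simp: ax_def axis_def)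
    finally show ?thesis by simp
  qed
  have prod: "(\<Prod>i\<in>UNIV. h i (f (ax i))) = (\<Prod>b\<in>Basis. H b (f b))" for f
    unfolding Basis by (subst prod.reindex[OF inj]) (simp add: H_def inv_f_f[OF inj])
  have hb[measurable]: "h i \<in> borel_measurable borel" for i
    using borel_measurable_integrable[OF h] by simp
  have meas: "(\<lambda>t :: real ^ 'd. \<Prod>i\<in>UNIV. h i (t $ i)) \<in> borel_measurable borel"
    by (intro borel_measurable_prod measurable_compose[OF _ hb] borel_measurable_continuous_onI continuous_intros)
  have "integrable (\<Pi>\<^sub>M b\<in>(Basis :: (real ^ 'd) set). lborel) (\<lambda>f. \<Prod>b\<in>Basis. H b (f b))"
    by (rule product_integrable_prod) (auto simp: H)
  then show "integrable lborel (\<lambda>t :: real ^ 'd. \<Prod>i\<in>UNIV. h i (t $ i))"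
    by (subst lborel_eq, subst integrable_distr_eq[OF g meas]) (simp only: comp prod)
  have "(LINT t|lborel. (\<Prod>i\<in>UNIV. h i ((t :: real ^ 'd) $ i))) =
    (LINT f|(\<Pi>\<^sub>M b\<in>(Basis :: (real ^ 'd) set). lborel). (\<Prod>b\<in>Basis. H b (f b)))"
    by (subst lborel_eq, subst integral_distr[OF g meas]) (simp only: comp prod)
  also have "\<dots> = (\<Prod>b\<in>Basis. integral\<^sup>L lborel (H b))"
    by (rule product_integral_prod) (auto simp: H)
  also have "\<dots> = (\<Prod>i\<in>UNIV. integral\<^sup>L lborel (h i))"
    unfolding Basis by (subst prod.reindex[OF inj]) (simp add: H_def inv_f_f[OF inj])
  finally show "(LINT t|lborel. (\<Prod>i\<in>UNIV. h i ((t :: real ^ 'd) $ i))) = (\<Prod>i\<in>UNIV. integral\<^sup>L lborel (h i))" .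
qed

definition torus_box :: "(real ^ 'd::finite) set" where
  "torus_box = {t. \<forall>i. - pi < t $ i \<and> t $ i \<le> pi}"

text \<open>The character exp(-i k.t) of the torus, with the sign convention of
  \<open>hardy_mean\<close>.\<close>

definition torus_char :: "nat ^ 'd \<Rightarrow> real ^ 'd::finite \<Rightarrow> complex" where
  "torus_char k t = (\<Prod>i\<in>UNIV. exp (- \<i> * of_real (t $ i)) ^ (k $ i))"

lemma mpow_torus:
  "mpow (\<chi> i. of_real r * exp (- \<i> * of_real (t $ i))) k = of_real (\<Prod>i\<in>UNIV. r ^ (k $ i)) * torus_char k t"
  unfolding mpow_def torus_char_def vec_lambda_beta power_mult_distrib prod.distrib of_real_prod of_real_power ..

lemma norm_torus_char [simp]: "norm (torus_char k t) = 1"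
  by (simp add: torus_char_def prod_norm[symmetric] norm_power)

lemma integral_exp_circle:
  fixes m :: int
  defines "e \<equiv> \<lambda>s. indicator {- pi<..pi} s *\<^sub>R exp (\<i> * of_int m * of_real s)"
  shows "integrable lborel e" "integral\<^sup>L lborel e = (if m = 0 then of_real (2 * pi) else 0)"
proof -
  have c: "continuous_on {- pi..pi} (\<lambda>s. exp (\<i> * of_int m * of_real s))"
    by (intro continuous_intros)
  have i: "integrable lborel (\<lambda>s. indicator {- pi..pi} s *\<^sub>R exp (\<i> * of_int m * of_real s))"
    using borel_integrable_compact[OF compact_Icc c] .
  \<comment> \<open>The half-open interval comes from \<open>hardy_mean\<close>; the fundamental
    theorem of calculus wants the closed one. They differ by the null set of the left
    endpoint.\<close>
  have ae: "AE s in lborel. e s = indicator {- pi..pi} s *\<^sub>R exp (\<i> * of_int m * of_real s)"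
    using AE_lborel_singleton[of "- pi"] by eventually_elim (auto simp: e_def indicator_def)
  have [measurable]: "e \<in> borel_measurable lborel"
    unfolding e_def by measurable
  show "integrable lborel e"
    using integrable_cong_AE[OF _ _ ae] i borel_measurable_integrable[OF i] by simp
  have "integral\<^sup>L lborel e = integral\<^sup>L lborel (\<lambda>s. indicator {- pi..pi} s *\<^sub>R exp (\<i> * of_int m * of_real s))"
    by (rule integral_cong_AE[OF _ _ ae]) (use borel_measurable_integrable[OF i] in auto)
  also have "\<dots> = (if m = 0 then of_real (2 * pi) else 0)"
  proof (cases "m = 0")
    case True
    then show ?thesis by (simp add: scaleR_conv_of_real)
  next
    case False
    define F where "F s = exp (\<i> * of_int m * of_real s) / (\<i> * of_int m)" for s :: real
    have "integral\<^sup>L lborel (\<lambda>s. indicator {- pi..pi} s *\<^sub>R exp (\<i> * of_int m * of_real s)) = F pi - F (- pi)"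
    proof (rule integral_FTC_atLeastAtMost[OF _ _ c])
      fix x :: real
      have "((\<lambda>z. exp (\<i> * of_int m * z) / (\<i> * of_int m)) has_field_derivative exp (\<i> * of_int m * of_real x)) (at (of_real x))"
        using False by (auto intro!: derivative_eq_intros)
      from has_vector_derivative_real_field[OF this]
      show "(F has_vector_derivative exp (\<i> * of_int m * of_real x)) (at x within {- pi..pi})"
        unfolding F_def .
    qed simp
    also have "exp (\<i> * of_int m * of_real pi) = exp (\<i> * of_int m * of_real (- pi) + \<i> * (of_int m * (of_real pi * 2)))"
      by (rule arg_cong[where f = exp]) (simp add: algebra_simps)
    then have "F pi - F (- pi) = 0" unfolding F_def by (simp only: exp_plus_2pin) simp
    finally show ?thesis using False by simp
  qed
  finally show "integral\<^sup>L lborel e = (if m = 0 then of_real (2 * pi) else 0)" .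
qed

lemma torus_char_orthogonal:
  fixes k l :: "nat ^ 'd::finite"
  defines "g \<equiv> \<lambda>t. indicator torus_box t *\<^sub>R (torus_char k t * cnj (torus_char l t))"
  shows "integrable lborel g" "integral\<^sup>L lborel g = (if k = l then of_real ((2 * pi) ^ CARD('d)) else 0)"
proof -
  define h where "h i s = indicator {- pi<..pi} s *\<^sub>R exp (\<i> * of_int (int (l $ i) - int (k $ i)) * of_real s)" for i and s :: real
  have g: "g = (\<lambda>t. \<Prod>i\<in>UNIV. h i (t $ i))"
  proof
    fix t :: "real ^ 'd"
    have "exp (\<i> * of_int (int (l $ i) - int (k $ i)) * of_real (t $ i)) =
       exp (- \<i> * of_real (t $ i)) ^ (k $ i) * cnj (exp (- \<i> * of_real (t $ i)) ^ (l $ i))" for i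
      by (simp add: exp_of_nat_mult[symmetric] exp_cnj exp_add[symmetric] algebra_simps flip: complex_cnj_power)
    then have "(\<Prod>i\<in>UNIV. exp (\<i> * of_int (int (l $ i) - int (k $ i)) * of_real (t $ i))) = torus_char k t * cnj (torus_char l t)"
      by (simp add: torus_char_def prod.distrib cnj_prod)
    moreover have "indicator torus_box t = (\<Prod>i\<in>UNIV. indicator {- pi<..pi} (t $ i) :: real)"
      by (auto simp: torus_box_def indicator_def intro!: prod_zero[symmetric] prod.neutral[symmetric])
    ultimately show "g t = (\<Prod>i\<in>UNIV. h i (t $ i))"
      unfolding g_def h_def by (simp add: scaleR_conv_of_real prod.distrib)
  qed
  have hi: "integrable lborel (h i)" for i unfolding h_def by (rule integral_exp_circle)
  show "integrable lborel g" unfolding g by (rule lborel_integral_vec_prod) (rule hi)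
  have "integral\<^sup>L lborel g = (\<Prod>i\<in>UNIV. integral\<^sup>L lborel (h i))"
    unfolding g by (rule lborel_integral_vec_prod) (rule hi)
  also have "\<dots> = (\<Prod>i\<in>UNIV. if k $ i = l $ i then of_real (2 * pi) else 0)"
    unfolding h_def integral_exp_circle by (intro prod.cong) auto
  also have "\<dots> = (if k = l then of_real ((2 * pi) ^ CARD('d)) else 0)"
    by (auto simp: vec_eq_iff intro!: prod_zero)
  finally show "integral\<^sup>L lborel g = (if k = l then of_real ((2 * pi) ^ CARD('d)) else 0)" .
qed

text \<open>Expanding the square leaves only the diagonal, by orthogonality of the characters.
  Finite sums suffice because infinite series are approximated uniformly on the torus below.\<close>

lemma torus_Parseval:
  fixes c :: "nat ^ 'd::finite \<Rightarrow> complex"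
  assumes F: "finite F"
  defines "g \<equiv> \<lambda>t. indicator torus_box t *\<^sub>R (norm (\<Sum>k\<in>F. c k * torus_char k t))\<^sup>2"
  shows "integrable lborel g" "integral\<^sup>L lborel g = (2 * pi) ^ CARD('d) * (\<Sum>k\<in>F. (norm (c k))\<^sup>2)"
proof -
  have eq: "complex_of_real (g t) =
    (\<Sum>k\<in>F. \<Sum>l\<in>F. c k * cnj (c l) * (indicator torus_box t *\<^sub>R (torus_char k t * cnj (torus_char l t))))" for t
  proof -
    have "complex_of_real (g t) = indicator torus_box t *\<^sub>R
       ((\<Sum>k\<in>F. c k * torus_char k t) * cnj (\<Sum>l\<in>F. c l * torus_char l t))"
      unfolding g_def complex_norm_square[symmetric] by (simp add: scaleR_conv_of_real)
    also have "\<dots> = (\<Sum>k\<in>F. \<Sum>l\<in>F. c k * cnj (c l) * (indicator torus_box t *\<^sub>R (torus_char k t * cnj (torus_char l t))))"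
      unfolding cnj_sum sum_product scaleR_sum_right by (intro sum.cong) (auto simp: mult_ac)
    finally show ?thesis .
  qed
  have hb: "has_bochner_integral lborel (\<lambda>t. indicator torus_box t *\<^sub>R (torus_char k t * cnj (torus_char l t)))
     (if k = l then of_real ((2 * pi) ^ CARD('d)) else 0)" for k l :: "nat ^ 'd"
    unfolding has_bochner_integral_iff by (intro conjI torus_char_orthogonal)
  have "has_bochner_integral lborel (\<lambda>t. complex_of_real (g t))
    (\<Sum>k\<in>F. \<Sum>l\<in>F. c k * cnj (c l) * (if k = l then of_real ((2 * pi) ^ CARD('d)) else 0))"
    unfolding eq
    by (intro has_bochner_integral_sum has_bochner_integral_mult_right hb)
  then have int: "integrable lborel (\<lambda>t. complex_of_real (g t))"
    and val: "integral\<^sup>L lborel (\<lambda>t. complex_of_real (g t)) =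
      (\<Sum>k\<in>F. \<Sum>l\<in>F. c k * cnj (c l) * (if k = l then of_real ((2 * pi) ^ CARD('d)) else 0))"
    unfolding has_bochner_integral_iff by blast+
  show "integrable lborel g" using integrable_Re[OF int] by simp
  have "complex_of_real (integral\<^sup>L lborel g) = integral\<^sup>L lborel (\<lambda>t. complex_of_real (g t))"
    by simp
  also have "\<dots> = (\<Sum>k\<in>F. \<Sum>l\<in>F. c k * cnj (c l) * (if k = l then of_real ((2 * pi) ^ CARD('d)) else 0))"
    by (rule val)
  also have "\<dots> = (\<Sum>k\<in>F. c k * cnj (c k) * of_real ((2 * pi) ^ CARD('d)))"
    using F by (intro sum.cong) (simp_all add: if_distrib[of "\<lambda>x. _ * x"] cong: if_cong)
  also have "\<dots> = complex_of_real ((2 * pi) ^ CARD('d) * (\<Sum>k\<in>F. (norm (c k))\<^sup>2))"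
    unfolding complex_norm_square[symmetric] by (simp add: sum_distrib_left mult_ac)
  finally show "integral\<^sup>L lborel g = (2 * pi) ^ CARD('d) * (\<Sum>k\<in>F. (norm (c k))\<^sup>2)"
    using of_real_eq_iff by blast
qed

text \<open>Parseval for the constant function 1, i.e. the single index 0.\<close>

lemma integrable_torus_box: "integrable lborel (\<lambda>t :: real ^ 'd::finite. indicator torus_box t :: real)"
  and measure_torus_box: "measure lborel (torus_box :: (real ^ 'd) set) = (2 * pi) ^ CARD('d)"
proof -
  have *: "(norm (\<Sum>k\<in>{0 :: nat ^ 'd}. 1 * torus_char k t))\<^sup>2 = 1" for t :: "real ^ 'd"
    by simp
  show "integrable lborel (\<lambda>t :: real ^ 'd. indicator torus_box t :: real)"
    using torus_Parseval(1)[of "{0 :: nat ^ 'd}" "\<lambda>_. 1"] unfolding * by simp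
  show "measure lborel (torus_box :: (real ^ 'd) set) = (2 * pi) ^ CARD('d)"
    using torus_Parseval(2)[of "{0 :: nat ^ 'd}" "\<lambda>_. 1"] unfolding * by simp
qed

text \<open>The set \<open>F\<close> depends on the majorant \<open>s\<close> alone. On a torus of
  fixed radius all moduli of the terms are constant, so one \<open>F\<close> works at every
  point.\<close>

lemma finite_partial_sum_close:
  fixes s :: "'b \<Rightarrow> real"
  assumes s: "s summable_on UNIV" "\<And>k. s k \<ge> 0" and \<epsilon>: "\<epsilon> > 0"
  obtains F where "finite F" "\<And>G (g :: 'b \<Rightarrow> complex) L. finite G \<Longrightarrow> F \<subseteq> G \<Longrightarrow> (\<And>k. norm (g k) \<le> s k) \<Longrightarrow>
     (g has_sum L) UNIV \<Longrightarrow> norm (L - sum g G) \<le> \<epsilon>"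
proof -
  have hs: "(s has_sum infsum s UNIV) UNIV" using s by simp
  from has_sum_finite_approximation[OF hs \<epsilon>] obtain F where F: "finite F" "dist (sum s F) (infsum s UNIV) \<le> \<epsilon>"
    by auto
  show ?thesis
  proof (rule that[OF F(1)])
    fix G and g :: "'b \<Rightarrow> complex" and L
    assume G: "finite G" "F \<subseteq> G" and g: "\<And>k. norm (g k) \<le> s k" and L: "(g has_sum L) UNIV"
    have sG: "sum s F \<le> sum s G" using G s by (intro sum_mono2) auto
    have 1: "(s has_sum (infsum s UNIV - sum s G)) (UNIV - G)"
      by (rule has_sum_Diff[OF hs]) (use G in auto)
    have 2: "(g has_sum (L - sum g G)) (UNIV - G)"
      by (rule has_sum_Diff[OF L]) (use G in auto)
    have 3: "(\<lambda>k. norm (g k)) summable_on (UNIV - G)"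
      by (rule summable_on_comparison_test[of s]) (use 1 g in \<open>auto simp: summable_on_def\<close>)
    have "norm (L - sum g G) \<le> infsum (\<lambda>k. norm (g k)) (UNIV - G)"
      by (rule norm_has_sum_bound[OF _ 2]) (use 3 in simp)
    also have "\<dots> \<le> infsum s UNIV - sum s G"
      by (rule has_sum_mono[OF has_sum_infsum[OF 3] 1]) (use g in auto)
    also have "\<dots> \<le> \<epsilon>" using F(2) sG by (simp add: dist_real_def)
    finally show "norm (L - sum g G) \<le> \<epsilon>" .
  qed
qed

lemma torus_point_in_polydisc:
  assumes "0 \<le> r" "r < 1"
  shows "(\<chi> i. of_real r * exp (- \<i> * of_real (t $ i))) \<in> polydisc"
proof -
  have "norm (exp (- \<i> * of_real x)) = 1" for x :: real by simp
  then show ?thesis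
    using assms unfolding polydisc_def mem_Collect_eq vec_lambda_beta norm_mult by simp
qed

text \<open>On the torus of radius 1/2 the series is zero, so large finite partial sums are
  uniformly at most \<open>\<epsilon>\<close>. Parseval then bounds each single coefficient,
  weighted by \<open>q k > 0\<close>, by the arbitrary \<open>\<epsilon>\<close>.\<close>

lemma power_series_coeff_zero:
  fixes c :: "nat ^ 'd::finite \<Rightarrow> complex"
  assumes c: "\<And>z. z \<in> polydisc \<Longrightarrow> ((\<lambda>k. c k * mpow z k) has_sum 0) UNIV"
  shows "c k = 0"
proof -
  define r :: real where "r = 1 / 2"
  define q where "q k = (\<Prod>i\<in>UNIV. r ^ (k $ i))" for k :: "nat ^ 'd"
  have q: "q k > 0" for k unfolding q_def r_def by (intro prod_pos) auto
  define w where "w t = (\<chi> i. of_real r * exp (- \<i> * of_real (t $ i)))" for t :: "real ^ 'd"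
  have w: "w t \<in> polydisc" for t unfolding w_def by (rule torus_point_in_polydisc) (auto simp: r_def)
  define s where "s k = norm (c k) * q k" for k
  have nw: "norm (c k * mpow (w t) k) = s k" for k t
    unfolding w_def mpow_torus s_def q_def[symmetric] using q[of k] by (simp add: norm_mult)
  have "(\<lambda>k. norm (c k * mpow (w 0) k)) summable_on UNIV"
    by (rule summable_on_iff_abs_summable_on_complex[THEN iffD1, OF has_sum_imp_summable[OF c[OF w[of 0]]]])
  then have s: "s summable_on UNIV" unfolding nw .
  have s0: "s k \<ge> 0" for k using q[of k] by (simp add: s_def)
  have "s k \<le> \<epsilon>" if \<epsilon>: "\<epsilon> > 0" for \<epsilon>
  proof -
    obtain F where F: "finite F" and close: "\<And>G (g :: nat ^ 'd \<Rightarrow> complex) L. finite G \<Longrightarrow> F \<subseteq> G \<Longrightarrow> (\<And>k. norm (g k) \<le> s k) \<Longrightarrow>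
     (g has_sum L) UNIV \<Longrightarrow> norm (L - sum g G) \<le> \<epsilon>"
      using finite_partial_sum_close[OF s s0 \<epsilon>] by blast
    define G where "G = insert k F"
    have G: "finite G" "F \<subseteq> G" "k \<in> G" using F by (auto simp: G_def)
    have small: "norm (\<Sum>k\<in>G. c k * of_real (q k) * torus_char k t) \<le> \<epsilon>" for t
      using close[OF G(1,2) _ c[OF w[of t]]] nw[of _ t]
      unfolding w_def mpow_torus q_def mult.assoc by simp
    have "(s k)\<^sup>2 \<le> (\<Sum>k\<in>G. (s k)\<^sup>2)"
      using G by (intro member_le_sum) auto
    also have "\<dots> = (\<Sum>k\<in>G. (norm (c k * of_real (q k)))\<^sup>2)"
      using q by (intro sum.cong) (auto simp: s_def norm_mult less_imp_le)
    finally have "(2 * pi) ^ CARD('d) * (s k)\<^sup>2 \<le> (2 * pi) ^ CARD('d) * (\<Sum>k\<in>G. (norm (c k * of_real (q k)))\<^sup>2)"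
      by (intro mult_left_mono) auto
    also have "\<dots> \<le> (LINT t|lborel. indicator (torus_box :: (real ^ 'd) set) t *\<^sub>R \<epsilon>\<^sup>2)"
      unfolding torus_Parseval(2)[OF G(1), symmetric]
    proof (rule integral_mono[OF torus_Parseval(1)[OF G(1)]])
      show "integrable lborel (\<lambda>t. indicator (torus_box :: (real ^ 'd) set) t *\<^sub>R \<epsilon>\<^sup>2)"
        using integrable_torus_box[where 'd = 'd] by simp
      show "indicator torus_box t *\<^sub>R (cmod (\<Sum>k\<in>G. c k * complex_of_real (q k) * torus_char k t))\<^sup>2
         \<le> indicator torus_box t *\<^sub>R \<epsilon>\<^sup>2" for t
        using small[of t] by (intro scaleR_left_mono power_mono) auto
    qed
    also have "\<dots> = (2 * pi) ^ CARD('d) * \<epsilon>\<^sup>2" using measure_torus_box[where 'd = 'd] by simp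
    finally have "(s k)\<^sup>2 \<le> \<epsilon>\<^sup>2" by simp
    then show "s k \<le> \<epsilon>" using \<epsilon> by (simp add: power2_le_iff_abs_le)
  qed
  then have "s k \<le> 0" by (rule field_le_epsilon[of _ 0, simplified])
  then show ?thesis using q[of k] by (simp add: s_def mult_le_0_iff)
qed

text \<open>For fixed \<open>r\<close> a finite partial sum \<open>p\<close> approximates
  \<open>f\<close> uniformly on the torus, and Parseval bounds the mean of its square by
  \<open>A\<close>. The added 1 pays for the approximation; only a bound uniform in \<open>r\<close>
  matters.\<close>

lemma hardy_H2_power_series:
  fixes \<alpha> :: "nat ^ 'd::finite \<Rightarrow> complex"
  assumes A: "\<And>F. finite F \<Longrightarrow> (\<Sum>k\<in>F. (norm (\<alpha> k))\<^sup>2) \<le> A" and ps: "power_series_on_polydisc \<alpha> f"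
  shows "f \<in> hardy_H2"
proof -
  have "(norm (\<alpha> k))\<^sup>2 \<le> A" for k using A[of "{k}"] by simp
  then have B: "norm (\<alpha> k) \<le> sqrt A" for k using real_le_rsqrt by blast
  have "hardy_mean f r \<le> A + 1" if r: "r \<in> {0..<1}" for r
  proof -
    define q where "q k = (\<Prod>i\<in>UNIV. r ^ (k $ i))" for k :: "nat ^ 'd"
    have q0: "q k \<ge> 0" and q1: "q k \<le> 1" for k
      unfolding q_def using r by (auto intro!: prod_nonneg prod_le_1 power_le_one)
    define w where "w t = (\<chi> i. of_real r * exp (- \<i> * of_real (t $ i)))" for t :: "real ^ 'd"
    have w: "w t \<in> polydisc" for t unfolding w_def by (rule torus_point_in_polydisc) (use r in auto)
    define s where "s k = norm (\<alpha> k) * q k" for k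
    have nw: "norm (\<alpha> k * mpow (w t) k) = s k" for k t
      unfolding w_def mpow_torus s_def q_def[symmetric] using q0[of k] by (simp add: norm_mult)
    have s: "s summable_on UNIV"
      using polydisc_series_summable[where \<alpha> = \<alpha>, OF w[of 0] B] unfolding nw .
    have s0: "s k \<ge> 0" for k using q0[of k] by (simp add: s_def)
    define T where "T = infsum s UNIV"
    have T: "T \<ge> 0" unfolding T_def by (rule infsum_nonneg) (rule s0)
    \<comment> \<open>Chosen so that (\<open>T\<close> + \<epsilon>)^2 exceeds \<open>T\<close>^2 by
      at most 1, where \<open>T\<close> bounds all partial sums.\<close>
    define \<epsilon> where "\<epsilon> = 1 / (2 * T + 2)"
    have \<epsilon>: "\<epsilon> > 0" "\<epsilon> \<le> 1" "2 * T * \<epsilon> + \<epsilon>\<^sup>2 \<le> 1"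
    proof -
      show "\<epsilon> > 0" "\<epsilon> \<le> 1" unfolding \<epsilon>_def using T by auto
      then have "\<epsilon>\<^sup>2 \<le> \<epsilon> * 2" by (simp add: power2_eq_square)
      then have "2 * T * \<epsilon> + \<epsilon>\<^sup>2 \<le> (2 * T + 2) * \<epsilon>" by (simp add: algebra_simps)
      also have "\<dots> = 1" unfolding \<epsilon>_def using T by simp
      finally show "2 * T * \<epsilon> + \<epsilon>\<^sup>2 \<le> 1" .
    qed
    obtain F where F: "finite F" and close: "\<And>G (g :: nat ^ 'd \<Rightarrow> complex) L. finite G \<Longrightarrow> F \<subseteq> G \<Longrightarrow> (\<And>k. norm (g k) \<le> s k) \<Longrightarrow>
     (g has_sum L) UNIV \<Longrightarrow> norm (L - sum g G) \<le> \<epsilon>"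
      using finite_partial_sum_close[OF s s0 \<epsilon>(1)] by blast
    define p where "p t = (\<Sum>k\<in>F. \<alpha> k * of_real (q k) * torus_char k t)" for t
    have pt: "p t = (\<Sum>k\<in>F. \<alpha> k * mpow (w t) k)" for t
      unfolding p_def w_def mpow_torus q_def mult.assoc ..
    have close': "norm (f (w t) - p t) \<le> \<epsilon>" for t
      using close[OF F order_refl, of "\<lambda>k. \<alpha> k * mpow (w t) k" "f (w t)"] ps w
      unfolding pt by (simp add: nw power_series_on_polydisc_def)
    have np: "norm (p t) \<le> T" for t
    proof -
      have "norm (p t) \<le> (\<Sum>k\<in>F. s k)" unfolding pt by (rule order_trans[OF norm_sum]) (simp add: nw)
      also have "\<dots> \<le> T" unfolding T_def by (rule finite_sum_le_infsum[OF s F]) (auto simp: s0)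
      finally show ?thesis .
    qed
    have sq: "(norm (f (w t)))\<^sup>2 \<le> (norm (p t))\<^sup>2 + 1" for t
    proof -
      have "norm (f (w t)) \<le> norm (p t) + \<epsilon>"
        using close'[of t] norm_triangle_sub[of "f (w t)" "p t"] by simp
      then have "(norm (f (w t)))\<^sup>2 \<le> (norm (p t) + \<epsilon>)\<^sup>2" by (intro power_mono) auto
      also have "\<dots> = (norm (p t))\<^sup>2 + (2 * norm (p t) * \<epsilon> + \<epsilon>\<^sup>2)" by (simp add: power2_sum)
      also have "2 * norm (p t) * \<epsilon> \<le> 2 * T * \<epsilon>" using np[of t] \<epsilon>(1) by simp
      finally show ?thesis using \<epsilon>(3) by simp
    qed
    have "(LINT t:torus_box|lborel. (norm (f (w t)))\<^sup>2) \<le>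
      (LINT t|lborel. indicator torus_box t *\<^sub>R (norm (p t))\<^sup>2 + indicator torus_box t)"
      unfolding set_lebesgue_integral_def
    proof (rule integral_mono')
      show "integrable lborel (\<lambda>t. indicator torus_box t *\<^sub>R (norm (p t))\<^sup>2 + indicator torus_box t)"
        unfolding p_def by (intro Bochner_Integration.integrable_add torus_Parseval F integrable_torus_box)
      show "indicator torus_box t *\<^sub>R (norm (f (w t)))\<^sup>2 \<le> indicator torus_box t *\<^sub>R (norm (p t))\<^sup>2 + indicator torus_box t" for t
        using sq[of t] by (simp add: indicator_def)
    qed simp
    also have "\<dots> = (2 * pi) ^ CARD('d) * ((\<Sum>k\<in>F. (norm (\<alpha> k * of_real (q k)))\<^sup>2) + 1)"
      unfolding p_def by (subst Bochner_Integration.integral_add)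
        (auto simp: torus_Parseval[OF F, simplified] integrable_torus_box measure_torus_box distrib_left simp del: power_mult_distrib)
    also have "\<dots> \<le> (2 * pi) ^ CARD('d) * (A + 1)"
    proof -
      have "(\<Sum>k\<in>F. (norm (\<alpha> k * of_real (q k)))\<^sup>2) \<le> (\<Sum>k\<in>F. (norm (\<alpha> k))\<^sup>2)"
        using q0 q1 by (intro sum_mono power_mono) (auto simp: norm_mult mult_left_le)
      then show ?thesis using A[OF F] by (intro mult_left_mono) auto
    qed
    finally show "hardy_mean f r \<le> A + 1"
      unfolding hardy_mean_def torus_box_def[symmetric] w_def by (simp add: field_simps)
  qed
  then show ?thesis
    unfolding hardy_H2_def using power_series_mholomorphic[OF B ps] by (auto intro!: bdd_aboveI2[where M = "A + 1"])
qed

section \<open>Symmetric i.i.d. fields and the multi-parameter Levy inequality\<close>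

text \<open>Supplies one outcome at which two highly probable estimates hold together. Statements
  about deterministic constants are then read off at that outcome.\<close>

lemma (in prob_space) prob_add_less_1_common:
  assumes [measurable]: "Measurable.pred M P" "Measurable.pred M Q"
    and lt: "\<P>(\<omega> in M. P \<omega>) + \<P>(\<omega> in M. Q \<omega>) < 1"
  shows "\<exists>\<omega>\<in>space M. \<not> P \<omega> \<and> \<not> Q \<omega>"
proof (rule ccontr)
  assume "\<not> ?thesis"
  then have "space M = {\<omega> \<in> space M. P \<omega>} \<union> {\<omega> \<in> space M. Q \<omega>}" by blast
  then have "1 = prob ({\<omega> \<in> space M. P \<omega>} \<union> {\<omega> \<in> space M. Q \<omega>})" using prob_space by simp
  also have "\<dots> \<le> \<P>(\<omega> in M. P \<omega>) + \<P>(\<omega> in M. Q \<omega>)"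
    by (rule measure_Un_le) measurable
  finally show False using lt by simp
qed

lemma (in prob_space) prob_triangle:
  assumes [measurable]: "X \<in> borel_measurable M" "X' \<in> borel_measurable M"
    and le: "\<And>\<omega>. \<omega> \<in> space M \<Longrightarrow> norm (f \<omega> :: complex) \<le> norm (X \<omega> :: complex) + norm (X' \<omega> :: complex)"
  shows "\<P>(\<omega> in M. a + b < norm (f \<omega>)) \<le> \<P>(\<omega> in M. a < norm (X \<omega>)) + \<P>(\<omega> in M. b < norm (X' \<omega>))"
proof -
  have "\<P>(\<omega> in M. a + b < norm (f \<omega>)) \<le> prob ({\<omega> \<in> space M. a < norm (X \<omega>)} \<union> {\<omega> \<in> space M. b < norm (X' \<omega>)})"
  proof (rule finite_measure_mono)
    show "{\<omega> \<in> space M. a + b < norm (f \<omega>)} \<subseteq> {\<omega> \<in> space M. a < norm (X \<omega>)} \<union> {\<omega> \<in> space M. b < norm (X' \<omega>)}"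
      using le by fastforce
  qed measurable
  also have "\<dots> \<le> \<P>(\<omega> in M. a < norm (X \<omega>)) + \<P>(\<omega> in M. b < norm (X' \<omega>))"
    by (rule measure_Un_le) measurable
  finally show ?thesis .
qed

text \<open>The events \<open>B m\<close> decrease to a null set, so continuity from above applies.
  A single tolerance serves as level and as probability, as in all concentration statements
  below.\<close>

lemma (in prob_space) AE_tendsto_imp_prob_less:
  fixes Y :: "'a \<Rightarrow> complex"
  assumes [measurable]: "\<And>n. X n \<in> borel_measurable M" "Y \<in> borel_measurable M"
    and lim: "AE \<omega> in M. (\<lambda>n. X n \<omega>) \<longlonglongrightarrow> Y \<omega>" and e: "\<epsilon> > 0"
  shows "\<exists>m. \<forall>n\<ge>m. \<P>(\<omega> in M. \<epsilon> < norm (Y \<omega> - X n \<omega>)) < \<epsilon>"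
proof -
  define B where "B m = {\<omega> \<in> space M. \<exists>n\<ge>m. \<epsilon> < norm (Y \<omega> - X n \<omega>)}" for m
  have Bm: "B m \<in> events" for m unfolding B_def by measurable
  have "AE \<omega> in M. \<omega> \<notin> (\<Inter>m. B m)"
    using lim
  proof eventually_elim
    case (elim \<omega>)
    from tendstoD[OF elim e] obtain m where "\<And>n. n \<ge> m \<Longrightarrow> dist (X n \<omega>) (Y \<omega>) < \<epsilon>"
      unfolding eventually_sequentially by blast
    then have "\<omega> \<notin> B m" unfolding B_def dist_norm by (auto simp: norm_minus_commute dest: less_asym)
    then show ?case by blast
  qed
  then have "prob (\<Inter>m. B m) = 0" using Bm by (subst prob_eq_0) auto
  moreover have "(\<lambda>m. prob (B m)) \<longlonglongrightarrow> prob (\<Inter>m. B m)"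
    by (rule finite_Lim_measure_decseq) (use Bm in \<open>auto simp: decseq_def B_def intro: order_trans\<close>)
  ultimately have "\<forall>\<^sub>F m in sequentially. prob (B m) < \<epsilon>" using e by (intro order_tendstoD(2)) auto
  then obtain m where m: "prob (B m) < \<epsilon>" using eventually_happens trivial_limit_sequentially by blast
  have "\<P>(\<omega> in M. \<epsilon> < norm (Y \<omega> - X n \<omega>)) < \<epsilon>" if "n \<ge> m" for n
  proof -
    have "\<P>(\<omega> in M. \<epsilon> < norm (Y \<omega> - X n \<omega>)) \<le> prob (B m)"
      by (rule finite_measure_mono[OF _ Bm]) (use that in \<open>auto simp: B_def\<close>)
    then show ?thesis using m by simp
  qed
  then show ?thesis by blast
qed

section \<open>Transformations that preserve the law of the noise field\<close>

abbreviation field_space :: "(int ^ 'd::finite \<Rightarrow> complex) measure" where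
  "field_space \<equiv> PiM UNIV (\<lambda>_. borel)"

locale iid_symmetric = prob_space M for M :: "'a measure" +
  fixes Z :: "int ^ 'd::finite \<Rightarrow> 'a \<Rightarrow> complex"
  assumes indep: "indep_vars (\<lambda>_. borel) Z UNIV"
    and ident: "distr M borel (Z t) = distr M borel (Z 0)"
    and symm: "distr M borel (Z 0) = distr M borel (\<lambda>\<omega>. - Z 0 \<omega>)"
begin

abbreviation noise :: "'a \<Rightarrow> int ^ 'd \<Rightarrow> complex" where
  "noise \<omega> \<equiv> (\<lambda>s. Z s \<omega>)"

text \<open>The instances are the identity, the sign change, and the sign change restricted to large
  values. Applied coordinatewise, with the choice depending on the index, they preserve the joint
  law.\<close>

definition law_preserving :: "(complex \<Rightarrow> complex) \<Rightarrow> bool" where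
  "law_preserving f \<longleftrightarrow> f \<in> borel_measurable borel \<and> distr M borel (\<lambda>\<omega>. f (Z 0 \<omega>)) = distr M borel (Z 0)"

lemma Z_measurable [measurable]: "Z t \<in> borel_measurable M"
  using indep by (simp add: indep_vars_def2)

lemma law_preserving_id: "law_preserving (\<lambda>z. z)"
  by (simp add: law_preserving_def)

lemma law_preserving_uminus: "law_preserving uminus"
  by (simp add: law_preserving_def symm)

lemma law_preserving_if: "law_preserving (if b then uminus else (\<lambda>z. z))"
  by (simp add: law_preserving_id law_preserving_uminus)

lemma prob_uminus:
  assumes A: "A \<in> sets borel"
  shows "\<P>(\<omega> in M. - Z 0 \<omega> \<in> A) = \<P>(\<omega> in M. Z 0 \<omega> \<in> A)"
proof -
  have "measure (distr M borel (\<lambda>\<omega>. - Z 0 \<omega>)) A = measure (distr M borel (Z 0)) A"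
    by (simp add: symm)
  then show ?thesis using A
    by (subst (asm) (1 2) measure_distr) (auto simp: vimage_def Int_def conj_commute)
qed

text \<open>The set of values with norm below \<open>C\<close> is symmetric, so flipping signs only
  on its complement respects the symmetric law. The average of \<open>z\<close> with its image is
  \<open>z\<close> cut off at \<open>C\<close>.\<close>

lemma law_preserving_truncation: "law_preserving (\<lambda>z. if norm z < C then z else - z)"
  unfolding law_preserving_def
proof
  let ?f = "\<lambda>z :: complex. if norm z < C then z else - z"
  show f[measurable]: "?f \<in> borel_measurable borel" by measurable
  show "distr M borel (\<lambda>\<omega>. ?f (Z 0 \<omega>)) = distr M borel (Z 0)"
  proof (rule measure_eqI)
    fix A assume "A \<in> sets (distr M borel (\<lambda>\<omega>. ?f (Z 0 \<omega>)))"
    then have A[measurable]: "A \<in> sets borel" by simp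
    let ?S = "{\<omega> \<in> space M. Z 0 \<omega> \<in> A \<and> norm (Z 0 \<omega>) < C}"
    have split: "\<P>(\<omega> in M. g \<omega> \<in> A) =
        \<P>(\<omega> in M. g \<omega> \<in> A \<and> norm (Z 0 \<omega>) < C) + \<P>(\<omega> in M. g \<omega> \<in> A \<and> \<not> norm (Z 0 \<omega>) < C)"
      if [measurable]: "g \<in> borel_measurable M" for g
      by (subst finite_measure_Union[symmetric]) (auto intro!: arg_cong[where f = prob])
    have "\<P>(\<omega> in M. ?f (Z 0 \<omega>) \<in> A) = prob ?S + \<P>(\<omega> in M. - Z 0 \<omega> \<in> A \<and> \<not> norm (Z 0 \<omega>) < C)"
      by (subst split) (auto intro!: arg_cong2[where f = "(+)"] arg_cong[where f = prob])
    also have "\<P>(\<omega> in M. - Z 0 \<omega> \<in> A \<and> \<not> norm (Z 0 \<omega>) < C) =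
       \<P>(\<omega> in M. - Z 0 \<omega> \<in> A \<inter> {z. \<not> norm z < C})"
      by (intro arg_cong[where f = prob]) auto
    also have "\<dots> = \<P>(\<omega> in M. Z 0 \<omega> \<in> A \<inter> {z. \<not> norm z < C})"
      by (rule prob_uminus) measurable
    also have "prob ?S + \<dots> = \<P>(\<omega> in M. Z 0 \<omega> \<in> A)"
      by (subst split) (auto intro!: arg_cong2[where f = "(+)"] arg_cong[where f = prob])
    finally show "emeasure (distr M borel (\<lambda>\<omega>. ?f (Z 0 \<omega>))) A = emeasure (distr M borel (Z 0)) A"
      by (simp add: emeasure_distr emeasure_eq_measure vimage_def Int_def conj_commute)
  qed simp
qed

lemma field_measurable [measurable]: "(\<lambda>\<omega> s. Z s \<omega>) \<in> measurable M field_space"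
  by (rule measurable_PiM_single') auto

text \<open>Independence is expressed by a product law with equal factors, and an injective
  reindexing maps this product measure to itself.\<close>

lemma indep_reindex:
  assumes \<sigma>: "inj \<sigma>"
  shows "indep_vars (\<lambda>_. borel) (\<lambda>s. Z (\<sigma> s)) (UNIV :: (int ^ 'd) set)"
proof -
  define \<mu> where "\<mu> = distr M borel (Z 0)"
  have id: "(\<lambda>s :: int ^ 'd. distr M borel (Z (f s))) = (\<lambda>_. \<mu>)" for f
    unfolding \<mu>_def by (intro ext ident)
  have s\<mu>: "sets \<mu> = sets borel" by (simp add: \<mu>_def)
  have sP: "sets (PiM UNIV (\<lambda>_ :: int ^ 'd. \<mu>)) = sets field_space"
    by (rule sets_PiM_cong) (auto simp: s\<mu>)
  interpret \<mu>: prob_space \<mu> unfolding \<mu>_def by (rule prob_space_distr) simp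
  have law: "distr M field_space (\<lambda>\<omega> s. Z s \<omega>) = PiM UNIV (\<lambda>_. \<mu>)"
    using indep id[of "\<lambda>s. s"] by (subst (asm) indep_vars_iff_distr_eq_PiM) (auto simp: restrict_UNIV)
  have m: "(\<lambda>x s. x (\<sigma> s)) \<in> measurable field_space (field_space :: (int ^ 'd \<Rightarrow> complex) measure)"
    by (rule measurable_PiM_single') (auto intro: measurable_component_singleton)
  have "distr M field_space (\<lambda>\<omega> s. Z (\<sigma> s) \<omega>) = distr (distr M field_space (\<lambda>\<omega> s. Z s \<omega>)) field_space (\<lambda>x s. x (\<sigma> s))"
    by (subst distr_distr) (auto simp: comp_def m)
  also have "\<dots> = distr (PiM UNIV (\<lambda>_. \<mu>)) (PiM UNIV (\<lambda>_. \<mu>)) (\<lambda>x. \<lambda>s\<in>UNIV. x (\<sigma> s))"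
    unfolding law by (rule distr_cong) (auto simp: sP)
  also have "\<dots> = PiM UNIV (\<lambda>_. \<mu>)"
    using distr_PiM_reindex[of UNIV "\<lambda>_. \<mu>" \<sigma> UNIV] \<sigma> \<mu>.prob_space_axioms by simp
  also have "\<dots> = PiM UNIV (\<lambda>s. distr M borel (Z (\<sigma> s)))"
    unfolding id ..
  finally show ?thesis
    by (subst indep_vars_iff_distr_eq_PiM) (auto simp: restrict_UNIV)
qed

text \<open>Source of every symmetry used later: reflections for the maximal inequality, the global
  sign change, symmetric truncation, and translations for stationarity.\<close>

lemma field_law:
  assumes \<tau>: "\<And>s. law_preserving (\<tau> s)" and \<sigma>: "inj \<sigma>"
  shows "distr M field_space (\<lambda>\<omega> s. \<tau> s (Z (\<sigma> s) \<omega>)) = distr M field_space (\<lambda>\<omega> s. Z s \<omega>)"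
proof -
  have [measurable]: "\<tau> s \<in> borel_measurable borel" for s using \<tau> by (simp add: law_preserving_def)
  have "indep_vars (\<lambda>_. borel) (\<lambda>s. Z (\<sigma> s)) UNIV" by (rule indep_reindex[OF \<sigma>])
  then have "indep_vars (\<lambda>_. borel) (\<lambda>s \<omega>. \<tau> s (Z (\<sigma> s) \<omega>)) UNIV"
    by (rule indep_vars_compose2) auto
  then have "distr M field_space (\<lambda>\<omega> s. \<tau> s (Z (\<sigma> s) \<omega>)) = PiM UNIV (\<lambda>s. distr M borel (\<lambda>\<omega>. \<tau> s (Z (\<sigma> s) \<omega>)))"
    by (subst (asm) indep_vars_iff_distr_eq_PiM) (auto simp: restrict_UNIV)
  also have "(\<lambda>s. distr M borel (\<lambda>\<omega>. \<tau> s (Z (\<sigma> s) \<omega>))) = (\<lambda>s. distr M borel (Z s))"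
  proof
    fix s
    have "distr M borel (\<lambda>\<omega>. \<tau> s (Z (\<sigma> s) \<omega>)) = distr (distr M borel (Z (\<sigma> s))) borel (\<tau> s)"
      by (subst distr_distr) (auto simp: comp_def)
    also have "\<dots> = distr (distr M borel (Z 0)) borel (\<tau> s)" unfolding ident[of "\<sigma> s"] ..
    also have "\<dots> = distr M borel (\<lambda>\<omega>. \<tau> s (Z 0 \<omega>))"
      by (subst distr_distr) (auto simp: comp_def)
    also have "\<dots> = distr M borel (Z 0)" using \<tau>[of s] unfolding law_preserving_def by blast
    also have "\<dots> = distr M borel (Z s)" by (rule ident[symmetric])
    finally show "distr M borel (\<lambda>\<omega>. \<tau> s (Z (\<sigma> s) \<omega>)) = distr M borel (Z s)" .
  qed
  also have "PiM UNIV (\<lambda>s. distr M borel (Z s)) = distr M field_space (\<lambda>\<omega> s. Z s \<omega>)"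
    using iffD1[OF indep_vars_iff_distr_eq_PiM indep] by (simp add: restrict_UNIV)
  finally show ?thesis .
qed

lemma prob_field_law:
  assumes \<tau>: "\<And>s. law_preserving (\<tau> s)" and P: "Measurable.pred field_space P"
  shows "\<P>(\<omega> in M. P (\<lambda>s. \<tau> s (Z s \<omega>))) = \<P>(\<omega> in M. P (noise \<omega>))"
proof -
  have [measurable]: "\<tau> s \<in> borel_measurable borel" for s using \<tau> by (simp add: law_preserving_def)
  have m: "(\<lambda>\<omega> s. \<tau> s (Z s \<omega>)) \<in> measurable M field_space"
    by (rule measurable_PiM_single') auto
  have E: "{x. P x} \<in> sets field_space" using P by (simp add: pred_def space_PiM)
  have "measure (distr M field_space (\<lambda>\<omega> s. \<tau> s (Z s \<omega>))) {x. P x} = measure (distr M field_space (\<lambda>\<omega> s. Z s \<omega>)) {x. P x}"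
    using field_law[OF \<tau>, of "\<lambda>s. s"] by simp
  then show ?thesis
    by (subst (asm) (1 2) measure_distr) (auto simp: E m vimage_def Int_def conj_commute)
qed

lemma measurable_field_sum [measurable]:
  "(\<lambda>x. \<Sum>s\<in>F. a s * x (h s)) \<in> borel_measurable (field_space :: (int ^ 'd \<Rightarrow> complex) measure)"
proof -
  have [measurable]: "(\<lambda>x. x (h s)) \<in> borel_measurable (field_space :: (int ^ 'd \<Rightarrow> complex) measure)" for s
    by (rule measurable_component_singleton) simp
  show ?thesis by measurable
qed

text \<open>The sum on the left is the average of two sums with the same law; if it exceeds
  \<open>c\<close>, one of the two does. Sign changes delete terms, and the modulus-dependent sign
  change truncates them.\<close>

lemma contraction:
  assumes \<tau>: "\<And>s. law_preserving (\<tau> s)"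
  shows "\<P>(\<omega> in M. c < norm (\<Sum>s\<in>F. a s * ((Z (h s) \<omega> + \<tau> (h s) (Z (h s) \<omega>)) / 2))) \<le>
    2 * \<P>(\<omega> in M. c < norm (\<Sum>s\<in>F. a s * Z (h s) \<omega>))"
proof -
  have [measurable]: "\<tau> s \<in> borel_measurable borel" for s using \<tau> by (simp add: law_preserving_def)
  let ?P = "\<lambda>x. c < norm (\<Sum>s\<in>F. a s * x (h s))"
  have "{\<omega> \<in> space M. c < norm (\<Sum>s\<in>F. a s * ((Z (h s) \<omega> + \<tau> (h s) (Z (h s) \<omega>)) / 2))} \<subseteq>
     {\<omega> \<in> space M. ?P (noise \<omega>)} \<union> {\<omega> \<in> space M. ?P (\<lambda>s. \<tau> s (Z s \<omega>))}"
  proof safe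
    fix \<omega> assume a: "c < norm (\<Sum>s\<in>F. a s * ((Z (h s) \<omega> + \<tau> (h s) (Z (h s) \<omega>)) / 2))" "\<not> c < norm (\<Sum>s\<in>F. a s * \<tau> (h s) (Z (h s) \<omega>))"
    have "(\<Sum>s\<in>F. a s * ((Z (h s) \<omega> + \<tau> (h s) (Z (h s) \<omega>)) / 2)) = ((\<Sum>s\<in>F. a s * Z (h s) \<omega>) + (\<Sum>s\<in>F. a s * \<tau> (h s) (Z (h s) \<omega>))) / 2"
      by (simp add: sum.distrib[symmetric] sum_divide_distrib distrib_left add_divide_distrib)
    from arg_cong[OF this, of norm] have "c < norm ((\<Sum>s\<in>F. a s * Z (h s) \<omega>) + (\<Sum>s\<in>F. a s * \<tau> (h s) (Z (h s) \<omega>))) / 2"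
      using a(1) by (simp only: norm_divide norm_numeral)
    then show "c < norm (\<Sum>s\<in>F. a s * Z (h s) \<omega>)"
      using a(2) norm_triangle_ineq[of "\<Sum>s\<in>F. a s * Z (h s) \<omega>" "\<Sum>s\<in>F. a s * \<tau> (h s) (Z (h s) \<omega>)"] by linarith
  qed
  then have "\<P>(\<omega> in M. c < norm (\<Sum>s\<in>F. a s * ((Z (h s) \<omega> + \<tau> (h s) (Z (h s) \<omega>)) / 2))) \<le>
     prob ({\<omega> \<in> space M. ?P (noise \<omega>)} \<union> {\<omega> \<in> space M. ?P (\<lambda>s. \<tau> s (Z s \<omega>))})"
    by (rule finite_measure_mono) measurable
  also have "\<dots> \<le> \<P>(\<omega> in M. ?P (noise \<omega>)) + \<P>(\<omega> in M. ?P (\<lambda>s. \<tau> s (Z s \<omega>)))"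
    by (rule measure_Un_le) measurable
  also have "\<P>(\<omega> in M. ?P (\<lambda>s. \<tau> s (Z s \<omega>))) = \<P>(\<omega> in M. ?P (noise \<omega>))"
    by (rule prob_field_law[OF \<tau>]) measurable
  finally show ?thesis by simp
qed

section \<open>Levy's maximal inequality for sums over boxes, and almost sure convergence\<close>

definition psum :: "(nat ^ 'd \<Rightarrow> complex) \<Rightarrow> int ^ 'd \<Rightarrow> nat ^ 'd \<Rightarrow> (int ^ 'd \<Rightarrow> complex) \<Rightarrow> complex" where
  "psum \<beta> t N x = (\<Sum>k | k \<le> N. \<beta> k * x (t - int_vec k))"

lemma psum_measurable [measurable]: "psum \<beta> t N \<in> borel_measurable field_space"
  unfolding psum_def[abs_def] by (rule measurable_field_sum)

lemma psum_Z_measurable [measurable]: "(\<lambda>\<omega>. psum \<beta> t N (noise \<omega>)) \<in> borel_measurable M"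
  by (rule measurable_compose[OF field_measurable psum_measurable])

text \<open>
  If \<open>j\<close> is the first slice in direction \<open>i\<close> on which the level is exceeded, reflect the noise in
  all indices beyond that slice. This preserves the law and the event, and the partial sum that
  exceeds the level is the average of the two sums continued to the end of direction \<open>i\<close>.
\<close>

lemma Levy_step:
  fixes K :: "nat ^ 'd" and a :: real and \<beta> :: "nat ^ 'd \<Rightarrow> complex" and t :: "int ^ 'd"
  defines "P \<equiv> \<lambda>I x. \<exists>N. N \<le> K \<and> (\<forall>l. l \<notin> I \<longrightarrow> N $ l = K $ l) \<and> a < norm (psum \<beta> t N x)"
  assumes i: "i \<notin> I"
  shows "\<P>(\<omega> in M. P (insert i I) (noise \<omega>)) \<le> 2 * \<P>(\<omega> in M. P I (noise \<omega>))"
proof -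
  \<comment> \<open>In \<open>P I\<close> the coordinates in \<open>I\<close> are free and all
    others are pinned to those of \<open>K\<close>. \<open>G j\<close> restricts the exceedance to
    slice \<open>j\<close> in direction \<open>i\<close>, and \<open>H j\<close> says that
    \<open>j\<close> is the earliest such slice.\<close>
  define G where "G j x \<longleftrightarrow> (\<exists>N. N \<le> K \<and> (\<forall>l. l \<notin> insert i I \<longrightarrow> N $ l = K $ l) \<and> N $ i = j \<and> a < norm (psum \<beta> t N x))" for j x
  define H where "H j x \<longleftrightarrow> G j x \<and> (\<forall>j'. j' < j \<longrightarrow> \<not> G j' x)" for j x
  define \<tau> where "\<tau> j s = (if int j < (t - s) $ i then uminus else (\<lambda>z :: complex. z))" for j s
  have \<tau>: "law_preserving (\<tau> j s)" for j s unfolding \<tau>_def by (rule law_preserving_if)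
  define fl where "fl j x = (\<lambda>s. \<tau> j s (x s))" for j x
  have Pm[measurable]: "Measurable.pred field_space (P I)" for I
    unfolding P_def by measurable
  have Gm[measurable]: "Measurable.pred field_space (G j)" for j
    unfolding G_def by measurable
  have Hm[measurable]: "Measurable.pred field_space (H j)" for j
    unfolding H_def by measurable
  have psum_fl: "psum \<beta> t N (fl j x) = psum \<beta> t N x" if "N $ i \<le> j" for N j x
    unfolding psum_def fl_def \<tau>_def using that
    by (intro sum.cong) (auto simp: less_eq_vec_def dest!: spec[of _ i])
  have G_fl: "G j' (fl j x) \<longleftrightarrow> G j' x" if "j' \<le> j" for j j' x
    unfolding G_def using psum_fl that by metis
  have H_fl: "H j (fl j x) \<longleftrightarrow> H j x" for j x
    unfolding H_def using G_fl by auto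
  have P_insert: "P (insert i I) x \<longleftrightarrow> (\<exists>j\<in>{..K $ i}. H j x)" for x
  proof
    assume "P (insert i I) x"
    then obtain N where N: "N \<le> K" "G (N $ i) x" unfolding P_def G_def by blast
    define j where "j = (LEAST j. G j x)"
    have "G j x" unfolding j_def by (rule LeastI[of "\<lambda>j. G j x"]) (rule N(2))
    moreover have "\<forall>j'. j' < j \<longrightarrow> \<not> G j' x" unfolding j_def using not_less_Least by blast
    moreover have "j \<le> N $ i" unfolding j_def using N(2) by (rule Least_le)
    moreover have "N $ i \<le> K $ i" using N(1) by (simp add: less_eq_vec_def)
    ultimately show "\<exists>j\<in>{..K $ i}. H j x" unfolding H_def by auto
  next
    assume "\<exists>j\<in>{..K $ i}. H j x"
    then show "P (insert i I) x" unfolding P_def H_def G_def by blast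
  qed
  have key: "P I x \<or> P I (fl j x)" if H: "H j x" for j x
  proof -
    obtain N where N: "N \<le> K" "\<forall>l. l \<notin> insert i I \<longrightarrow> N $ l = K $ l" "N $ i = j" "a < norm (psum \<beta> t N x)"
      using H unfolding H_def G_def by blast
    \<comment> \<open>Only coordinate \<open>i\<close> is enlarged, to its full length. A new index
      \<open>k\<close> therefore has \<open>k $ i > j\<close>, its noise is reflected, and it
      cancels in the sum of the two continued box sums; the old terms double.\<close>
    define N' where "N' = (\<chi> l. if l = i then K $ l else N $ l)"
    have N': "N' \<le> K" "\<forall>l. l \<notin> I \<longrightarrow> N' $ l = K $ l"
      using N(1,2) by (auto simp: N'_def less_eq_vec_def)
    have "psum \<beta> t N' x + psum \<beta> t N' (fl j x) =
       (\<Sum>k | k \<le> N'. \<beta> k * (x (t - int_vec k) + fl j x (t - int_vec k)))"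
      unfolding psum_def by (simp add: sum.distrib distrib_left)
    also have "\<dots> = (\<Sum>k | k \<le> N. \<beta> k * (2 * x (t - int_vec k)))"
    proof (rule sum.mono_neutral_cong_right)
      show "finite {k. k \<le> N'}" by (rule finite_atMost_nat_vec)
      show "{k. k \<le> N} \<subseteq> {k. k \<le> N'}"
        using N(1) by (auto simp: N'_def less_eq_vec_def intro: order_trans)
      show "\<forall>k\<in>{k. k \<le> N'} - {k. k \<le> N}. \<beta> k * (x (t - int_vec k) + fl j x (t - int_vec k)) = 0"
      proof
        fix k assume k: "k \<in> {k. k \<le> N'} - {k. k \<le> N}"
        then obtain l where "\<not> k $ l \<le> N $ l" by (auto simp: less_eq_vec_def)
        moreover have "k $ l \<le> N' $ l" using k by (auto simp: less_eq_vec_def)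
        ultimately have "l = i" by (auto simp: N'_def split: if_splits)
        then have "j < k $ i" using \<open>\<not> k $ l \<le> N $ l\<close> N(3) by simp
        then show "\<beta> k * (x (t - int_vec k) + fl j x (t - int_vec k)) = 0"
          by (simp add: fl_def \<tau>_def)
      qed
      show "\<beta> k * (x (t - int_vec k) + fl j x (t - int_vec k)) = \<beta> k * (2 * x (t - int_vec k))" if "k \<in> {k. k \<le> N}" for k
      proof -
        have "k $ i \<le> j" using that N(3) by (auto simp: less_eq_vec_def)
        then show ?thesis by (simp add: fl_def \<tau>_def)
      qed
    qed
    also have "\<dots> = 2 * psum \<beta> t N x" by (simp add: psum_def sum_distrib_left mult_ac)
    finally have "2 * norm (psum \<beta> t N x) \<le> norm (psum \<beta> t N' x) + norm (psum \<beta> t N' (fl j x))"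
      by (metis norm_mult norm_numeral norm_triangle_ineq)
    then have "a < norm (psum \<beta> t N' x) \<or> a < norm (psum \<beta> t N' (fl j x))" using N(4) by linarith
    then show ?thesis unfolding P_def using N' by blast
  qed
  have H_half: "\<P>(\<omega> in M. H j (noise \<omega>)) \<le> 2 * \<P>(\<omega> in M. H j (noise \<omega>) \<and> P I (noise \<omega>))" for j
  proof -
    have HPm: "Measurable.pred field_space (\<lambda>x. H j x \<and> P I x)" by measurable
    have [measurable]: "(\<lambda>\<omega>. fl j (noise \<omega>)) \<in> measurable M field_space"
      unfolding fl_def using \<tau>[unfolded law_preserving_def]
      by (intro measurable_PiM_single') (auto intro: measurable_compose[OF Z_measurable])
    have "\<P>(\<omega> in M. H j (noise \<omega>)) \<le> prob ({\<omega> \<in> space M. H j (noise \<omega>) \<and> P I (noise \<omega>)} \<union>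
       {\<omega> \<in> space M. H j (fl j (noise \<omega>)) \<and> P I (fl j (noise \<omega>))})"
    proof (rule finite_measure_mono)
      show "{\<omega> \<in> space M. H j (noise \<omega>)} \<subseteq> {\<omega> \<in> space M. H j (noise \<omega>) \<and> P I (noise \<omega>)} \<union>
       {\<omega> \<in> space M. H j (fl j (noise \<omega>)) \<and> P I (fl j (noise \<omega>))}"
        using key H_fl by blast
    qed measurable
    also have "\<dots> \<le> \<P>(\<omega> in M. H j (noise \<omega>) \<and> P I (noise \<omega>)) +
      \<P>(\<omega> in M. H j (fl j (noise \<omega>)) \<and> P I (fl j (noise \<omega>)))"
      by (rule measure_Un_le) measurable
    also have "\<P>(\<omega> in M. H j (fl j (noise \<omega>)) \<and> P I (fl j (noise \<omega>))) =
       \<P>(\<omega> in M. H j (noise \<omega>) \<and> P I (noise \<omega>))"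
      using prob_field_law[OF \<tau> HPm] unfolding fl_def .
    finally show ?thesis by simp
  qed
  have "\<P>(\<omega> in M. P (insert i I) (noise \<omega>)) = prob (\<Union>j\<in>{..K $ i}. {\<omega> \<in> space M. H j (noise \<omega>)})"
    unfolding P_insert by (intro arg_cong[where f = prob]) blast
  also have "\<dots> \<le> (\<Sum>j\<in>{..K $ i}. \<P>(\<omega> in M. H j (noise \<omega>)))"
    by (rule finite_measure_subadditive_finite) auto
  also have "\<dots> \<le> (\<Sum>j\<in>{..K $ i}. 2 * \<P>(\<omega> in M. H j (noise \<omega>) \<and> P I (noise \<omega>)))"
    by (intro sum_mono H_half)
  \<comment> \<open>At most one \<open>j\<close> can be the earliest slice, so the events are
    disjoint and summing over \<open>j\<close> costs no constant.\<close>
  also have "\<dots> = 2 * prob (\<Union>j\<in>{..K $ i}. {\<omega> \<in> space M. H j (noise \<omega>) \<and> P I (noise \<omega>)})"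
  proof -
    have "disjoint_family_on (\<lambda>j. {\<omega> \<in> space M. H j (noise \<omega>) \<and> P I (noise \<omega>)}) {..K $ i}"
      unfolding disjoint_family_on_def H_def by (auto, metis linorder_neqE_nat)
    then show ?thesis
      by (subst finite_measure_finite_Union) (auto simp: sum_distrib_left)
  qed
  also have "\<dots> \<le> 2 * \<P>(\<omega> in M. P I (noise \<omega>))"
    by (intro mult_left_mono finite_measure_mono) auto
  finally show ?thesis .
qed

text \<open>Coordinates are freed one at a time by \<open>Levy_step\<close>, each at a factor 2: no
  free coordinate means the single box \<open>K\<close>, all coordinates free means every box inside
  \<open>K\<close>.\<close>

lemma Levy_box:
  "\<P>(\<omega> in M. \<exists>N\<le>K. a < norm (psum \<beta> t N (noise \<omega>))) \<le>
    2 ^ CARD('d) * \<P>(\<omega> in M. a < norm (psum \<beta> t K (noise \<omega>)))"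
proof -
  let ?P = "\<lambda>I x. \<exists>N. N \<le> K \<and> (\<forall>l. l \<notin> I \<longrightarrow> N $ l = K $ l) \<and> a < norm (psum \<beta> t N x)"
  have "\<P>(\<omega> in M. ?P I (noise \<omega>)) \<le>
    2 ^ card I * \<P>(\<omega> in M. a < norm (psum \<beta> t K (noise \<omega>)))" if "finite I" for I
    using that
  proof induction
    case empty
    have "?P {} x \<longleftrightarrow> a < norm (psum \<beta> t K x)" for x
      by (auto simp: vec_eq_iff[symmetric])
    then show ?case by simp
  next
    case (insert i I)
    have "\<P>(\<omega> in M. ?P (insert i I) (noise \<omega>)) \<le> 2 * \<P>(\<omega> in M. ?P I (noise \<omega>))"
      by (rule Levy_step) (rule insert)
    then show ?case using insert by simp
  qed
  from this[of UNIV] show ?thesis by simp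
qed

text \<open>Monotone limit over growing boxes. The probability bound may be assumed for large
  \<open>K\<close> only, because all the exhausting boxes \<open>K m\<close> lie above
  \<open>n\<close>.\<close>

lemma Levy_all:
  assumes q: "\<And>K. n \<le> K \<Longrightarrow> \<P>(\<omega> in M. a < norm (psum \<beta> t K (noise \<omega>))) \<le> q"
  shows "\<P>(\<omega> in M. \<exists>N. a < norm (psum \<beta> t N (noise \<omega>))) \<le> 2 ^ CARD('d) * q"
proof -
  define K where "K m = n + (\<chi> i. m)" for m :: nat
  define E where "E m = {\<omega> \<in> space M. \<exists>N\<le>K m. a < norm (psum \<beta> t N (noise \<omega>))}" for m
  have Em: "E m \<in> events" for m unfolding E_def by measurable
  have mono: "incseq E"
  proof (rule incseq_SucI)
    fix m have "K m \<le> K (Suc m)" by (simp add: K_def less_eq_vec_def)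
    then show "E m \<subseteq> E (Suc m)" unfolding E_def by (auto intro: order_trans)
  qed
  have bound: "prob (E m) \<le> 2 ^ CARD('d) * q" for m
  proof -
    have "n \<le> K m" by (simp add: K_def less_eq_vec_def)
    then show ?thesis unfolding E_def
      using Levy_box[of "K m" a \<beta> t] q[of "K m"] by (meson mult_left_mono order_trans zero_le_numeral zero_le_power)
  qed
  have "(\<lambda>m. prob (E m)) \<longlonglongrightarrow> prob (\<Union>m. E m)"
    by (rule finite_Lim_measure_incseq) (use Em mono in auto)
  then have "prob (\<Union>m. E m) \<le> 2 ^ CARD('d) * q"
    by (rule LIMSEQ_le_const2) (use bound in blast)
  also have "(\<Union>m. E m) = {\<omega> \<in> space M. \<exists>N. a < norm (psum \<beta> t N (noise \<omega>))}"
  proof -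
    have "\<exists>m. N \<le> K m" for N
    proof
      have "N $ i \<le> (\<Sum>i\<in>UNIV. N $ i)" for i by (rule member_le_sum) auto
      then show "N \<le> K (\<Sum>i\<in>UNIV. N $ i)" by (auto simp: K_def less_eq_vec_def intro: trans_le_add2)
    qed
    then show ?thesis unfolding E_def by blast
  qed
  finally show ?thesis .
qed

text \<open>An increment over a box becomes a box sum with coefficients set to zero inside, so the
  maximal inequality applies to increments.\<close>

lemma psum_truncate:
  assumes "n \<le> N"
  shows "psum (\<lambda>k. if k \<le> n then 0 else \<alpha> k) t N x = psum \<alpha> t N x - psum \<alpha> t n x"
proof -
  have "psum \<alpha> t N x - psum (\<lambda>k. if k \<le> n then 0 else \<alpha> k) t N x = (\<Sum>k | k \<le> N. if k \<le> n then \<alpha> k * x (t - int_vec k) else 0)"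
    unfolding psum_def sum_subtractf[symmetric] by (intro sum.cong) auto
  also have "\<dots> = (\<Sum>k\<in>{k. k \<le> N} \<inter> {k. k \<le> n}. \<alpha> k * x (t - int_vec k))"
    by (subst sum.inter_restrict[OF finite_atMost_nat_vec]) simp
  also have "{k. k \<le> N} \<inter> {k. k \<le> n} = {k. k \<le> n}" using assms by auto
  finally show ?thesis by (simp add: psum_def algebra_simps)
qed

lemma AE_rect_convergentI:
  assumes conv: "\<And>\<epsilon>. \<epsilon> > 0 \<Longrightarrow> \<exists>n. \<forall>N\<ge>n. \<P>(\<omega> in M. \<epsilon> < norm (psum \<alpha> t N (noise \<omega>) - psum \<alpha> t n (noise \<omega>))) \<le> \<epsilon>"
  shows "AE_rect_convergent M (\<lambda>k \<omega>. \<alpha> k * Z (t - int_vec k) \<omega>)"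
proof -
  define S where "S N \<omega> = psum \<alpha> t N (noise \<omega>)" for N \<omega>
  have [measurable]: "S N \<in> borel_measurable M" for N unfolding S_def by measurable
  define B where "B e = {\<omega> \<in> space M. \<forall>m. \<exists>N\<ge>m. 1 / real (Suc e) < norm (S N \<omega> - S m \<omega>)}" for e
  have Bm: "B e \<in> events" for e unfolding B_def by measurable
  have B0: "prob (B e) = 0" for e
  proof -
    have "prob (B e) \<le> 0 + \<delta>" if \<delta>: "\<delta> > 0" for \<delta>
    proof -
      \<comment> \<open>The level must not exceed the Cauchy tolerance of \<open>B e\<close>, and
        the factor \<open>2 ^ CARD('d)\<close> of the maximal inequality must be absorbed into
        \<open>\<delta>\<close>.\<close>
      define \<epsilon> where "\<epsilon> = min (1 / real (Suc e)) (\<delta> / 2 ^ CARD('d))"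
      have \<epsilon>: "\<epsilon> > 0" "\<epsilon> \<le> 1 / real (Suc e)" "2 ^ CARD('d) * \<epsilon> \<le> \<delta>"
        unfolding \<epsilon>_def using \<delta> by (auto simp: min_def field_simps)
      obtain n where n: "\<And>N. N \<ge> n \<Longrightarrow> \<P>(\<omega> in M. \<epsilon> < norm (S N \<omega> - S n \<omega>)) \<le> \<epsilon>"
        using conv[OF \<epsilon>(1)] unfolding S_def by blast
      let ?\<beta> = "\<lambda>k. if k \<le> n then 0 else \<alpha> k"
      have "prob (B e) \<le> \<P>(\<omega> in M. \<exists>N. \<epsilon> < norm (psum ?\<beta> t N (noise \<omega>)))"
      proof (rule finite_measure_mono)
        show "B e \<subseteq> {\<omega> \<in> space M. \<exists>N. \<epsilon> < norm (psum ?\<beta> t N (noise \<omega>))}"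
        proof
          fix \<omega> assume "\<omega> \<in> B e"
          then obtain N where N: "N \<ge> n" "1 / real (Suc e) < norm (S N \<omega> - S n \<omega>)" "\<omega> \<in> space M"
            unfolding B_def by blast
          then have "\<epsilon> < norm (psum ?\<beta> t N (noise \<omega>))"
            using \<epsilon>(2) psum_truncate[OF N(1)] unfolding S_def by (simp add: order_le_less_trans)
          then show "\<omega> \<in> {\<omega> \<in> space M. \<exists>N. \<epsilon> < norm (psum ?\<beta> t N (noise \<omega>))}" using N(3) by blast
        qed
      qed measurable
      also have "\<dots> \<le> 2 ^ CARD('d) * \<epsilon>"
        by (rule Levy_all[of n]) (use n psum_truncate in \<open>simp add: S_def\<close>)
      finally show ?thesis using \<epsilon>(3) by simp
    qed
    then have "prob (B e) \<le> 0" by (rule field_le_epsilon)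
    then show ?thesis using measure_nonneg[of M "B e"] by linarith
  qed
  have "AE \<omega> in M. \<forall>e. \<omega> \<notin> B e"
    unfolding AE_all_countable using B0 Bm by (auto intro!: AE_not_in simp: null_setsI emeasure_eq_measure)
  then show ?thesis
    unfolding AE_rect_convergent_def rect_convergent_iff_Cauchy
    using AE_space
  proof eventually_elim
    case (elim \<omega>)
    then show ?case unfolding B_def S_def psum_def by (simp add: not_less)
  qed
qed

end

section \<open>Causal solutions and convergence\<close>

context iid_symmetric begin

section \<open>Sigma-algebras generated by the noise on an index set, independence and
  approximation\<close>

definition Fsig :: "(int ^ 'd) set \<Rightarrow> 'a measure" where
  "Fsig C = sigma (space M) {Z s -` A \<inter> space M | s A. s \<in> C \<and> A \<in> sets borel}"

lemma past_sigma_eq: "past_sigma M Z t = Fsig {s. s \<le> t}"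
  unfolding past_sigma_def Fsig_def by simp

lemma space_Fsig [simp]: "space (Fsig C) = space M"
  by (simp add: Fsig_def space_measure_of_conv)

lemma sets_Fsig: "sets (Fsig C) = sigma_sets (space M) {Z s -` A \<inter> space M | s A. s \<in> C \<and> A \<in> sets borel}"
  unfolding Fsig_def by (rule sets_measure_of) auto

lemma Fsig_mono: "C \<subseteq> D \<Longrightarrow> sets (Fsig C) \<subseteq> sets (Fsig D)"
  unfolding sets_Fsig by (rule sigma_sets_mono') blast

lemma sets_Fsig_events: "sets (Fsig C) \<subseteq> events"
  unfolding sets_Fsig by (rule sets.sigma_sets_subset) (auto intro: measurable_sets[OF Z_measurable])

lemma measurable_Fsig_mono:
  assumes f: "f \<in> borel_measurable (Fsig C)" and CD: "C \<subseteq> D"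
  shows "f \<in> borel_measurable (Fsig D)"
proof (rule measurableI)
  fix A :: "'b set" assume "A \<in> sets borel"
  from measurable_sets[OF f this] Fsig_mono[OF CD]
  show "f -` A \<inter> space (Fsig D) \<in> sets (Fsig D)" by (simp add: subset_iff)
qed simp

lemma measurable_Fsig_M:
  assumes f: "f \<in> borel_measurable (Fsig C)"
  shows "f \<in> borel_measurable M"
proof (rule measurableI)
  fix A :: "'b set" assume "A \<in> sets borel"
  from measurable_sets[OF f this] sets_Fsig_events[of C]
  show "f -` A \<inter> space M \<in> events" by (simp add: subset_iff)
qed simp

lemma Z_Fsig_measurable: "s \<in> C \<Longrightarrow> Z s \<in> borel_measurable (Fsig C)"
  by (rule measurableI) (auto simp: sets_Fsig intro!: sigma_sets.Basic)

lemma indep_Fsig: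
  fixes f g :: "'a \<Rightarrow> complex"
  assumes CD: "C \<inter> D = {}" and f: "f \<in> borel_measurable (Fsig C)" and g: "g \<in> borel_measurable (Fsig D)"
  shows "indep_var borel f borel g"
proof -
  define E where "E s = {Z s -` A \<inter> space M | A. A \<in> sets borel}" for s
  have ind: "indep_sets E UNIV" using indep unfolding indep_vars_def2 E_def by blast
  \<comment> \<open>Two blocks indexed by \<open>bool\<close>: the independent, intersection-stable
    families \<open>E s\<close> are grouped into the sigma-algebras of \<open>C\<close> and of
    \<open>D\<close>.\<close>
  define J where "J b = (case b of True \<Rightarrow> C | False \<Rightarrow> D)" for b
  have "indep_sets (\<lambda>b. sigma_sets (space M) (\<Union>s\<in>J b. E s)) (UNIV :: bool set)"
  proof (rule indep_sets_collect_sigma)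
    show "indep_sets E (\<Union>j\<in>UNIV. J j)" by (rule indep_sets_mono_index[OF _ ind]) simp
    show "disjoint_family J" using CD by (auto simp: disjoint_family_on_def J_def split: bool.splits)
    fix s
    show "Int_stable (E s)"
    proof (rule Int_stableI)
      fix a b assume "a \<in> E s" "b \<in> E s"
      then obtain A B where "a = Z s -` A \<inter> space M" "b = Z s -` B \<inter> space M" "A \<in> sets borel" "B \<in> sets borel"
        unfolding E_def by blast
      then have "a \<inter> b = Z s -` (A \<inter> B) \<inter> space M" "A \<inter> B \<in> sets borel" by auto
      then show "a \<inter> b \<in> E s" unfolding E_def by blast
    qed
  qed
  moreover have "sigma_sets (space M) (\<Union>s\<in>C. E s) = sets (Fsig C)" for C
    unfolding sets_Fsig E_def by (rule arg_cong[where f = "sigma_sets (space M)"]) blast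
  ultimately have *: "indep_sets (\<lambda>b. sets (Fsig (J b))) UNIV" by simp
  have i: "indep_set (sets (Fsig C)) (sets (Fsig D))"
    unfolding indep_set_def
    by (rule indep_sets_cong[THEN iffD1, OF refl _ *]) (auto simp: J_def split: bool.split)
  have sub: "sigma_sets (space M) {h -` A \<inter> space M | A. A \<in> sets borel} \<subseteq> sets (Fsig C)"
    if h: "h \<in> borel_measurable (Fsig C)" for h :: "'a \<Rightarrow> complex" and C
  proof -
    have "sigma_sets (space (Fsig C)) {h -` A \<inter> space M | A. A \<in> sets borel} \<subseteq> sets (Fsig C)"
      by (rule sets.sigma_sets_subset) (use measurable_sets[OF h] in auto)
    then show ?thesis by simp
  qed
  have "indep_set (sigma_sets (space M) {f -` A \<inter> space M | A. A \<in> sets borel})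
     (sigma_sets (space M) {g -` A \<inter> space M | A. A \<in> sets borel})"
    unfolding indep_sets2_eq
  proof (intro conjI ballI)
    show "sigma_sets (space M) {f -` A \<inter> space M |A. A \<in> sets borel} \<subseteq> events"
      "sigma_sets (space M) {g -` A \<inter> space M |A. A \<in> sets borel} \<subseteq> events"
      using order_trans[OF sub[OF f] sets_Fsig_events] order_trans[OF sub[OF g] sets_Fsig_events] .
    fix a b assume "a \<in> sigma_sets (space M) {f -` A \<inter> space M |A. A \<in> sets borel}"
      "b \<in> sigma_sets (space M) {g -` A \<inter> space M |A. A \<in> sets borel}"
    then show "prob (a \<inter> b) = prob a * prob b"
      using indep_setD[OF i] sub[OF f] sub[OF g] by (meson subsetD)
  qed
  then show ?thesis
    unfolding indep_var_eq using measurable_Fsig_M[OF f] measurable_Fsig_M[OF g] by blast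
qed

text \<open>By Fubini the probability in the hypothesis is an average over the values u of
  \<open>U\<close> of P(|W - u| > \<delta>). If every constant were at least as bad as
  \<open>\<eta>\<close>, so would be the average.\<close>

lemma indep_difference_concentrated:
  fixes W U :: "'a \<Rightarrow> complex"
  assumes ind: "indep_var borel W borel U" and small: "\<P>(\<omega> in M. \<delta> < norm (W \<omega> - U \<omega>)) < \<eta>"
  shows "\<exists>c. \<P>(\<omega> in M. \<delta> < norm (W \<omega> - c)) < \<eta>"
proof (rule ccontr)
  assume "\<not> ?thesis"
  then have big: "\<And>c. \<eta> \<le> \<P>(\<omega> in M. \<delta> < norm (W \<omega> - c))" by (meson not_less)
  have rv[measurable]: "W \<in> borel_measurable M" "U \<in> borel_measurable M"
    using ind unfolding indep_var_eq by auto
  interpret MW: prob_space "distr M borel W" by (rule prob_space_distr) simp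
  interpret MU: prob_space "distr M borel U" by (rule prob_space_distr) simp
  define Q where "Q = {x :: complex \<times> complex. \<delta> < norm (snd x - fst x)}"
  have Qb: "Q \<in> sets borel"
  proof -
    have "open Q" unfolding Q_def by (intro open_Collect_less continuous_intros)
    then show ?thesis by simp
  qed
  then have Q: "Q \<in> sets (borel \<Otimes>\<^sub>M borel)" unfolding borel_prod .
  have "indep_var borel U borel W"
    using ind unfolding indep_var_eq indep_sets2_eq by (metis (no_types, lifting) Int_commute mult.commute)
  then have joint: "distr M borel U \<Otimes>\<^sub>M distr M borel W = distr M (borel \<Otimes>\<^sub>M borel) (\<lambda>\<omega>. (U \<omega>, W \<omega>))"
    using indep_var_distribution_eq by blast
  have "ennreal \<eta> = (\<integral>\<^sup>+u. ennreal \<eta> \<partial>distr M borel U)"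
    using MU.emeasure_space_1 by simp
  also have "\<dots> \<le> (\<integral>\<^sup>+u. emeasure (distr M borel W) (Pair u -` Q) \<partial>distr M borel U)"
  proof (rule nn_integral_mono)
    fix u :: complex
    have "{w. \<delta> < norm (w - u)} \<in> sets borel" by measurable
    then have "emeasure (distr M borel W) (Pair u -` Q) = ennreal (\<P>(\<omega> in M. \<delta> < norm (W \<omega> - u)))"
      by (simp add: Q_def vimage_def emeasure_distr Int_def conj_commute emeasure_eq_measure)
    then show "ennreal \<eta> \<le> emeasure (distr M borel W) (Pair u -` Q)" using big[of u] by (simp add: ennreal_leI)
  qed
  also have "\<dots> = emeasure (distr M borel U \<Otimes>\<^sub>M distr M borel W) Q"
    by (rule MW.emeasure_pair_measure_alt[symmetric]) (use Q in simp)
  also have "\<dots> = ennreal (\<P>(\<omega> in M. \<delta> < norm (W \<omega> - U \<omega>)))"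
    unfolding joint using Q
    by (subst emeasure_distr) (auto simp: Q_def vimage_def Int_def conj_commute emeasure_eq_measure)
  finally have "\<eta> \<le> \<P>(\<omega> in M. \<delta> < norm (W \<omega> - U \<omega>))"
    by (simp add: ennreal_le_iff)
  then show False using small by simp
qed

text \<open>A generator involves one index, which lies in some \<open>D m\<close>; approximability
  then passes to complements and countable unions. Since \<open>D\<close> increases, finitely many
  approximants fit into one \<open>Fsig (D k)\<close>.\<close>

lemma Fsig_approx_set:
  assumes D: "incseq D" and E: "E \<in> sets (Fsig (\<Union>m. D m))" and e: "\<epsilon> > 0"
  shows "\<exists>m. \<exists>C\<in>sets (Fsig (D m)). prob ((E - C) \<union> (C - E)) < \<epsilon>"
proof -
  have "E \<in> sigma_sets (space M) {Z s -` A \<inter> space M | s A. s \<in> (\<Union>m. D m) \<and> A \<in> sets borel}"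
    using E by (simp add: sets_Fsig)
  then show ?thesis using e
  proof (induction arbitrary: \<epsilon> rule: sigma_sets.induct)
    case (Basic a)
    then obtain s A m where a: "a = Z s -` A \<inter> space M" "s \<in> D m" "A \<in> sets borel" by blast
    then have "a \<in> sets (Fsig (D m))" unfolding sets_Fsig by (intro sigma_sets.Basic) blast
    then show ?case using Basic by (intro exI[of _ m] bexI[of _ a]) auto
  next
    case Empty
    then show ?case by (intro exI[of _ 0] bexI[of _ "{}"]) auto
  next
    case (Compl a)
    obtain m C where C: "C \<in> sets (Fsig (D m))" "prob ((a - C) \<union> (C - a)) < \<epsilon>" using Compl by blast
    have sub: "C \<subseteq> space M" using sets.sets_into_space[OF C(1)] by simp
    have "space M - C \<in> sets (Fsig (D m))" using sets.compl_sets[OF C(1)] by simp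
    moreover have "((space M - a) - (space M - C)) \<union> ((space M - C) - (space M - a)) = (a - C) \<inter> space M \<union> (C - a)"
      using sub by blast
    moreover have "prob ((a - C) \<inter> space M \<union> (C - a)) \<le> prob ((a - C) \<union> (C - a))"
    proof (rule finite_measure_mono)
      have "a \<in> sets (Fsig (\<Union>m. D m))" using Compl(1) by (simp add: sets_Fsig)
      then show "a - C \<union> (C - a) \<in> events" using C(1) sets_Fsig_events by blast
    qed blast
    ultimately show ?case using C(2) by (intro exI[of _ m] bexI[of _ "space M - C"]) auto
  next
    case (Union a)
    have am: "a i \<in> events" for i
    proof -
      have "a i \<in> sets (Fsig (\<Union>m. D m))" using Union(1)[of i] by (simp add: sets_Fsig)
      then show ?thesis using sets_Fsig_events by blast
    qed
    have "(\<lambda>n. prob (\<Union>i<n. a i)) \<longlonglongrightarrow> prob (\<Union>n. \<Union>i<n. a i)"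
      by (rule finite_Lim_measure_incseq) (use am in \<open>auto simp: incseq_def intro: order_less_le_trans\<close>)
    moreover have "(\<Union>n. \<Union>i<n. a i) = (\<Union>i. a i)" by blast
    ultimately have "\<forall>\<^sub>F n in sequentially. prob (\<Union>i. a i) - \<epsilon> / 2 < prob (\<Union>i<n. a i)"
      using Union(3) by (intro order_tendstoD) auto
    then obtain n where n: "prob (\<Union>i. a i) - \<epsilon> / 2 < prob (\<Union>i<n. a i)"
      using eventually_happens trivial_limit_sequentially by blast
    have tail: "prob ((\<Union>i. a i) - (\<Union>i<n. a i)) < \<epsilon> / 2"
      using n am by (subst finite_measure_Diff) auto
    \<comment> \<open>Half of \<open>\<epsilon>\<close> is spent on the tail of the union, the other
      half is shared by \<open>n\<close> approximations. The added 1 keeps the denominator positive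
      for \<open>n = 0\<close>.\<close>
    define \<eta> where "\<eta> = \<epsilon> / (2 * (real n + 1))"
    have \<eta>: "\<eta> > 0" "real n * \<eta> \<le> \<epsilon> / 2" unfolding \<eta>_def using Union(3) by (auto simp: field_simps)
    have "\<forall>i. \<exists>m C. C \<in> sets (Fsig (D m)) \<and> prob ((a i - C) \<union> (C - a i)) < \<eta>"
      using Union(2)[OF \<eta>(1)] by blast
    then obtain m C where C: "\<And>i. C i \<in> sets (Fsig (D (m i)))" "\<And>i. prob ((a i - C i) \<union> (C i - a i)) < \<eta>"
      by metis
    define k where "k = (\<Sum>i<n. m i)"
    have "C i \<in> sets (Fsig (D k))" if "i < n" for i
    proof -
      have "m i \<le> k" unfolding k_def using that by (intro member_le_sum) auto
      then have "D (m i) \<subseteq> D k" using D by (simp add: incseq_def)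
      then show ?thesis using C(1)[of i] Fsig_mono by blast
    qed
    then have Ck: "(\<Union>i<n. C i) \<in> sets (Fsig (D k))" by (intro sets.finite_UN) auto
    have Cm: "C i \<in> events" for i using C(1) sets_Fsig_events by blast
    have "prob (((\<Union>i. a i) - (\<Union>i<n. C i)) \<union> ((\<Union>i<n. C i) - (\<Union>i. a i))) \<le>
      prob (((\<Union>i. a i) - (\<Union>i<n. a i)) \<union> (\<Union>i<n. (a i - C i) \<union> (C i - a i)))"
    proof (rule finite_measure_mono)
      show "((\<Union>i. a i) - (\<Union>i<n. a i)) \<union> (\<Union>i<n. (a i - C i) \<union> (C i - a i)) \<in> events"
        using am Cm by (intro sets.Un sets.Diff sets.finite_UN sets.countable_UN) auto
    qed blast
    also have "\<dots> \<le> prob ((\<Union>i. a i) - (\<Union>i<n. a i)) + prob (\<Union>i<n. (a i - C i) \<union> (C i - a i))"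
      using am Cm by (intro measure_Un_le sets.Un sets.Diff sets.finite_UN sets.countable_UN) auto
    also have "prob (\<Union>i<n. (a i - C i) \<union> (C i - a i)) \<le> (\<Sum>i<n. prob ((a i - C i) \<union> (C i - a i)))"
      using am Cm by (intro finite_measure_subadditive_finite) auto
    also have "\<dots> \<le> (\<Sum>i<n. \<eta>)" by (intro sum_mono less_imp_le C(2))
    also have "\<dots> \<le> \<epsilon> / 2" using \<eta>(2) by simp
    finally have "prob (((\<Union>i. a i) - (\<Union>i<n. C i)) \<union> ((\<Union>i<n. C i) - (\<Union>i. a i))) < \<epsilon>" using tail by simp
    then show ?case using Ck by blast
  qed
qed

text \<open>A simple function close to \<open>Y\<close> in probability has finitely many level sets,
  and each is replaced by a set from one \<open>Fsig (D k)\<close>.\<close>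

lemma Fsig_approx_function:
  fixes Y :: "'a \<Rightarrow> complex"
  assumes D: "incseq D" and Y: "Y \<in> borel_measurable (Fsig (\<Union>m. D m))" and e: "\<epsilon> > 0"
  shows "\<exists>m. \<exists>V\<in>borel_measurable (Fsig (D m)). \<P>(\<omega> in M. \<epsilon> < norm (Y \<omega> - V \<omega>)) < \<epsilon>"
proof -
  let ?F = "Fsig (\<Union>m. D m)"
  obtain G where G: "\<And>i. simple_function ?F (G i)" "\<And>\<omega>. \<omega> \<in> space M \<Longrightarrow> (\<lambda>i. G i \<omega>) \<longlonglongrightarrow> Y \<omega>"
    using borel_measurable_implies_sequence_metric[OF Y, of 0] by auto
  have Gm: "G i \<in> borel_measurable ?F" for i using G(1) by (rule borel_measurable_simple_function)
  have [measurable]: "G i \<in> borel_measurable M" "Y \<in> borel_measurable M" for i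
    using measurable_Fsig_M[OF Gm] measurable_Fsig_M[OF Y] by auto
  define B where "B n = {\<omega> \<in> space M. \<epsilon> / 2 < norm (Y \<omega> - G n \<omega>)}" for n
  have Bm: "B n \<in> events" for n unfolding B_def by measurable
  obtain n where n: "prob (B n) < \<epsilon> / 2"
    using AE_tendsto_imp_prob_less[of G Y "\<epsilon> / 2"] G(2) e unfolding B_def by (auto intro: AE_I2)
  define R where "R = G n ` space M"
  have R: "finite R" using simple_functionD(1)[OF G(1)[of n]] unfolding R_def by simp
  define E where "E y = G n -` {y} \<inter> space M" for y
  have E: "E y \<in> sets ?F" for y using simple_functionD(2)[OF G(1)[of n], of "{y}"] unfolding E_def by simp
  define \<eta> where "\<eta> = \<epsilon> / (2 * (real (card R) + 1))"
  have \<eta>: "\<eta> > 0" "real (card R) * \<eta> \<le> \<epsilon> / 2" unfolding \<eta>_def using e by (auto simp: field_simps)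
  have "\<forall>y. \<exists>m C. C \<in> sets (Fsig (D m)) \<and> prob ((E y - C) \<union> (C - E y)) < \<eta>"
    using Fsig_approx_set[OF D E \<eta>(1)] by blast
  then obtain m C where C: "\<And>y. C y \<in> sets (Fsig (D (m y)))" "\<And>y. prob ((E y - C y) \<union> (C y - E y)) < \<eta>"
    by metis
  define k where "k = (\<Sum>y\<in>R. m y)"
  have Ck: "C y \<in> sets (Fsig (D k))" if "y \<in> R" for y
  proof -
    have "m y \<le> k" unfolding k_def using that R by (intro member_le_sum) auto
    then have "D (m y) \<subseteq> D k" using D by (simp add: incseq_def)
    then show ?thesis using C(1)[of y] Fsig_mono by blast
  qed
  have Cm: "C y \<in> events" for y using C(1) sets_Fsig_events by blast
  have Em: "E y \<in> events" for y using E sets_Fsig_events by blast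
  \<comment> \<open>The sets \<open>C y\<close> may overlap or leave gaps, so \<open>V\<close> need
    not take its values in \<open>R\<close>; it agrees with \<open>G n\<close> off the small
    symmetric differences.\<close>
  define V where "V \<omega> = (\<Sum>y\<in>R. y * indicator (C y) \<omega>)" for \<omega>
  have V: "V \<in> borel_measurable (Fsig (D k))"
    unfolding V_def by (intro borel_measurable_sum borel_measurable_times borel_measurable_const borel_measurable_indicator Ck)
  have VG: "V \<omega> = G n \<omega>" if sp: "\<omega> \<in> space M" and nb: "\<And>y. y \<in> R \<Longrightarrow> \<omega> \<notin> (E y - C y) \<union> (C y - E y)" for \<omega>
  proof -
    have "V \<omega> = (\<Sum>y\<in>R. if y = G n \<omega> then y else 0)"
      unfolding V_def
    proof (rule sum.cong[OF refl])
      fix y assume "y \<in> R"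
      from nb[OF this] have "\<omega> \<in> C y \<longleftrightarrow> y = G n \<omega>" using sp unfolding E_def by blast
      then show "y * indicator (C y) \<omega> = (if y = G n \<omega> then y else 0)" by (simp add: indicator_def)
    qed
    also have "\<dots> = G n \<omega>" using R sp by (simp add: R_def)
    finally show ?thesis .
  qed
  have "\<P>(\<omega> in M. \<epsilon> < norm (Y \<omega> - V \<omega>)) \<le> prob (B n \<union> (\<Union>y\<in>R. (E y - C y) \<union> (C y - E y)))"
  proof (rule finite_measure_mono)
    show "B n \<union> (\<Union>y\<in>R. (E y - C y) \<union> (C y - E y)) \<in> events"
      using Bm Em Cm R by (intro sets.Un sets.finite_UN sets.Diff) auto
    show "{\<omega> \<in> space M. \<epsilon> < norm (Y \<omega> - V \<omega>)} \<subseteq> B n \<union> (\<Union>y\<in>R. (E y - C y) \<union> (C y - E y))"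
    proof
      fix \<omega> assume \<omega>: "\<omega> \<in> {\<omega> \<in> space M. \<epsilon> < norm (Y \<omega> - V \<omega>)}"
      show "\<omega> \<in> B n \<union> (\<Union>y\<in>R. (E y - C y) \<union> (C y - E y))"
      proof (rule ccontr)
        assume nb: "\<omega> \<notin> B n \<union> (\<Union>y\<in>R. (E y - C y) \<union> (C y - E y))"
        then have "V \<omega> = G n \<omega>" using \<omega> by (intro VG) auto
        then have "\<omega> \<in> B n" using \<omega> e unfolding B_def by auto
        then show False using nb by blast
      qed
    qed
  qed
  also have "\<dots> \<le> prob (B n) + prob (\<Union>y\<in>R. (E y - C y) \<union> (C y - E y))"
    using Bm Em Cm R by (intro measure_Un_le sets.finite_UN sets.Un sets.Diff) auto
  also have "prob (\<Union>y\<in>R. (E y - C y) \<union> (C y - E y)) \<le> (\<Sum>y\<in>R. prob ((E y - C y) \<union> (C y - E y)))"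
    using Em Cm R by (intro finite_measure_subadditive_finite) auto
  also have "\<dots> \<le> (\<Sum>y\<in>R. \<eta>)" by (intro sum_mono less_imp_le C(2))
  also have "\<dots> \<le> \<epsilon> / 2" using \<eta>(2) by simp
  finally have "\<P>(\<omega> in M. \<epsilon> < norm (Y \<omega> - V \<omega>)) < \<epsilon>" using n by simp
  then show ?thesis using V by blast
qed

text \<open>
  Here \<open>p\<close> is the lower corner of the box. The proof moves \<open>t\<close> towards \<open>p\<close> with the ARMA equation;
  once \<open>t\<close> has left the box, the box sum is empty and causality suffices.
\<close>

lemma causal_remainder:
  assumes R: "finite R" "0 \<notin> R" and S: "finite S" "0 \<notin> S"
    and Y: "causal_solution M R \<phi> S \<theta> Z Y" and rec: "arma_recursion R \<phi> S \<theta> \<alpha>"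
  shows "\<exists>W\<in>borel_measurable (Fsig {s. \<not> p \<le> s}). AE \<omega> in M. Y t \<omega> - box_sum \<alpha> (noise \<omega>) p t = W \<omega>"
proof -
  have base: "\<exists>W\<in>borel_measurable (Fsig {s. \<not> p \<le> s}). AE \<omega> in M. Y t \<omega> - box_sum \<alpha> (noise \<omega>) p t = W \<omega>"
    if "\<not> p \<le> t" for t
  proof (rule bexI[of _ "Y t"])
    have "Y t \<in> borel_measurable (Fsig {s. s \<le> t})"
      using Y unfolding causal_solution_def past_sigma_eq by blast
    then show "Y t \<in> borel_measurable (Fsig {s. \<not> p \<le> s})"
      by (rule measurable_Fsig_mono) (use that in \<open>auto intro: order_trans\<close>)
  qed (simp add: box_sum_empty[OF that])
  show ?thesis
  proof (induction "\<Sum>i\<in>UNIV. nat (t $ i - p $ i)" arbitrary: t rule: less_induct)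
    case (less t)
    show ?case
    proof (cases "p \<le> t")
      case True
      have "\<exists>W\<in>borel_measurable (Fsig {s. \<not> p \<le> s}). AE \<omega> in M. Y (t - int_vec n) \<omega> - box_sum \<alpha> (noise \<omega>) p (t - int_vec n) = W \<omega>"
        if n: "n \<in> R" for n
      proof (cases "p \<le> t - int_vec n")
        case le: True
        have "n \<noteq> 0" using n R by metis
        then obtain i where i: "n $ i > 0" by (auto simp: vec_eq_iff)
        have "(\<Sum>i\<in>UNIV. nat ((t - int_vec n) $ i - p $ i)) < (\<Sum>i\<in>UNIV. nat (t $ i - p $ i))"
        proof (rule sum_strict_mono_ex1)
          have "p $ i \<le> t $ i - int (n $ i)" using le by (simp add: less_eq_vec_def)
          then show "\<exists>i\<in>UNIV. nat ((t - int_vec n) $ i - p $ i) < nat (t $ i - p $ i)"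
            using i by (intro bexI[of _ i]) auto
        qed auto
        then show ?thesis by (rule less)
      qed (rule base)
      then have "\<forall>n. \<exists>W. n \<in> R \<longrightarrow> W \<in> borel_measurable (Fsig {s. \<not> p \<le> s}) \<and>
          (AE \<omega> in M. Y (t - int_vec n) \<omega> - box_sum \<alpha> (noise \<omega>) p (t - int_vec n) = W \<omega>)" by blast
      from choice[OF this] obtain W where W: "\<And>n. n \<in> R \<Longrightarrow> W n \<in> borel_measurable (Fsig {s. \<not> p \<le> s})"
        "\<And>n. n \<in> R \<Longrightarrow> AE \<omega> in M. Y (t - int_vec n) \<omega> - box_sum \<alpha> (noise \<omega>) p (t - int_vec n) = W n \<omega>"
        by blast
      \<comment> \<open>The moving average terms outside the box. Those inside cancel against the
        box sums, by \<open>box_sum_arma\<close>.\<close>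
      let ?J = "{j \<in> insert 0 S. \<not> p \<le> t - int_vec j}"
      define V where "V \<omega> = (\<Sum>n\<in>R. \<phi> n * W n \<omega>) + (\<Sum>j\<in>?J. ma_coeff S \<theta> j * Z (t - int_vec j) \<omega>)" for \<omega>
      have "V \<in> borel_measurable (Fsig {s. \<not> p \<le> s})"
        unfolding V_def
        by (intro borel_measurable_add borel_measurable_sum borel_measurable_times borel_measurable_const W Z_Fsig_measurable) auto
      moreover have "AE \<omega> in M. Y t \<omega> - box_sum \<alpha> (noise \<omega>) p t = V \<omega>"
      proof -
        have "AE \<omega> in M. \<forall>n\<in>R. Y (t - int_vec n) \<omega> - box_sum \<alpha> (noise \<omega>) p (t - int_vec n) = W n \<omega>"
          using W(2) R(1) by (intro AE_finite_allI) auto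
        moreover have "AE \<omega> in M. Y t \<omega> - (\<Sum>n\<in>R. \<phi> n * Y (t - int_vec n) \<omega>) =
            Z t \<omega> + (\<Sum>n\<in>S. \<theta> n * Z (t - int_vec n) \<omega>)"
          using Y unfolding causal_solution_def arma_equation_def by blast
        ultimately show ?thesis
        proof eventually_elim
          case (elim \<omega>)
          let ?z = "\<lambda>s. Z s \<omega>"
          have "Y t \<omega> - box_sum \<alpha> ?z p t = (\<Sum>n\<in>R. \<phi> n * (Y (t - int_vec n) \<omega> - box_sum \<alpha> ?z p (t - int_vec n)))
            + (Z t \<omega> + (\<Sum>n\<in>S. \<theta> n * Z (t - int_vec n) \<omega>))
            - (box_sum \<alpha> ?z p t - (\<Sum>n\<in>R. \<phi> n * box_sum \<alpha> ?z p (t - int_vec n)))"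
            using elim(2) by (simp add: right_diff_distrib sum_subtractf algebra_simps)
          also have "(\<Sum>n\<in>R. \<phi> n * (Y (t - int_vec n) \<omega> - box_sum \<alpha> ?z p (t - int_vec n))) = (\<Sum>n\<in>R. \<phi> n * W n \<omega>)"
            using elim(1) by (intro sum.cong) auto
          also have "box_sum \<alpha> ?z p t - (\<Sum>n\<in>R. \<phi> n * box_sum \<alpha> ?z p (t - int_vec n)) =
             (\<Sum>j | j \<in> insert 0 S \<and> p \<le> t - int_vec j. ma_coeff S \<theta> j * Z (t - int_vec j) \<omega>)"
            unfolding box_sum_arma[OF R(1) rec] box_sum_ma_coeff[OF S(1)] ..
          also have "Z t \<omega> + (\<Sum>n\<in>S. \<theta> n * Z (t - int_vec n) \<omega>) =
             (\<Sum>j\<in>insert 0 S. ma_coeff S \<theta> j * Z (t - int_vec j) \<omega>)"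
            by (rule ma_sum_eq[OF S, where x = ?z])
          also have "\<dots> = (\<Sum>j | j \<in> insert 0 S \<and> p \<le> t - int_vec j. ma_coeff S \<theta> j * Z (t - int_vec j) \<omega>) +
             (\<Sum>j\<in>?J. ma_coeff S \<theta> j * Z (t - int_vec j) \<omega>)"
            using S(1) by (subst sum.union_disjoint[symmetric]) (auto intro!: sum.cong)
          finally show ?case by (simp add: V_def)
        qed
      qed
      ultimately show ?thesis by blast
    qed (rule base)
  qed
qed

lemma psum_eq_box_sum: "psum \<alpha> t N x = box_sum \<alpha> x (t - int_vec N) t"
  by (simp add: psum_def box_sum_eq)

text \<open>Let V approximate \<open>Y t\<close> using noise in a cube. For every box containing the
  cube, U = V - A_N lives inside the box, W = Y - A_N outside, and W - U = Y - V is small;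
  \<open>indep_difference_concentrated\<close> applies. The centring constant may depend on
  \<open>N\<close>.\<close>

lemma causal_concentration:
  assumes R: "finite R" "0 \<notin> R" and S: "finite S" "0 \<notin> S"
    and Y: "causal_solution M R \<phi> S \<theta> Z Y" and rec: "arma_recursion R \<phi> S \<theta> \<alpha>" and e: "\<epsilon> > 0"
  shows "\<exists>n. \<forall>N\<ge>n. \<exists>c. \<P>(\<omega> in M. \<epsilon> < norm (Y t \<omega> - psum \<alpha> t N (noise \<omega>) - c)) < \<epsilon>"
proof -
  define D where "D m = {s. t - int_vec (\<chi> i. m) \<le> s \<and> s \<le> t}" for m :: nat
  have D: "incseq D"
    unfolding D_def incseq_def
  proof (intro allI impI subsetI, safe)
    fix m n :: nat and s assume "m \<le> n" "t - int_vec (\<chi> i. m) \<le> s"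
    moreover from \<open>m \<le> n\<close> have "t - int_vec (\<chi> i. n) \<le> t - int_vec (\<chi> i. m)" by (simp add: less_eq_vec_def)
    ultimately show "t - int_vec (\<chi> i. n) \<le> s" by (rule_tac order_trans)
  qed
  have "(\<Union>m. D m) = {s. s \<le> t}"
  proof (intro equalityI subsetI)
    fix s assume "s \<in> {s. s \<le> t}"
    define m where "m = (\<Sum>i\<in>UNIV. nat (t $ i - s $ i))"
    have "nat (t $ i - s $ i) \<le> m" for i unfolding m_def by (rule member_le_sum) auto
    then have "t $ i - int m \<le> s $ i" for i by (metis diff_le_eq add.commute nat_le_iff)
    then have "s \<in> D m" using \<open>s \<in> {s. s \<le> t}\<close> by (simp add: D_def less_eq_vec_def)
    then show "s \<in> (\<Union>m. D m)" by blast
  qed (auto simp: D_def)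
  then have Yt: "Y t \<in> borel_measurable (Fsig (\<Union>m. D m))"
    using Y unfolding causal_solution_def past_sigma_eq by simp
  obtain m V where V: "V \<in> borel_measurable (Fsig (D m))" "\<P>(\<omega> in M. \<epsilon> < norm (Y t \<omega> - V \<omega>)) < \<epsilon>"
    using Fsig_approx_function[OF D Yt e] by blast
  have [measurable]: "Y t \<in> borel_measurable M" "V \<in> borel_measurable M"
    using measurable_Fsig_M Yt V(1) by auto
  show ?thesis
  proof (intro exI[of _ "\<chi> i. m"] allI impI)
    fix N :: "nat ^ 'd" assume N: "(\<chi> i. m) \<le> N"
    define p where "p = t - int_vec N"
    obtain W where W: "W \<in> borel_measurable (Fsig {s. \<not> p \<le> s})"
      "AE \<omega> in M. Y t \<omega> - box_sum \<alpha> (noise \<omega>) p t = W \<omega>"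
      using causal_remainder[OF R S Y rec] by blast
    define U where "U \<omega> = V \<omega> - psum \<alpha> t N (noise \<omega>)" for \<omega>
    have "p \<le> t - int_vec (\<chi> i. m)" using N by (simp add: p_def less_eq_vec_def)
    then have "D m \<subseteq> {s. p \<le> s}" unfolding D_def by (auto intro: order_trans)
    then have Vp: "V \<in> borel_measurable (Fsig {s. p \<le> s})" using V(1) measurable_Fsig_mono by blast
    have U: "U \<in> borel_measurable (Fsig {s. p \<le> s})"
      unfolding U_def psum_def
    proof (intro borel_measurable_diff borel_measurable_sum borel_measurable_times borel_measurable_const Vp Z_Fsig_measurable)
      fix k assume "k \<in> {k. k \<le> N}"
      then show "t - int_vec k \<in> {s. p \<le> s}" by (simp add: p_def less_eq_vec_def)
    qed
    have [measurable]: "W \<in> borel_measurable M" "U \<in> borel_measurable M" using measurable_Fsig_M W(1) U by auto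
    have ind: "indep_var borel W borel U" by (rule indep_Fsig[OF _ W(1) U]) blast
    have "\<P>(\<omega> in M. \<epsilon> < norm (W \<omega> - U \<omega>)) = \<P>(\<omega> in M. \<epsilon> < norm (Y t \<omega> - V \<omega>))"
    proof (rule finite_measure_eq_AE)
      show "AE x in M. (x \<in> {\<omega> \<in> space M. \<epsilon> < norm (W \<omega> - U \<omega>)}) = (x \<in> {\<omega> \<in> space M. \<epsilon> < norm (Y t \<omega> - V \<omega>)})"
        using W(2)
      proof eventually_elim
        case (elim \<omega>)
        have "W \<omega> - U \<omega> = Y t \<omega> - V \<omega>" using elim by (simp add: U_def psum_eq_box_sum p_def[symmetric] algebra_simps)
        then show ?case by simp
      qed
    qed measurable
    then have "\<P>(\<omega> in M. \<epsilon> < norm (W \<omega> - U \<omega>)) < \<epsilon>" using V(2) by simp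
    from indep_difference_concentrated[OF ind this] obtain c where c: "\<P>(\<omega> in M. \<epsilon> < norm (W \<omega> - c)) < \<epsilon>" ..
    have "\<P>(\<omega> in M. \<epsilon> < norm (W \<omega> - c)) = \<P>(\<omega> in M. \<epsilon> < norm (Y t \<omega> - psum \<alpha> t N (noise \<omega>) - c))"
    proof (rule finite_measure_eq_AE)
      show "AE x in M. (x \<in> {\<omega> \<in> space M. \<epsilon> < norm (W \<omega> - c)}) =
         (x \<in> {\<omega> \<in> space M. \<epsilon> < norm (Y t \<omega> - psum \<alpha> t N (noise \<omega>) - c)})"
        using W(2) by eventually_elim (simp add: psum_eq_box_sum p_def[symmetric])
    qed measurable
    then show "\<exists>c. \<P>(\<omega> in M. \<epsilon> < norm (Y t \<omega> - psum \<alpha> t N (noise \<omega>) - c)) < \<epsilon>"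
      using c by auto
  qed
qed

lemma psum_uminus: "psum \<alpha> t N (\<lambda>s. - x s) = - psum \<alpha> t N x"
  by (simp add: psum_def sum_negf)

text \<open>Subtracting the concentration statements for \<open>N\<close> and \<open>n\<close> puts
  the increment near a constant \<open>b\<close>. Changing the sign of all noise puts it near
  \<open>-b\<close> as well, and an outcome common to both estimates forces \<open>b\<close> to be
  small.\<close>

lemma causal_Cauchy:
  assumes R: "finite R" "0 \<notin> R" and S: "finite S" "0 \<notin> S"
    and Y: "causal_solution M R \<phi> S \<theta> Z Y" and rec: "arma_recursion R \<phi> S \<theta> \<alpha>" and e: "\<epsilon> > 0"
  shows "\<exists>n. \<forall>N\<ge>n. \<P>(\<omega> in M. \<epsilon> < norm (psum \<alpha> t N (noise \<omega>) - psum \<alpha> t n (noise \<omega>))) \<le> \<epsilon>"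
proof -
  \<comment> \<open>The bound 1/4 makes the two failure probabilities, each below 2\<delta>, sum to
    less than 1. The bound \<epsilon>/4 leaves room for the increment error 2\<delta> and for |b| at
    most 2\<delta>.\<close>
  define \<delta> where "\<delta> = min (\<epsilon> / 4) (1 / 4)"
  have \<delta>: "\<delta> > 0" "4 * \<delta> \<le> \<epsilon>" "4 * \<delta> \<le> 1" unfolding \<delta>_def using e by auto
  define A where "A N \<omega> = psum \<alpha> t N (noise \<omega>)" for N \<omega>
  have [measurable]: "A N \<in> borel_measurable M" for N unfolding A_def by measurable
  have [measurable]: "Y t \<in> borel_measurable M"
    using Y unfolding causal_solution_def strictly_stationary_def by blast
  obtain n where n: "\<And>N. N \<ge> n \<Longrightarrow> \<exists>c. \<P>(\<omega> in M. \<delta> < norm (Y t \<omega> - A N \<omega> - c)) < \<delta>"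
    using causal_concentration[OF R S Y rec \<delta>(1)] unfolding A_def by blast
  show ?thesis
  proof (intro exI[of _ n] allI impI)
    fix N assume N: "n \<le> N"
    obtain c where c: "\<P>(\<omega> in M. \<delta> < norm (Y t \<omega> - A N \<omega> - c)) < \<delta>" using n[OF N] by blast
    obtain c' where c': "\<P>(\<omega> in M. \<delta> < norm (Y t \<omega> - A n \<omega> - c')) < \<delta>" using n[OF order_refl] by blast
    define b where "b = c' - c"
    have 1: "\<P>(\<omega> in M. \<delta> + \<delta> < norm (A N \<omega> - A n \<omega> - b)) < 2 * \<delta>"
    proof -
      have "\<P>(\<omega> in M. \<delta> + \<delta> < norm (A N \<omega> - A n \<omega> - b)) \<le>
        \<P>(\<omega> in M. \<delta> < norm (Y t \<omega> - A N \<omega> - c)) + \<P>(\<omega> in M. \<delta> < norm (Y t \<omega> - A n \<omega> - c'))"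
      proof (rule prob_triangle)
        fix \<omega>
        have "A N \<omega> - A n \<omega> - b = (Y t \<omega> - A n \<omega> - c') - (Y t \<omega> - A N \<omega> - c)" by (simp add: b_def)
        then show "norm (A N \<omega> - A n \<omega> - b) \<le> norm (Y t \<omega> - A N \<omega> - c) + norm (Y t \<omega> - A n \<omega> - c')"
          by (metis add.commute norm_triangle_ineq4)
      qed measurable
      then show ?thesis using c c' by simp
    qed
    have 2: "\<P>(\<omega> in M. \<delta> + \<delta> < norm (A N \<omega> - A n \<omega> + b)) < 2 * \<delta>"
    proof -
      have "\<P>(\<omega> in M. (\<lambda>x. \<delta> + \<delta> < norm (psum \<alpha> t N x - psum \<alpha> t n x - b)) (\<lambda>s. - Z s \<omega>)) =
        \<P>(\<omega> in M. (\<lambda>x. \<delta> + \<delta> < norm (psum \<alpha> t N x - psum \<alpha> t n x - b)) (noise \<omega>))"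
        by (rule prob_field_law[OF law_preserving_uminus]) measurable
      moreover have "norm (- A N \<omega> + A n \<omega> - b) = norm (A N \<omega> - A n \<omega> + b)" for \<omega>
        by (metis add.commute diff_minus_eq_add minus_diff_eq norm_minus_cancel uminus_add_conv_diff diff_diff_eq2)
      ultimately show ?thesis using 1 unfolding psum_uminus A_def[symmetric] by simp
    qed
    obtain \<omega> where "norm (A N \<omega> - A n \<omega> - b) \<le> \<delta> + \<delta>" "norm (A N \<omega> - A n \<omega> + b) \<le> \<delta> + \<delta>"
    proof -
      have "\<exists>\<omega>\<in>space M. \<not> \<delta> + \<delta> < norm (A N \<omega> - A n \<omega> - b) \<and> \<not> \<delta> + \<delta> < norm (A N \<omega> - A n \<omega> + b)"
      proof (rule prob_add_less_1_common)
        show "\<P>(\<omega> in M. \<delta> + \<delta> < norm (A N \<omega> - A n \<omega> - b)) +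
          \<P>(\<omega> in M. \<delta> + \<delta> < norm (A N \<omega> - A n \<omega> + b)) < 1"
          using 1 2 \<delta> by linarith
      qed measurable
      then show ?thesis using that by (auto simp: not_less)
    qed
    then have "norm (2 * b) \<le> 4 * \<delta>"
      using norm_triangle_ineq4[of "A N \<omega> - A n \<omega> + b" "A N \<omega> - A n \<omega> - b"] by simp
    then have b: "norm b \<le> 2 * \<delta>" by (simp add: norm_mult)
    have "\<P>(\<omega> in M. \<epsilon> < norm (A N \<omega> - A n \<omega>)) \<le> \<P>(\<omega> in M. \<delta> + \<delta> < norm (A N \<omega> - A n \<omega> - b))"
    proof (rule finite_measure_mono)
      show "{\<omega> \<in> space M. \<epsilon> < norm (A N \<omega> - A n \<omega>)} \<subseteq> {\<omega> \<in> space M. \<delta> + \<delta> < norm (A N \<omega> - A n \<omega> - b)}"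
      proof safe
        fix \<omega> assume "\<epsilon> < norm (A N \<omega> - A n \<omega>)"
        then show "\<delta> + \<delta> < norm (A N \<omega> - A n \<omega> - b)"
          using norm_triangle_sub[of "A N \<omega> - A n \<omega>" b] b \<delta>(2) by linarith
      qed
    qed measurable
    also have "\<dots> \<le> \<epsilon>" using 1 \<delta> by simp
    finally show "\<P>(\<omega> in M. \<epsilon> < norm (psum \<alpha> t N (noise \<omega>) - psum \<alpha> t n (noise \<omega>))) \<le> \<epsilon>"
      unfolding A_def .
  qed
qed

end

section \<open>Square summability of the coefficients\<close>

lemma cos_le_quadratic:
  fixes x :: real assumes x: "\<bar>x\<bar> \<le> 1"
  shows "cos x \<le> 1 - x\<^sup>2 / 4"
proof -
  \<comment> \<open>The cubic Taylor term is imaginary, so the real part sees only 1 - x^2/2 with an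
    error of fourth order.\<close>
  define w where "w = iexp x - (\<Sum>k\<le>3. (\<i> * x) ^ k / fact k)"
  have "cmod w \<le> \<bar>x\<bar> ^ 4 / fact 4"
    using iexp_approx1[of x 3] by (simp add: w_def)
  moreover have "Re w = cos x - (1 - x\<^sup>2 / 2)"
    by (simp add: w_def numeral_3_eq_3 numeral_2_eq_2 power2_eq_square Re_exp)
  ultimately have "cos x - (1 - x\<^sup>2 / 2) \<le> \<bar>x\<bar> ^ 4 / fact 4"
    using complex_Re_le_cmod[of w] by linarith
  also have "\<bar>x\<bar> ^ 4 / fact 4 \<le> x\<^sup>2 / 24"
  proof -
    have "\<bar>x\<bar> ^ 4 = x\<^sup>2 * x\<^sup>2" by (simp add: power2_eq_square power4_eq_xxxx)
    also have "\<dots> \<le> x\<^sup>2 * 1" using x by (intro mult_left_mono) (auto simp: abs_square_le_1)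
    finally show ?thesis by (simp add: fact_numeral)
  qed
  finally show ?thesis using zero_le_power2[of x] by linarith
qed

text \<open>Vanishing sine means make every characteristic function real, and independence
  multiplies them.\<close>

lemma (in prob_space) expectation_cos_sum:
  fixes X :: "'i \<Rightarrow> 'a \<Rightarrow> real"
  assumes F: "finite F" and ind: "indep_vars (\<lambda>_. borel) X F"
    and sin: "\<And>s. s \<in> F \<Longrightarrow> expectation (\<lambda>\<omega>. sin (X s \<omega>)) = 0"
  shows "expectation (\<lambda>\<omega>. cos (\<Sum>s\<in>F. X s \<omega>)) = (\<Prod>s\<in>F. expectation (\<lambda>\<omega>. cos (X s \<omega>)))"
proof -
  have [measurable]: "X s \<in> borel_measurable M" if "s \<in> F" for s
    using ind that unfolding indep_vars_def2 by auto
  have ci: "complex_integrable M (\<lambda>\<omega>. iexp (g \<omega>))" if [measurable]: "g \<in> borel_measurable M" for g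
    by (rule integrable_const_bound[where B = 1]) auto
  have ind': "indep_vars (\<lambda>_. borel) (\<lambda>s \<omega>. iexp (X s \<omega>)) F"
    by (rule indep_vars_compose2[OF ind]) measurable
  have one: "(CLINT \<omega>|M. iexp (X s \<omega>)) = of_real (expectation (\<lambda>\<omega>. cos (X s \<omega>)))" if s: "s \<in> F" for s
  proof (rule complex_eqI)
    show "Re (CLINT \<omega>|M. iexp (X s \<omega>)) = Re (of_real (expectation (\<lambda>\<omega>. cos (X s \<omega>))))"
      using ci[of "X s"] s by (subst integral_Re[symmetric]) (auto simp: Re_exp)
    show "Im (CLINT \<omega>|M. iexp (X s \<omega>)) = Im (of_real (expectation (\<lambda>\<omega>. cos (X s \<omega>))))"
      using ci[of "X s"] s sin[OF s] by (subst integral_Im[symmetric]) (auto simp: Im_exp)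
  qed
  have sm: "(\<lambda>\<omega>. \<Sum>s\<in>F. X s \<omega>) \<in> borel_measurable M" by measurable
  have "expectation (\<lambda>\<omega>. cos (\<Sum>s\<in>F. X s \<omega>)) = Re (CLINT \<omega>|M. iexp (\<Sum>s\<in>F. X s \<omega>))"
    using ci[OF sm] by (subst integral_Re[symmetric]) (auto simp: Re_exp)
  also have "(\<lambda>\<omega>. iexp (\<Sum>s\<in>F. X s \<omega>)) = (\<lambda>\<omega>. \<Prod>s\<in>F. iexp (X s \<omega>))"
    using F by (simp add: exp_sum sum_distrib_left)
  also have "(CLINT \<omega>|M. (\<Prod>s\<in>F. iexp (X s \<omega>))) = (\<Prod>s\<in>F. CLINT \<omega>|M. iexp (X s \<omega>))"
    by (rule indep_vars_lebesgue_integral[OF F ind']) (auto intro: ci)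
  also have "\<dots> = (\<Prod>s\<in>F. of_real (expectation (\<lambda>\<omega>. cos (X s \<omega>))))"
    by (intro prod.cong one refl)
  finally show ?thesis by (simp flip: of_real_prod)
qed

text \<open>Each factor E cos X is at most 1 - d/4, hence at most exp(-d/4), so 1/2 is at most
  exp(-D/4) for the sum D of second moments. As e is at least 2, D cannot exceed 4.\<close>

lemma (in prob_space) sum_second_moments_le:
  fixes X :: "'i \<Rightarrow> 'a \<Rightarrow> real"
  assumes F: "finite F" and ind: "indep_vars (\<lambda>_. borel) X F"
    and sin: "\<And>s. s \<in> F \<Longrightarrow> expectation (\<lambda>\<omega>. sin (X s \<omega>)) = 0"
    and bd: "\<And>s \<omega>. s \<in> F \<Longrightarrow> \<omega> \<in> space M \<Longrightarrow> \<bar>X s \<omega>\<bar> \<le> 1"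
    and half: "1 / 2 \<le> expectation (\<lambda>\<omega>. cos (\<Sum>s\<in>F. X s \<omega>))"
  shows "(\<Sum>s\<in>F. expectation (\<lambda>\<omega>. (X s \<omega>)\<^sup>2)) \<le> 4"
proof -
  have [measurable]: "X s \<in> borel_measurable M" if "s \<in> F" for s
    using ind that unfolding indep_vars_def2 by auto
  define d where "d s = expectation (\<lambda>\<omega>. (X s \<omega>)\<^sup>2)" for s
  have cosd: "0 \<le> expectation (\<lambda>\<omega>. cos (X s \<omega>)) \<and> expectation (\<lambda>\<omega>. cos (X s \<omega>)) \<le> 1 - d s / 4" if s: "s \<in> F" for s
  proof
    have sq: "integrable M (\<lambda>\<omega>. (X s \<omega>)\<^sup>2)"
      by (rule integrable_const_bound[where B = 1]) (use s bd[OF s] in \<open>auto simp: abs_square_le_1\<close>)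
    show "0 \<le> expectation (\<lambda>\<omega>. cos (X s \<omega>))"
    proof (rule Bochner_Integration.integral_nonneg_AE, rule AE_I2)
      fix \<omega> assume "\<omega> \<in> space M"
      then have "\<bar>X s \<omega>\<bar> \<le> 1" by (rule bd[OF s])
      then show "0 \<le> cos (X s \<omega>)" using pi_gt3 by (intro cos_ge_zero) auto
    qed
    have "expectation (\<lambda>\<omega>. cos (X s \<omega>)) \<le> expectation (\<lambda>\<omega>. 1 - (X s \<omega>)\<^sup>2 / 4)"
    proof (rule integral_mono)
      show "integrable M (\<lambda>\<omega>. cos (X s \<omega>))"
        by (rule integrable_const_bound[where B = 1]) (use s in auto)
      show "integrable M (\<lambda>\<omega>. 1 - (X s \<omega>)\<^sup>2 / 4)" using sq by simp
    qed (use cos_le_quadratic bd[OF s] in blast)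
    also have "\<dots> = 1 - d s / 4" using sq by (simp add: d_def prob_space)
    finally show "expectation (\<lambda>\<omega>. cos (X s \<omega>)) \<le> 1 - d s / 4" .
  qed
  have "1 / 2 \<le> (\<Prod>s\<in>F. expectation (\<lambda>\<omega>. cos (X s \<omega>)))"
    using half expectation_cos_sum[OF F ind sin] by simp
  also have "\<dots> \<le> (\<Prod>s\<in>F. exp (- (d s / 4)))"
  proof (rule prod_mono)
    fix s assume "s \<in> F"
    from cosd[OF this] show "0 \<le> expectation (\<lambda>\<omega>. cos (X s \<omega>)) \<and> expectation (\<lambda>\<omega>. cos (X s \<omega>)) \<le> exp (- (d s / 4))"
      using exp_ge_add_one_self[of "- (d s / 4)"] by linarith
  qed
  also have "\<dots> = exp (- ((\<Sum>s\<in>F. d s) / 4))"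
    using F by (simp add: exp_sum[symmetric] sum_negf sum_divide_distrib)
  finally have le: "1 / 2 \<le> exp (- ((\<Sum>s\<in>F. d s) / 4))" .
  have "(\<Sum>s\<in>F. d s) / 4 \<le> 1"
  proof (rule ccontr)
    assume "\<not> ?thesis"
    then have "exp 1 < exp ((\<Sum>s\<in>F. d s) / 4)" by simp
    moreover have "2 \<le> exp (1 :: real)" using exp_ge_add_one_self[of 1] by simp
    ultimately have "2 < exp ((\<Sum>s\<in>F. d s) / 4)" by linarith
    then have "exp (- ((\<Sum>s\<in>F. d s) / 4)) < 1 / 2" unfolding exp_minus by (simp add: field_simps)
    then show False using le by simp
  qed
  then show ?thesis unfolding d_def by simp
qed

text \<open>Tightness of one variable, from \<open>X / (n + 1)\<close> tending to 0 in
  probability.\<close>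

lemma (in prob_space) norm_le_high_prob:
  fixes X :: "'a \<Rightarrow> complex"
  assumes [measurable]: "X \<in> borel_measurable M" and e: "\<epsilon> > 0"
  shows "\<exists>b>0. \<P>(\<omega> in M. b < norm (X \<omega>)) \<le> \<epsilon>"
proof -
  define X' where "X' n \<omega> = X \<omega> / of_nat (Suc n)" for n \<omega>
  have [measurable]: "X' n \<in> borel_measurable M" for n unfolding X'_def by measurable
  have "(\<lambda>n. X' n \<omega>) \<longlonglongrightarrow> 0" for \<omega>
    unfolding X'_def using LIMSEQ_Suc[OF lim_const_over_n[of "X \<omega>"]] .
  then obtain n where n: "\<P>(\<omega> in M. \<epsilon> < norm (0 - X' n \<omega>)) < \<epsilon>"
    using AE_tendsto_imp_prob_less[of X' "\<lambda>_. 0" \<epsilon>] e by auto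
  moreover have "\<epsilon> < norm (0 - X' n \<omega>) \<longleftrightarrow> \<epsilon> * real (Suc n) < norm (X \<omega>)" for \<omega>
    by (simp add: X'_def norm_divide pos_less_divide_eq del: of_nat_Suc)
  ultimately show ?thesis using e by (intro exI[of _ "\<epsilon> * real (Suc n)"]) auto
qed

context iid_symmetric begin

lemma same_law_integral:
  fixes g :: "complex \<Rightarrow> real"
  assumes g: "g \<in> borel_measurable borel"
  shows "expectation (\<lambda>\<omega>. g (Z s \<omega>)) = expectation (\<lambda>\<omega>. g (Z 0 \<omega>))"
proof -
  have "expectation (\<lambda>\<omega>. g (Z s \<omega>)) = integral\<^sup>L (distr M borel (Z s)) g"
    using g by (subst integral_distr) auto
  also have "distr M borel (Z s) = distr M borel (Z 0)" by (rule ident)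
  also have "integral\<^sup>L (distr M borel (Z 0)) g = expectation (\<lambda>\<omega>. g (Z 0 \<omega>))"
    using g by (subst integral_distr) auto
  finally show ?thesis .
qed

lemma odd_expectation_zero:
  fixes g :: "complex \<Rightarrow> real"
  assumes g: "g \<in> borel_measurable borel" and odd: "\<And>z. g (- z) = - g z"
  shows "expectation (\<lambda>\<omega>. g (Z s \<omega>)) = 0"
proof -
  have "expectation (\<lambda>\<omega>. g (Z 0 \<omega>)) = integral\<^sup>L (distr M borel (Z 0)) g"
    using g by (subst integral_distr) auto
  also have "distr M borel (Z 0) = distr M borel (\<lambda>\<omega>. - Z 0 \<omega>)" by (rule symm)
  also have "integral\<^sup>L (distr M borel (\<lambda>\<omega>. - Z 0 \<omega>)) g = expectation (\<lambda>\<omega>. g (- Z 0 \<omega>))"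
    using g by (subst integral_distr) auto
  also have "\<dots> = - expectation (\<lambda>\<omega>. g (Z 0 \<omega>))" by (simp add: odd)
  finally show ?thesis unfolding same_law_integral[OF g, of s] by simp
qed

lemma prob_same_law:
  assumes A: "A \<in> sets borel"
  shows "\<P>(\<omega> in M. Z s \<omega> \<in> A) = \<P>(\<omega> in M. Z 0 \<omega> \<in> A)"
proof -
  have "measure (distr M borel (Z s)) A = measure (distr M borel (Z 0)) A"
    unfolding ident[of s] ..
  then show ?thesis using A
    by (subst (asm) (1 2) measure_distr) (auto simp: vimage_def Int_def conj_commute)
qed

text \<open>Tightness survives truncation by \<open>contraction\<close>, and truncated noise has a
  finite positive second moment \<open>v\<close>. At the small frequency \<open>\<eta>\<close> the
  characteristic functions of the real and imaginary parts stay above 1/2, so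
  \<open>sum_second_moments_le\<close> bounds both variances by 4, whence 8 in total.\<close>

lemma square_summable_of_tight:
  assumes nz: "\<not> (AE \<omega> in M. Z 0 \<omega> = 0)"
    and tight: "\<And>\<epsilon>. \<epsilon> > 0 \<Longrightarrow> \<exists>b>0. \<forall>F. finite F \<longrightarrow> \<P>(\<omega> in M. b < norm (\<Sum>s\<in>F. a s * Z s \<omega>)) \<le> \<epsilon>"
  shows "\<exists>A. \<forall>F. finite F \<longrightarrow> (\<Sum>s\<in>F. (norm (a s))\<^sup>2) \<le> A"
proof -
  \<comment> \<open>One number \<open>C = Suc n\<close> does two jobs: the shell between
    \<open>1 / C\<close> and \<open>C\<close> has positive probability, and \<open>C\<close> is the
    truncation level, so the second moment stays positive.\<close>
  have "\<exists>n. \<P>(\<omega> in M. Z 0 \<omega> \<in> {z. 1 / real (Suc n) < norm z \<and> norm z < real (Suc n)}) > 0"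
  proof (rule ccontr)
    assume neg: "\<not> ?thesis"
    have "AE \<omega> in M. \<not> (1 / real (Suc n) < norm (Z 0 \<omega>) \<and> norm (Z 0 \<omega>) < real (Suc n))" for n
    proof (rule AE_I')
      have "\<P>(\<omega> in M. Z 0 \<omega> \<in> {z. 1 / real (Suc n) < norm z \<and> norm z < real (Suc n)}) = 0"
        using neg measure_nonneg by (meson linorder_not_less order_antisym)
      then show "{\<omega> \<in> space M. 1 / real (Suc n) < norm (Z 0 \<omega>) \<and> norm (Z 0 \<omega>) < real (Suc n)} \<in> null_sets M"
        by (simp add: null_setsI emeasure_eq_measure)
    qed auto
    then have "AE \<omega> in M. \<forall>n. \<not> (1 / real (Suc n) < norm (Z 0 \<omega>) \<and> norm (Z 0 \<omega>) < real (Suc n))"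
      by (simp add: AE_all_countable)
    then have "AE \<omega> in M. Z 0 \<omega> = 0"
    proof eventually_elim
      case (elim \<omega>)
      show ?case
      proof (rule ccontr)
        assume "Z 0 \<omega> \<noteq> 0"
        then obtain n where n: "inverse (real (Suc n)) < norm (Z 0 \<omega>)" using reals_Archimedean[of "norm (Z 0 \<omega>)"] by auto
        obtain m where m: "norm (Z 0 \<omega>) < real m" using reals_Archimedean2 by blast
        have "1 / real (Suc (n + m)) \<le> 1 / real (Suc n)" by (intro divide_left_mono) auto
        then have "1 / real (Suc (n + m)) < norm (Z 0 \<omega>)" using n by (simp add: inverse_eq_divide)
        moreover have "norm (Z 0 \<omega>) < real (Suc (n + m))" using m by simp
        ultimately show False using elim by blast
      qed
    qed
    then show False using nz by blast
  qed
  then obtain n where n: "\<P>(\<omega> in M. Z 0 \<omega> \<in> {z. 1 / real (Suc n) < norm z \<and> norm z < real (Suc n)}) > 0" ..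
  define C where "C = real (Suc n)"
  define q where "q = \<P>(\<omega> in M. Z 0 \<omega> \<in> {z. 1 / C < norm z \<and> norm z < C})"
  have C: "C > 0" by (simp add: C_def)
  have q: "q > 0" using n by (simp add: q_def C_def)
  define T where "T z = (if norm z < C then z else 0)" for z :: complex
  have Tm[measurable]: "T \<in> borel_measurable borel" unfolding T_def by measurable
  have T_le: "norm (T z) \<le> C" for z using C by (simp add: T_def)
  define v where "v = expectation (\<lambda>\<omega>. (norm (T (Z 0 \<omega>)))\<^sup>2)"
  have T2i: "integrable M (\<lambda>\<omega>. (norm (T (Z s \<omega>)))\<^sup>2)" for s
    by (rule integrable_const_bound[where B = "C\<^sup>2"]) (use T_le in \<open>auto intro!: power_mono\<close>)
  have v: "v > 0"
  proof -
    have "(1 / C)\<^sup>2 * q = expectation (\<lambda>\<omega>. (1 / C)\<^sup>2 * indicator {\<omega> \<in> space M. Z 0 \<omega> \<in> {z. 1 / C < norm z \<and> norm z < C}} \<omega>)"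
      by (simp add: q_def)
    also have "\<dots> \<le> v" unfolding v_def
    proof (rule integral_mono[OF _ T2i])
      fix \<omega>
      show "(1 / C)\<^sup>2 * indicator {\<omega> \<in> space M. Z 0 \<omega> \<in> {z. 1 / C < norm z \<and> norm z < C}} \<omega> \<le> (norm (T (Z 0 \<omega>)))\<^sup>2"
        using C by (auto simp: indicator_def T_def power_divide[symmetric] intro!: power_mono)
    qed (simp add: emeasure_eq_measure)
    moreover have "(1 / C)\<^sup>2 * q > 0" using q C by simp
    ultimately show ?thesis by linarith
  qed
  \<comment> \<open>Tightness for singletons: if \<open>norm (a s)\<close> exceeded
    \<open>b * C\<close>, the shell event of probability \<open>q\<close> would push the single term
    above \<open>b\<close>, against the bound \<open>q / 2\<close>. Boundedness is what allows one
    frequency for all terms.\<close>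
  have "\<exists>B>0. \<forall>s. norm (a s) \<le> B"
  proof -
    obtain b where b: "b > 0" "\<And>F. finite F \<Longrightarrow> \<P>(\<omega> in M. b < norm (\<Sum>s\<in>F. a s * Z s \<omega>)) \<le> q / 2"
      using tight[of "q / 2"] q by auto
    have "norm (a s) \<le> b * C" for s
    proof (rule ccontr)
      assume neg: "\<not> norm (a s) \<le> b * C"
      have "q = \<P>(\<omega> in M. Z s \<omega> \<in> {z. 1 / C < norm z \<and> norm z < C})"
        unfolding q_def by (rule prob_same_law[symmetric]) measurable
      also have "\<dots> \<le> \<P>(\<omega> in M. b < norm (\<Sum>s\<in>{s}. a s * Z s \<omega>))"
      proof (rule finite_measure_mono)
        show "{\<omega> \<in> space M. Z s \<omega> \<in> {z. 1 / C < norm z \<and> norm z < C}} \<subseteq> {\<omega> \<in> space M. b < norm (\<Sum>s\<in>{s}. a s * Z s \<omega>)}"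
        proof safe
          fix \<omega> assume "1 / C < norm (Z s \<omega>)"
          have "b = b * C * (1 / C)" using C by simp
          also have "\<dots> < norm (a s) * norm (Z s \<omega>)"
            using neg \<open>1 / C < norm (Z s \<omega>)\<close> b(1) C by (intro mult_strict_mono) auto
          finally show "b < norm (\<Sum>s\<in>{s}. a s * Z s \<omega>)" by (simp add: norm_mult)
        qed
      qed measurable
      also have "\<dots> \<le> q / 2" by (rule b(2)) simp
      finally show False using q by simp
    qed
    then show ?thesis using b(1) C by (intro exI[of _ "b * C"]) auto
  qed
  then obtain B where B: "B > 0" "\<And>s. norm (a s) \<le> B" by blast
  obtain b where b: "b > 0" "\<And>F. finite F \<Longrightarrow> \<P>(\<omega> in M. b < norm (\<Sum>s\<in>F. a s * Z s \<omega>)) \<le> 1 / 16"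
    using tight[of "1 / 16"] by auto
  have tightT: "\<P>(\<omega> in M. b < norm (\<Sum>s\<in>F. a s * T (Z s \<omega>))) \<le> 1 / 8" if F: "finite F" for F
  proof -
    have "(z + (if norm z < C then z else - z)) / 2 = T z" for z :: complex by (simp add: T_def)
    then have "\<P>(\<omega> in M. b < norm (\<Sum>s\<in>F. a s * T (Z s \<omega>))) \<le> 2 * \<P>(\<omega> in M. b < norm (\<Sum>s\<in>F. a s * Z s \<omega>))"
      using contraction[where \<tau> = "\<lambda>_ z. if norm z < C then z else - z" and c = b and F = F and a = a and h = "\<lambda>s. s"]
        law_preserving_truncation by simp
    then show ?thesis using b(2)[OF F] by simp
  qed
  \<comment> \<open>The first bound keeps each single term below 1, the range of the quadratic
    cosine estimate; the second keeps the total below 1/2 whenever the sum has norm at most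
    \<open>b\<close>.\<close>
  define \<eta> where "\<eta> = min (1 / (B * C)) (1 / (2 * b))"
  have \<eta>: "\<eta> > 0" "\<eta> * (B * C) \<le> 1" "\<eta> * b \<le> 1 / 2"
    unfolding \<eta>_def using B C b(1) by (auto simp: min_def field_simps)
  have bound: "\<bar>\<eta> * L (a s * T z)\<bar> \<le> 1" if L: "\<And>z. \<bar>L z\<bar> \<le> norm z" for L :: "complex \<Rightarrow> real" and s z
  proof -
    have "\<bar>L (a s * T z)\<bar> \<le> norm (a s) * norm (T z)" using L by (metis norm_mult)
    also have "\<dots> \<le> B * C" using B T_le by (intro mult_mono) auto
    finally have "\<eta> * \<bar>L (a s * T z)\<bar> \<le> \<eta> * (B * C)" using \<eta>(1) by (intro mult_left_mono) auto
    from order_trans[OF this \<eta>(2)] show ?thesis using \<eta>(1) by (simp add: abs_mult)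
  qed
  have part: "(\<Sum>s\<in>F. expectation (\<lambda>\<omega>. (\<eta> * L (a s * T (Z s \<omega>)))\<^sup>2)) \<le> 4"
    if F: "finite F" and L: "bounded_linear L" "\<And>z. \<bar>L z\<bar> \<le> norm z" for F and L :: "complex \<Rightarrow> real"
  proof (rule sum_second_moments_le[OF F])
    note lin = bounded_linear.linear[OF L(1)]
    have Lm[measurable]: "L \<in> borel_measurable borel"
      by (intro borel_measurable_continuous_onI linear_continuous_on L)
    have g: "(\<lambda>z. \<eta> * L (a s * T z)) \<in> borel_measurable borel" for s by measurable
    show "indep_vars (\<lambda>_. borel) (\<lambda>s \<omega>. \<eta> * L (a s * T (Z s \<omega>))) F"
      by (rule indep_vars_compose2[OF indep_vars_subset[OF indep] g]) simp
    show "expectation (\<lambda>\<omega>. sin (\<eta> * L (a s * T (Z s \<omega>)))) = 0" for s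
    proof (rule odd_expectation_zero)
      show "(\<lambda>z. sin (\<eta> * L (a s * T z))) \<in> borel_measurable borel" by measurable
      show "sin (\<eta> * L (a s * T (- z))) = - sin (\<eta> * L (a s * T z))" for z
        by (simp add: T_def linear_neg[OF lin] linear_0[OF lin])
    qed
    show "\<bar>\<eta> * L (a s * T (Z s \<omega>))\<bar> \<le> 1" for s \<omega> by (rule bound[OF L(2)])
    let ?D = "\<lambda>\<omega>. \<Sum>s\<in>F. a s * T (Z s \<omega>)"
    have sum: "(\<Sum>s\<in>F. \<eta> * L (a s * T (Z s \<omega>))) = \<eta> * L (?D \<omega>)" for \<omega>
      by (simp add: linear_sum[OF lin] sum_distrib_left)
    \<comment> \<open>On the good event cos is at least 1 - (1/2)^2/2 = 7/8; elsewhere -1 exceeds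
      7/8 - 2. The bad event has probability at most 1/8, twice the 1/16 above, which leaves
      5/8.\<close>
    have "7 / 8 - 2 * \<P>(\<omega> in M. b < norm (?D \<omega>)) =
      expectation (\<lambda>\<omega>. 7 / 8 - 2 * indicator {\<omega> \<in> space M. b < norm (?D \<omega>)} \<omega>)"
      by (subst Bochner_Integration.integral_diff) (auto simp: prob_space emeasure_eq_measure)
    also have "\<dots> \<le> expectation (\<lambda>\<omega>. cos (\<eta> * L (?D \<omega>)))"
    proof (rule integral_mono)
      show "integrable M (\<lambda>\<omega>. 7 / 8 - 2 * indicator {\<omega> \<in> space M. b < norm (?D \<omega>)} \<omega> :: real)"
        by (auto simp: emeasure_eq_measure)
      show "integrable M (\<lambda>\<omega>. cos (\<eta> * L (?D \<omega>)))"
        by (rule integrable_const_bound[where B = 1]) auto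
      fix \<omega> assume \<omega>: "\<omega> \<in> space M"
      show "7 / 8 - 2 * indicator {\<omega> \<in> space M. b < norm (?D \<omega>)} \<omega> \<le> cos (\<eta> * L (?D \<omega>))"
      proof (cases "b < norm (?D \<omega>)")
        case True
        then have "indicator {\<omega> \<in> space M. b < norm (?D \<omega>)} \<omega> = (1 :: real)" using \<omega> by simp
        then show ?thesis using cos_ge_minus_one[of "\<eta> * L (?D \<omega>)"] by linarith
      next
        case False
        have "\<bar>\<eta> * L (?D \<omega>)\<bar> \<le> \<eta> * norm (?D \<omega>)"
          unfolding abs_mult using \<eta>(1) L(2) by (intro mult_mono) auto
        also have "\<dots> \<le> \<eta> * b" using False \<eta>(1) by (intro mult_left_mono) auto
        finally have h: "\<bar>\<eta> * L (?D \<omega>)\<bar> \<le> 1 / 2" using \<eta>(3) by linarith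
        have "(\<eta> * L (?D \<omega>))\<^sup>2 \<le> (1 / 2)\<^sup>2" using h power_mono[OF h, of 2] by simp
        moreover have "1 - (\<eta> * L (?D \<omega>))\<^sup>2 / 2 \<le> cos (\<eta> * L (?D \<omega>))"
        proof -
          have "\<bar>sin (\<eta> * L (?D \<omega>) / 2)\<bar> \<le> \<bar>\<eta> * L (?D \<omega>) / 2\<bar>" by (rule abs_sin_x_le_abs_x)
          then have "(sin (\<eta> * L (?D \<omega>) / 2))\<^sup>2 \<le> (\<eta> * L (?D \<omega>) / 2)\<^sup>2" by (simp only: abs_le_square_iff)
          moreover have "cos (\<eta> * L (?D \<omega>)) = 1 - 2 * (sin (\<eta> * L (?D \<omega>) / 2))\<^sup>2"
            using cos_double_sin[of "\<eta> * L (?D \<omega>) / 2"] by simp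
          ultimately show ?thesis by (simp add: power_divide)
        qed
        ultimately show ?thesis using False by (simp add: power2_eq_square)
      qed
    qed
    finally show "1 / 2 \<le> expectation (\<lambda>\<omega>. cos (\<Sum>s\<in>F. \<eta> * L (a s * T (Z s \<omega>))))"
      unfolding sum using tightT[OF F] by linarith
  qed
  have "(\<Sum>s\<in>F. (norm (a s))\<^sup>2) \<le> 8 / (\<eta>\<^sup>2 * v)" if F: "finite F" for F
  proof -
    have int: "integrable M (\<lambda>\<omega>. (\<eta> * L (a s * T (Z s \<omega>)))\<^sup>2)"
      if [measurable]: "L \<in> borel_measurable borel" and L: "\<And>z. \<bar>L z\<bar> \<le> norm z" for s and L :: "complex \<Rightarrow> real"
    proof (rule integrable_const_bound[where B = 1])
      have "(\<eta> * L (a s * T (Z s \<omega>)))\<^sup>2 \<le> 1" for \<omega>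
        using bound[of L s "Z s \<omega>", OF L] by (simp add: abs_square_le_1)
      then show "AE \<omega> in M. norm ((\<eta> * L (a s * T (Z s \<omega>)))\<^sup>2) \<le> 1" by simp
    qed measurable
    have eq: "(\<eta>\<^sup>2 * v) * (norm (a s))\<^sup>2 =
       expectation (\<lambda>\<omega>. (\<eta> * Re (a s * T (Z s \<omega>)))\<^sup>2) + expectation (\<lambda>\<omega>. (\<eta> * Im (a s * T (Z s \<omega>)))\<^sup>2)" for s
    proof -
      have "expectation (\<lambda>\<omega>. (\<eta> * Re (a s * T (Z s \<omega>)))\<^sup>2) + expectation (\<lambda>\<omega>. (\<eta> * Im (a s * T (Z s \<omega>)))\<^sup>2)
        = expectation (\<lambda>\<omega>. (\<eta> * Re (a s * T (Z s \<omega>)))\<^sup>2 + (\<eta> * Im (a s * T (Z s \<omega>)))\<^sup>2)"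
        by (rule Bochner_Integration.integral_add[symmetric]) (rule int; auto simp: abs_Re_le_cmod abs_Im_le_cmod)+
      also have "(\<lambda>\<omega>. (\<eta> * Re (a s * T (Z s \<omega>)))\<^sup>2 + (\<eta> * Im (a s * T (Z s \<omega>)))\<^sup>2) =
         (\<lambda>\<omega>. (\<eta>\<^sup>2 * (norm (a s))\<^sup>2) * (norm (T (Z s \<omega>)))\<^sup>2)"
      proof
        fix \<omega>
        have "(\<eta> * Re (a s * T (Z s \<omega>)))\<^sup>2 + (\<eta> * Im (a s * T (Z s \<omega>)))\<^sup>2 = \<eta>\<^sup>2 * (norm (a s * T (Z s \<omega>)))\<^sup>2"
          unfolding cmod_power2 power_mult_distrib distrib_left ..
        then show "(\<eta> * Re (a s * T (Z s \<omega>)))\<^sup>2 + (\<eta> * Im (a s * T (Z s \<omega>)))\<^sup>2 =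
           (\<eta>\<^sup>2 * (norm (a s))\<^sup>2) * (norm (T (Z s \<omega>)))\<^sup>2"
          by (simp add: norm_mult power_mult_distrib)
      qed
      also have "expectation \<dots> = (\<eta>\<^sup>2 * (norm (a s))\<^sup>2) * v"
      proof -
        have "expectation (\<lambda>\<omega>. (norm (T (Z s \<omega>)))\<^sup>2) = v"
          unfolding v_def by (rule same_law_integral) measurable
        then show ?thesis by simp
      qed
      finally show ?thesis by (simp add: mult_ac)
    qed
    have "(\<eta>\<^sup>2 * v) * (\<Sum>s\<in>F. (norm (a s))\<^sup>2) \<le> 8"
      unfolding sum_distrib_left eq sum.distrib
      using part[OF F bounded_linear_Re abs_Re_le_cmod] part[OF F bounded_linear_Im abs_Im_le_cmod] by simp
    moreover have "\<eta>\<^sup>2 * v > 0" using \<eta> v by simp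
    ultimately show ?thesis by (simp add: pos_le_divide_eq mult.commute)
  qed
  then show ?thesis by blast
qed

text \<open>Convergence controls large boxes only, while the tightness criterion needs all finite
  index sets. \<open>a\<close> carries \<open>\<alpha>\<close> to the indices
  \<open>t - int_vec k\<close> and vanishes elsewhere.\<close>

lemma square_summable_coefficients:
  assumes nz: "\<not> (AE \<omega> in M. Z 0 \<omega> = 0)"
    and conv: "\<And>\<epsilon>. \<epsilon> > 0 \<Longrightarrow> \<exists>n. \<forall>N\<ge>n. \<P>(\<omega> in M. \<epsilon> < norm (psum \<alpha> t N (noise \<omega>) - psum \<alpha> t n (noise \<omega>))) \<le> \<epsilon>"
  shows "\<exists>A. \<forall>F. finite F \<longrightarrow> (\<Sum>k\<in>F. (norm (\<alpha> k))\<^sup>2) \<le> A"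
proof -
  define h where "h k = t - int_vec k" for k :: "nat ^ 'd"
  have inj: "inj h" using inj_int_vec unfolding h_def inj_def by auto
  define a where "a s = (if s \<in> range h then \<alpha> (inv h s) else 0)" for s
  have ah: "a (h k) = \<alpha> k" for k by (simp add: a_def inv_f_f[OF inj])
  have "\<exists>A. \<forall>F. finite F \<longrightarrow> (\<Sum>s\<in>F. (norm (a s))\<^sup>2) \<le> A"
  proof (rule square_summable_of_tight[OF nz])
    fix \<epsilon> :: real assume "\<epsilon> > 0"
    then have e: "\<epsilon> / 4 > 0" by simp
    obtain n where n: "\<And>N. N \<ge> n \<Longrightarrow> \<P>(\<omega> in M. \<epsilon> / 4 < norm (psum \<alpha> t N (noise \<omega>) - psum \<alpha> t n (noise \<omega>))) \<le> \<epsilon> / 4"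
      using conv[OF e] by blast
    obtain b where b: "b > 0" "\<P>(\<omega> in M. b < norm (psum \<alpha> t n (noise \<omega>))) \<le> \<epsilon> / 4"
      using norm_le_high_prob[OF psum_Z_measurable e] by blast
    have big: "\<P>(\<omega> in M. \<epsilon> / 4 + b < norm (psum \<alpha> t N (noise \<omega>))) \<le> \<epsilon> / 2" if N: "n \<le> N" for N
    proof -
      have "\<P>(\<omega> in M. \<epsilon> / 4 + b < norm (psum \<alpha> t N (noise \<omega>))) \<le>
        \<P>(\<omega> in M. \<epsilon> / 4 < norm (psum \<alpha> t N (noise \<omega>) - psum \<alpha> t n (noise \<omega>))) +
        \<P>(\<omega> in M. b < norm (psum \<alpha> t n (noise \<omega>)))"
      proof (rule prob_triangle)
        show "norm (psum \<alpha> t N (noise \<omega>)) \<le>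
          norm (psum \<alpha> t N (noise \<omega>) - psum \<alpha> t n (noise \<omega>)) + norm (psum \<alpha> t n (noise \<omega>))" for \<omega>
          using norm_triangle_sub[of "psum \<alpha> t N (noise \<omega>)" "psum \<alpha> t n (noise \<omega>)"] by simp
      qed measurable
      then show ?thesis using n[OF N] b(2) by linarith
    qed
    have "\<P>(\<omega> in M. \<epsilon> / 4 + b < norm (\<Sum>s\<in>F. a s * Z s \<omega>)) \<le> \<epsilon>" if F: "finite F" for F
    proof -
      define G where "G = {k. h k \<in> F}"
      have G: "finite G" unfolding G_def using finite_vimageI[OF F inj] by (simp add: vimage_def)
      define N where "N = n + (\<chi> i. \<Sum>k\<in>G. k $ i)"
      have N: "n \<le> N" by (simp add: N_def less_eq_vec_def)
      have GN: "k \<le> N" if "k \<in> G" for k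
      proof -
        have "k $ i \<le> (\<Sum>k\<in>G. k $ i)" for i using that G by (intro member_le_sum) auto
        then show ?thesis by (simp add: N_def less_eq_vec_def trans_le_add2)
      qed
      \<comment> \<open>Reflecting the noise outside \<open>F\<close> deletes those terms from the
        average, so a box above \<open>n\<close> that covers \<open>G\<close> reduces to the sum
        over \<open>F\<close>. The factor 2 turns \<open>\<epsilon> / 2\<close> into
        \<open>\<epsilon>\<close>.\<close>
      define \<tau> where "\<tau> s = (if s \<notin> F then uminus else (\<lambda>z :: complex. z))" for s
      have "(\<Sum>s\<in>F. a s * Z s \<omega>) = (\<Sum>k | k \<le> N. \<alpha> k * ((Z (h k) \<omega> + \<tau> (h k) (Z (h k) \<omega>)) / 2))" for \<omega>
      proof -
        have "(\<Sum>k | k \<le> N. \<alpha> k * ((Z (h k) \<omega> + \<tau> (h k) (Z (h k) \<omega>)) / 2)) = (\<Sum>k\<in>G. \<alpha> k * Z (h k) \<omega>)"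
          by (rule sum.mono_neutral_cong_right) (auto simp: G_def \<tau>_def finite_atMost_nat_vec GN[unfolded G_def])
        also have "\<dots> = (\<Sum>s\<in>h ` G. a s * Z s \<omega>)"
          by (subst sum.reindex) (use inj in \<open>auto simp: ah inj_on_def\<close>)
        also have "\<dots> = (\<Sum>s\<in>F. a s * Z s \<omega>)"
          by (rule sum.mono_neutral_left) (use F in \<open>auto simp: G_def a_def\<close>)
        finally show ?thesis ..
      qed
      then have "\<P>(\<omega> in M. \<epsilon> / 4 + b < norm (\<Sum>s\<in>F. a s * Z s \<omega>)) =
        \<P>(\<omega> in M. \<epsilon> / 4 + b < norm (\<Sum>k | k \<le> N. \<alpha> k * ((Z (h k) \<omega> + \<tau> (h k) (Z (h k) \<omega>)) / 2)))" by simp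
      also have "\<dots> \<le> 2 * \<P>(\<omega> in M. \<epsilon> / 4 + b < norm (\<Sum>k | k \<le> N. \<alpha> k * Z (h k) \<omega>))"
        by (rule contraction) (simp add: \<tau>_def law_preserving_if)
      also have "\<dots> \<le> \<epsilon>" using big[OF N] unfolding psum_def h_def by simp
      finally show ?thesis .
    qed
    then show "\<exists>b>0. \<forall>F. finite F \<longrightarrow> \<P>(\<omega> in M. b < norm (\<Sum>s\<in>F. a s * Z s \<omega>)) \<le> \<epsilon>"
      using b(1) e by (intro exI[of _ "\<epsilon> / 4 + b"]) auto
  qed
  then obtain A where A: "\<And>F. finite F \<Longrightarrow> (\<Sum>s\<in>F. (norm (a s))\<^sup>2) \<le> A" by blast
  have "(\<Sum>k\<in>F. (norm (\<alpha> k))\<^sup>2) \<le> A" if "finite F" for F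
  proof -
    have "(\<Sum>s\<in>h ` F. (norm (a s))\<^sup>2) = (\<Sum>k\<in>F. (norm (\<alpha> k))\<^sup>2)"
      by (subst sum.reindex) (use inj in \<open>auto simp: ah inj_on_def\<close>)
    then show ?thesis using A[of "h ` F"] that by simp
  qed
  then show ?thesis by blast
qed

end

section \<open>The moving average field and its uniqueness\<close>

text \<open>Two centring constants are close because some outcome is near both; they form a Cauchy
  sequence, and its limit is the almost sure value.\<close>

lemma (in prob_space) AE_constI:
  fixes D :: "'a \<Rightarrow> complex"
  assumes [measurable]: "D \<in> borel_measurable M"
    and conc: "\<And>\<epsilon>. \<epsilon> > 0 \<Longrightarrow> \<exists>c. \<P>(\<omega> in M. \<epsilon> < norm (D \<omega> - c)) < \<epsilon>"
  shows "\<exists>c. AE \<omega> in M. D \<omega> = c"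
proof -
  \<comment> \<open>The shift by 3 keeps any two failure probabilities below 2/3 in total.\<close>
  define e where "e m = 1 / real (m + 3)" for m :: nat
  have e: "e m > 0" "e m \<le> 1 / 3" for m by (auto simp: e_def field_simps)
  have "\<forall>m. \<exists>c. \<P>(\<omega> in M. e m < norm (D \<omega> - c)) < e m" using conc e(1) by blast
  then obtain c where c: "\<And>m. \<P>(\<omega> in M. e m < norm (D \<omega> - c m)) < e m" by metis
  have near: "norm (c m - c l) \<le> e m + e l" for m l
  proof -
    have "\<exists>\<omega>\<in>space M. \<not> e m < norm (D \<omega> - c m) \<and> \<not> e l < norm (D \<omega> - c l)"
    proof (rule prob_add_less_1_common)
      show "\<P>(\<omega> in M. e m < norm (D \<omega> - c m)) + \<P>(\<omega> in M. e l < norm (D \<omega> - c l)) < 1"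
        using c[of m] c[of l] e(2)[of m] e(2)[of l] by linarith
    qed measurable
    then obtain \<omega> where "norm (D \<omega> - c m) \<le> e m" "norm (D \<omega> - c l) \<le> e l" by (auto simp: not_less)
    then show ?thesis
      using norm_triangle_ineq4[of "D \<omega> - c l" "D \<omega> - c m"] by simp
  qed
  have e_lim: "e \<longlonglongrightarrow> 0"
    unfolding e_def using LIMSEQ_ignore_initial_segment[OF lim_const_over_n[of "1 :: real"], of 3] by simp
  have "Cauchy c"
  proof (rule metric_CauchyI)
    fix \<delta> :: real assume "\<delta> > 0"
    then have "\<forall>\<^sub>F m in sequentially. e m < \<delta> / 2" using e_lim by (intro order_tendstoD) auto
    then obtain K where K: "\<And>m. m \<ge> K \<Longrightarrow> e m < \<delta> / 2" unfolding eventually_sequentially by blast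
    show "\<exists>K. \<forall>m\<ge>K. \<forall>n\<ge>K. dist (c m) (c n) < \<delta>"
    proof (intro exI[of _ K] allI impI)
      fix m n assume "K \<le> m" "K \<le> n"
      then show "dist (c m) (c n) < \<delta>" using near[of m n] K[of m] K[of n] by (simp add: dist_norm)
    qed
  qed
  then obtain L where L: "c \<longlonglongrightarrow> L" using Cauchy_convergent convergentD by blast
  have cL: "norm (c m - L) \<le> e m" for m
  proof -
    have "(\<lambda>l. norm (c m - c l)) \<longlonglongrightarrow> norm (c m - L)" by (intro tendsto_intros L)
    moreover have "(\<lambda>l. e m + e l) \<longlonglongrightarrow> e m + 0" by (intro tendsto_intros e_lim)
    ultimately show ?thesis using LIMSEQ_le near by fastforce
  qed
  have "AE \<omega> in M. norm (D \<omega> - L) \<le> 1 / real (Suc j)" for j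
  proof -
    have "\<P>(\<omega> in M. 1 / real (Suc j) < norm (D \<omega> - L)) \<le> e m" if m: "2 * e m \<le> 1 / real (Suc j)" for m
    proof -
      have "\<P>(\<omega> in M. 1 / real (Suc j) < norm (D \<omega> - L)) \<le> \<P>(\<omega> in M. e m < norm (D \<omega> - c m))"
      proof (rule finite_measure_mono)
        show "{\<omega> \<in> space M. 1 / real (Suc j) < norm (D \<omega> - L)} \<subseteq> {\<omega> \<in> space M. e m < norm (D \<omega> - c m)}"
        proof safe
          fix \<omega> assume "1 / real (Suc j) < norm (D \<omega> - L)"
          moreover have "norm (D \<omega> - L) \<le> norm (D \<omega> - c m) + norm (c m - L)"
            using norm_triangle_ineq[of "D \<omega> - c m" "c m - L"] by simp
          ultimately show "e m < norm (D \<omega> - c m)" using cL[of m] m by linarith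
        qed
      qed measurable
      then show ?thesis using c[of m] by linarith
    qed
    moreover have "\<forall>\<^sub>F m in sequentially. 2 * e m \<le> 1 / real (Suc j)"
    proof -
      define r where "r = 1 / real (Suc j)"
      have "r > 0" by (simp add: r_def)
      then have "\<forall>\<^sub>F m in sequentially. e m < r / 2" using e_lim by (intro order_tendstoD) auto
      then show ?thesis unfolding r_def[symmetric] by eventually_elim linarith
    qed
    ultimately have "\<forall>\<^sub>F m in sequentially. \<P>(\<omega> in M. 1 / real (Suc j) < norm (D \<omega> - L)) \<le> e m"
      by (auto elim: eventually_mono)
    then have "\<P>(\<omega> in M. 1 / real (Suc j) < norm (D \<omega> - L)) \<le> 0"
      by (rule tendsto_lowerbound[OF e_lim]) simp
    then have "\<P>(\<omega> in M. 1 / real (Suc j) < norm (D \<omega> - L)) = 0"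
      using measure_nonneg[of M "{\<omega> \<in> space M. 1 / real (Suc j) < norm (D \<omega> - L)}"] by linarith
    then show ?thesis
      by (intro AE_I'[of "{\<omega> \<in> space M. 1 / real (Suc j) < norm (D \<omega> - L)}"])
         (auto simp: null_setsI emeasure_eq_measure not_le)
  qed
  then have "AE \<omega> in M. \<forall>j. norm (D \<omega> - L) \<le> 1 / real (Suc j)" by (simp add: AE_all_countable)
  then have "AE \<omega> in M. D \<omega> = L"
  proof eventually_elim
    case (elim \<omega>)
    show ?case
    proof (rule ccontr)
      assume "D \<omega> \<noteq> L"
      then obtain j where "inverse (real (Suc j)) < norm (D \<omega> - L)"
        using reals_Archimedean[of "norm (D \<omega> - L)"] by auto
      then show False using elim[rule_format, of j] by (simp add: inverse_eq_divide)
    qed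
  qed
  then show ?thesis ..
qed

text \<open>Iteration gives \<open>X\<close> and X + m d the same law for all m, and tightness then
  bounds m |d| independently of m.\<close>

lemma (in prob_space) shift_invariant_law:
  fixes X :: "'a \<Rightarrow> complex"
  assumes [measurable]: "X \<in> borel_measurable M" and law: "distr M borel (\<lambda>\<omega>. X \<omega> + d) = distr M borel X"
  shows "d = 0"
proof -
  have shift: "distr M borel (\<lambda>\<omega>. X \<omega> + of_nat m * d) = distr M borel X" for m
  proof (induction m)
    case (Suc m)
    have "distr M borel (\<lambda>\<omega>. X \<omega> + of_nat (Suc m) * d) = distr (distr M borel (\<lambda>\<omega>. X \<omega> + d)) borel (\<lambda>x. x + of_nat m * d)"
      by (subst distr_distr) (auto simp: comp_def algebra_simps)
    also have "\<dots> = distr (distr M borel X) borel (\<lambda>x. x + of_nat m * d)" unfolding law ..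
    also have "\<dots> = distr M borel (\<lambda>\<omega>. X \<omega> + of_nat m * d)"
      by (subst distr_distr) (auto simp: comp_def)
    finally show ?case using Suc by simp
  qed simp
  obtain b where b: "b > 0" "\<P>(\<omega> in M. b < norm (X \<omega>)) \<le> 1 / 4"
    using norm_le_high_prob[of X "1 / 4"] by auto
  have "real m * norm d \<le> 2 * b" for m
  proof -
    have "measure (distr M borel (\<lambda>\<omega>. X \<omega> + of_nat m * d)) {x. b < norm x} = measure (distr M borel X) {x. b < norm x}"
      unfolding shift ..
    moreover have "{x :: complex. b < norm x} \<in> sets borel" by measurable
    ultimately have eq: "\<P>(\<omega> in M. b < norm (X \<omega> + of_nat m * d)) = \<P>(\<omega> in M. b < norm (X \<omega>))"
      by (subst (asm) (1 2) measure_distr) (auto simp: vimage_def Int_def conj_commute)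
    have "\<exists>\<omega>\<in>space M. \<not> b < norm (X \<omega>) \<and> \<not> b < norm (X \<omega> + of_nat m * d)"
    proof (rule prob_add_less_1_common)
      show "\<P>(\<omega> in M. b < norm (X \<omega>)) + \<P>(\<omega> in M. b < norm (X \<omega> + of_nat m * d)) < 1"
        using eq b by simp
    qed measurable
    then obtain \<omega> where "norm (X \<omega>) \<le> b" "norm (X \<omega> + of_nat m * d) \<le> b" by (auto simp: not_less)
    then have "norm (of_nat m * d) \<le> 2 * b" using norm_triangle_ineq4[of "X \<omega> + of_nat m * d" "X \<omega>"] by simp
    then show ?thesis by (simp add: norm_mult)
  qed
  then have "norm d = 0" using reals_Archimedean3[of "norm d"] by (metis norm_ge_zero order_le_less not_less)
  then show ?thesis by simp
qed

context iid_symmetric begin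

context
  fixes \<alpha> :: "nat ^ 'd \<Rightarrow> complex" and Y :: "int ^ 'd \<Rightarrow> 'a \<Rightarrow> complex"
  assumes AE_conv: "\<And>t. AE_rect_convergent M (\<lambda>k \<omega>. \<alpha> k * Z (t - int_vec k) \<omega>)"
  defines "Y \<equiv> \<lambda>t \<omega>. rect_suminf (\<lambda>k. \<alpha> k * Z (t - int_vec k) \<omega>)"
begin

lemma AE_rect_sums: "AE \<omega> in M. rect_sums (\<lambda>k. \<alpha> k * Z (t - int_vec k) \<omega>) (Y t \<omega>)"
  using AE_conv[of t] unfolding AE_rect_convergent_def
  by eventually_elim (auto simp: Y_def dest: rect_suminf_eqI)

lemma rect_field_past: "Y t \<in> borel_measurable (past_sigma M Z t)"
  unfolding past_sigma_eq Y_def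
proof (intro borel_measurable_rect_suminf borel_measurable_times borel_measurable_const Z_Fsig_measurable)
  show "t - int_vec k \<in> {s. s \<le> t}" for k by (simp add: less_eq_vec_def)
qed

lemma rect_field_measurable [measurable]: "Y t \<in> borel_measurable M"
  using measurable_Fsig_M rect_field_past unfolding past_sigma_eq by blast

text \<open>The solution as a measurable functional of the noise path, so that invariance of the
  noise law transfers to it.\<close>

definition field_map :: "int ^ 'd \<Rightarrow> (int ^ 'd \<Rightarrow> complex) \<Rightarrow> complex" where
  "field_map t x = rect_suminf (\<lambda>k. \<alpha> k * x (t - int_vec k))"

lemma field_map_measurable [measurable]: "field_map t \<in> borel_measurable field_space"
  unfolding field_map_def[abs_def]
  by (intro borel_measurable_rect_suminf borel_measurable_times borel_measurable_const measurable_component_singleton) simp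

lemma rect_field_eq_map: "Y t \<omega> = field_map t (noise \<omega>)"
  by (simp add: Y_def field_map_def)

lemma rect_field_stationary: "strictly_stationary M Y"
  unfolding strictly_stationary_def
proof (intro conjI allI)
  fix h :: "int ^ 'd"
  have Gm: "(\<lambda>x t. field_map t x) \<in> measurable field_space field_space"
    by (rule measurable_PiM_single') auto
  have sm: "(\<lambda>\<omega> s. Z (s + h) \<omega>) \<in> measurable M field_space"
    by (rule measurable_PiM_single') auto
  have "field_map t (\<lambda>s. Z (s + h) \<omega>) = Y (t + h) \<omega>" for t \<omega>
    by (simp add: field_map_def Y_def algebra_simps)
  then have "distr M field_space (\<lambda>\<omega> t. Y (t + h) \<omega>) = distr (distr M field_space (\<lambda>\<omega> s. Z (s + h) \<omega>)) field_space (\<lambda>x t. field_map t x)"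
    by (subst distr_distr) (auto simp: comp_def Gm sm)
  also have "distr M field_space (\<lambda>\<omega> s. Z (s + h) \<omega>) = distr M field_space (\<lambda>\<omega> s. Z s \<omega>)"
    using field_law[of "\<lambda>_ z. z" "\<lambda>s. s + h"] law_preserving_id by (simp add: inj_def)
  also have "distr (distr M field_space (\<lambda>\<omega> s. Z s \<omega>)) field_space (\<lambda>x t. field_map t x) = distr M field_space (\<lambda>\<omega> t. Y t \<omega>)"
    by (subst distr_distr) (auto simp: comp_def Gm rect_field_eq_map)
  finally show "distr M field_space (\<lambda>\<omega> t. Y (t + h) \<omega>) = distr M field_space (\<lambda>\<omega> t. Y t \<omega>)" .
qed simp

text \<open>Negating the noise negates the sum only on the convergence event, since the default
  value off it need not be 0; hence the almost sure comparison.\<close>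

lemma rect_field_symmetric_law: "distr M borel (\<lambda>\<omega>. - Y t \<omega>) = distr M borel (Y t)"
proof -
  have um: "(\<lambda>\<omega> s. - Z s \<omega>) \<in> measurable M field_space"
    by (rule measurable_PiM_single') auto
  have "AE \<omega> in M. - Y t \<omega> = field_map t (\<lambda>s. - Z s \<omega>)"
    using AE_rect_sums[of t]
  proof eventually_elim
    case (elim \<omega>)
    from rect_suminf_eqI[OF rect_sums_uminus[OF elim]] show ?case by (simp add: field_map_def)
  qed
  then have "distr M borel (\<lambda>\<omega>. - Y t \<omega>) = distr M borel (\<lambda>\<omega>. field_map t (\<lambda>s. - Z s \<omega>))"
    using measurable_compose[OF um field_map_measurable] by (intro distr_cong_AE) auto
  also have "\<dots> = distr (distr M field_space (\<lambda>\<omega> s. - Z s \<omega>)) borel (field_map t)"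
    by (subst distr_distr) (auto simp: comp_def um)
  also have "distr M field_space (\<lambda>\<omega> s. - Z s \<omega>) = distr M field_space (\<lambda>\<omega> s. Z s \<omega>)"
    using field_law[of "\<lambda>_. uminus" "\<lambda>s. s"] law_preserving_uminus by simp
  also have "distr (distr M field_space (\<lambda>\<omega> s. Z s \<omega>)) borel (field_map t) = distr M borel (Y t)"
    by (subst distr_distr) (auto simp: comp_def rect_field_eq_map[abs_def])
  finally show ?thesis .
qed

lemma rect_field_symmetric: "symmetric_field M Y"
  unfolding symmetric_field_def using rect_field_symmetric_law by simp

text \<open>Passage to the limit in the finite identity \<open>box_sum_arma\<close> along boxes with
  one common lower corner.\<close>

lemma rect_field_arma:
  assumes R: "finite R" and S: "finite S" "0 \<notin> S" and rec: "arma_recursion R \<phi> S \<theta> \<alpha>"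
  shows "arma_equation M R \<phi> S \<theta> Z Y"
  unfolding arma_equation_def
proof
  fix t
  have "AE \<omega> in M. \<forall>n\<in>insert 0 R. rect_sums (\<lambda>k. \<alpha> k * Z (t - int_vec n - int_vec k) \<omega>) (Y (t - int_vec n) \<omega>)"
    using R by (intro AE_finite_allI AE_rect_sums) auto
  then show "AE \<omega> in M. Y t \<omega> - (\<Sum>n\<in>R. \<phi> n * Y (t - int_vec n) \<omega>) =
        Z t \<omega> + (\<Sum>n\<in>S. \<theta> n * Z (t - int_vec n) \<omega>)"
  proof eventually_elim
    case (elim \<omega>)
    let ?x = "\<lambda>s. Z s \<omega>"
    define p where "p m = t - int_vec (\<chi> i. m)" for m :: nat
    have lim: "(\<lambda>m. box_sum \<alpha> ?x (p m) (t - int_vec n)) \<longlonglongrightarrow> Y (t - int_vec n) \<omega>" if n: "n \<in> insert 0 R" for n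
    proof -
      \<comment> \<open>Seen from \<open>t - int_vec n\<close>, the box with corner
        \<open>p m\<close> is in general no cube, so convergence along cubes would not do. The
        truncated subtraction is exact from \<open>c\<close> on.\<close>
      define N where "N m = (\<chi> i. m) - n" for m :: nat
      define c where "c = (\<Sum>i\<in>UNIV. n $ i)"
      have nc: "n $ i \<le> c" for i unfolding c_def by (rule member_le_sum) auto
      have "filterlim (\<lambda>m. Min (range (\<lambda>i. N m $ i))) at_top sequentially"
      proof (rule filterlim_at_top_mono[OF filterlim_minus_const_nat_at_top])
        show "\<forall>\<^sub>F m in sequentially. m - c \<le> Min (range (\<lambda>i. N m $ i))"
          by (intro always_eventually allI Min.boundedI) (auto simp: N_def nc diff_le_mono2)
      qed
      then have "(\<lambda>m. \<Sum>j | j \<le> N m. \<alpha> j * ?x (t - int_vec n - int_vec j)) \<longlonglongrightarrow> Y (t - int_vec n) \<omega>"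
        using elim n unfolding rect_sums_def by blast
      moreover have "\<forall>\<^sub>F m in sequentially. (\<Sum>j | j \<le> N m. \<alpha> j * ?x (t - int_vec n - int_vec j)) = box_sum \<alpha> ?x (p m) (t - int_vec n)"
      proof (rule eventually_sequentiallyI[of c])
        fix m assume "c \<le> m"
        then have "n $ i \<le> m" for i using nc order_trans by blast
        then have "p m = (t - int_vec n) - int_vec (N m)"
          by (auto simp: p_def N_def vec_eq_iff of_nat_diff)
        then show "(\<Sum>j | j \<le> N m. \<alpha> j * ?x (t - int_vec n - int_vec j)) = box_sum \<alpha> ?x (p m) (t - int_vec n)"
          by (simp add: box_sum_eq)
      qed
      ultimately show ?thesis by (rule Lim_transform_eventually)
    qed
    have "(\<lambda>m. box_sum \<alpha> ?x (p m) t - (\<Sum>n\<in>R. \<phi> n * box_sum \<alpha> ?x (p m) (t - int_vec n))) \<longlonglongrightarrow>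
       Y t \<omega> - (\<Sum>n\<in>R. \<phi> n * Y (t - int_vec n) \<omega>)"
      using lim[of 0] by (intro tendsto_intros lim) auto
    moreover have "\<forall>\<^sub>F m in sequentially. box_sum \<alpha> ?x (p m) t - (\<Sum>n\<in>R. \<phi> n * box_sum \<alpha> ?x (p m) (t - int_vec n)) =
       Z t \<omega> + (\<Sum>n\<in>S. \<theta> n * Z (t - int_vec n) \<omega>)"
    proof (rule eventually_sequentiallyI)
      define c where "c = (\<Sum>j\<in>insert 0 S. \<Sum>i\<in>UNIV. j $ i)"
      fix m assume m: "c \<le> m"
      have "p m \<le> t - int_vec j" if j: "j \<in> insert 0 S" for j
      proof -
        have "j $ i \<le> m" for i
        proof -
          have "j $ i \<le> (\<Sum>i\<in>UNIV. j $ i)" by (rule member_le_sum) auto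
          also have "\<dots> \<le> c" unfolding c_def
            by (rule member_le_sum[where f = "\<lambda>j. \<Sum>i\<in>UNIV. j $ i"]) (use j S in auto)
          finally show ?thesis using m by simp
        qed
        then show ?thesis by (simp add: p_def less_eq_vec_def)
      qed
      then have "{j \<in> insert 0 S. p m \<le> t - int_vec j} = insert 0 S" by auto
      then show "box_sum \<alpha> ?x (p m) t - (\<Sum>n\<in>R. \<phi> n * box_sum \<alpha> ?x (p m) (t - int_vec n)) =
         Z t \<omega> + (\<Sum>n\<in>S. \<theta> n * Z (t - int_vec n) \<omega>)"
        unfolding box_sum_arma[OF R rec] box_sum_ma_coeff[OF S(1)] ma_sum_eq[OF S, where x = ?x] by simp
    qed
    ultimately have "(\<lambda>_. Z t \<omega> + (\<Sum>n\<in>S. \<theta> n * Z (t - int_vec n) \<omega>)) \<longlonglongrightarrow>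
       Y t \<omega> - (\<Sum>n\<in>R. \<phi> n * Y (t - int_vec n) \<omega>)"
      by (rule Lim_transform_eventually)
    then show ?case by (rule LIMSEQ_unique[OF _ tendsto_const])
  qed
qed

lemma rect_field_causal:
  assumes R: "finite R" and S: "finite S" "0 \<notin> S" and rec: "arma_recursion R \<phi> S \<theta> \<alpha>"
  shows "causal_solution M R \<phi> S \<theta> Z Y"
  unfolding causal_solution_def using rect_field_stationary rect_field_arma[OF assms] rect_field_past by blast

text \<open>Both \<open>Y' t\<close> and \<open>Y t\<close> are approximated by the same box sums,
  the former up to constants. Hence \<open>Y' t - Y t\<close> is concentrated at every scale and so
  almost surely constant.\<close>

lemma rect_field_unique:
  assumes R: "finite R" "0 \<notin> R" and S: "finite S" "0 \<notin> S" and rec: "arma_recursion R \<phi> S \<theta> \<alpha>"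
    and Y': "causal_solution M R \<phi> S \<theta> Z Y'" "symmetric_field M Y'"
  shows "AE \<omega> in M. Y' t \<omega> = Y t \<omega>"
proof -
  have Y'm[measurable]: "Y' t \<in> borel_measurable M" for t
    using Y'(1) unfolding causal_solution_def strictly_stationary_def by blast
  define A where "A N \<omega> = psum \<alpha> t N (noise \<omega>)" for N \<omega>
  have [measurable]: "A N \<in> borel_measurable M" for N unfolding A_def by measurable
  have "\<exists>c. \<P>(\<omega> in M. \<epsilon> < norm ((Y' t \<omega> - Y t \<omega>) - c)) < \<epsilon>" if e: "\<epsilon> > 0" for \<epsilon>
  proof -
    have e2: "\<epsilon> / 2 > 0" using e by simp
    obtain n where n: "\<And>N. N \<ge> n \<Longrightarrow> \<exists>c. \<P>(\<omega> in M. \<epsilon> / 2 < norm (Y' t \<omega> - A N \<omega> - c)) < \<epsilon> / 2"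
      using causal_concentration[OF R S Y'(1) rec e2] unfolding A_def by blast
    have "AE \<omega> in M. (\<lambda>m. A (\<chi> i. m) \<omega>) \<longlonglongrightarrow> Y t \<omega>"
      using AE_rect_sums[of t] by eventually_elim (use rect_sums_diagonal in \<open>auto simp: A_def psum_def\<close>)
    then obtain m0 where m0: "\<And>m. m \<ge> m0 \<Longrightarrow> \<P>(\<omega> in M. \<epsilon> / 2 < norm (Y t \<omega> - A (\<chi> i. m) \<omega>)) < \<epsilon> / 2"
      using AE_tendsto_imp_prob_less[of "\<lambda>m. A (\<chi> i. m)" "Y t" "\<epsilon> / 2"] e2 by auto
    define m where "m = max m0 (\<Sum>i\<in>UNIV. n $ i)"
    have "n $ i \<le> (\<Sum>i\<in>UNIV. n $ i)" for i by (rule member_le_sum) auto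
    then have nm: "n \<le> (\<chi> i. m)" by (auto simp: m_def less_eq_vec_def intro: le_max_iff_disj[THEN iffD2])
    obtain c where c: "\<P>(\<omega> in M. \<epsilon> / 2 < norm (Y' t \<omega> - A (\<chi> i. m) \<omega> - c)) < \<epsilon> / 2" using n[OF nm] by blast
    have "\<P>(\<omega> in M. \<epsilon> / 2 + \<epsilon> / 2 < norm ((Y' t \<omega> - Y t \<omega>) - c)) \<le>
      \<P>(\<omega> in M. \<epsilon> / 2 < norm (Y' t \<omega> - A (\<chi> i. m) \<omega> - c)) + \<P>(\<omega> in M. \<epsilon> / 2 < norm (Y t \<omega> - A (\<chi> i. m) \<omega>))"
    proof (rule prob_triangle)
      show "norm ((Y' t \<omega> - Y t \<omega>) - c) \<le> norm (Y' t \<omega> - A (\<chi> i. m) \<omega> - c) + norm (Y t \<omega> - A (\<chi> i. m) \<omega>)" for \<omega>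
        using norm_triangle_ineq4[of "Y' t \<omega> - A (\<chi> i. m) \<omega> - c" "Y t \<omega> - A (\<chi> i. m) \<omega>"] by (simp add: algebra_simps)
    qed measurable
    also have "\<P>(\<omega> in M. \<epsilon> / 2 < norm (Y t \<omega> - A (\<chi> i. m) \<omega>)) < \<epsilon> / 2" by (rule m0) (simp add: m_def)
    finally have "\<P>(\<omega> in M. \<epsilon> < norm ((Y' t \<omega> - Y t \<omega>) - c)) < \<epsilon>" using c by simp
    then show ?thesis by blast
  qed
  then obtain c where c: "AE \<omega> in M. Y' t \<omega> - Y t \<omega> = c"
    using AE_constI[of "\<lambda>\<omega>. Y' t \<omega> - Y t \<omega>"] by auto
  \<comment> \<open>Symmetry is defined at index 0; strict stationarity carries it to
    \<open>t\<close>.\<close>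
  have law': "distr M borel (\<lambda>\<omega>. - Y' t \<omega>) = distr M borel (Y' t)"
  proof -
    have "distr M borel (Y' t) = distr M borel (Y' 0)"
    proof -
      have m: "(\<lambda>\<omega> s. Y' (s + h) \<omega>) \<in> measurable M field_space" for h
        by (rule measurable_PiM_single') auto
      have proj: "(\<lambda>x. x 0) \<in> borel_measurable (field_space :: (int ^ 'd \<Rightarrow> complex) measure)"
        by (rule measurable_component_singleton) simp
      have "distr M field_space (\<lambda>\<omega> s. Y' (s + t) \<omega>) = distr M field_space (\<lambda>\<omega> s. Y' s \<omega>)"
        using Y'(1) unfolding causal_solution_def strictly_stationary_def by blast
      then have "distr (distr M field_space (\<lambda>\<omega> s. Y' (s + t) \<omega>)) borel (\<lambda>x. x 0) =
        distr (distr M field_space (\<lambda>\<omega> s. Y' s \<omega>)) borel (\<lambda>x. x 0)" by simp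
      then show ?thesis
        using m[of 0] by (subst (asm) (1 2) distr_distr) (auto simp: comp_def m proj)
    qed
    note eq = this
    have "distr M borel (\<lambda>\<omega>. - Y' t \<omega>) = distr (distr M borel (Y' t)) borel uminus"
      by (subst distr_distr) (auto simp: comp_def)
    also have "\<dots> = distr M borel (\<lambda>\<omega>. - Y' 0 \<omega>)"
      unfolding eq by (subst distr_distr) (auto simp: comp_def)
    also have "\<dots> = distr M borel (Y' 0)" using Y'(2) unfolding symmetric_field_def by simp
    finally show ?thesis unfolding eq .
  qed
  \<comment> \<open>With Y' = Y + c, the chain Y + 2c = Y' + c ~ -Y' + c = -Y ~ Y uses both
    symmetries and makes \<open>2 * c\<close> a period of the law of \<open>Y t\<close>.\<close>
  have "distr M borel (\<lambda>\<omega>. Y t \<omega> + 2 * c) = distr M borel (Y t)"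
  proof -
    have "distr M borel (\<lambda>\<omega>. Y t \<omega> + 2 * c) = distr M borel (\<lambda>\<omega>. Y' t \<omega> + c)"
      using c by (intro distr_cong_AE) (auto simp: algebra_simps)
    also have "\<dots> = distr (distr M borel (Y' t)) borel (\<lambda>z. z + c)"
      by (subst distr_distr) (auto simp: comp_def)
    also have "\<dots> = distr M borel (\<lambda>\<omega>. - Y' t \<omega> + c)"
      unfolding law'[symmetric] by (subst distr_distr) (auto simp: comp_def)
    also have "\<dots> = distr M borel (\<lambda>\<omega>. - Y t \<omega>)"
      using c by (intro distr_cong_AE) (auto simp: algebra_simps)
    also have "\<dots> = distr M borel (Y t)" by (rule rect_field_symmetric_law)
    finally show ?thesis .
  qed
  from shift_invariant_law[OF rect_field_measurable this] have "c = 0" by simp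
  then show ?thesis using c by simp
qed

end

end

theorem corollary3p8:
  fixes M :: "'a measure"
    and R S :: "(nat ^ 'd::finite) set"
    and \<phi> \<theta> :: "nat ^ 'd \<Rightarrow> complex"
    and Z :: "int ^ 'd \<Rightarrow> 'a \<Rightarrow> complex"
  assumes "prob_space M"
    and "finite R" and "0 \<notin> R"
    and "finite S" and "0 \<notin> S"
    and "iid_field M Z"
    and "\<not> deterministic_field M Z"
    and "symmetric_field M Z"
  shows "((\<exists>Y. causal_solution M R \<phi> S \<theta> Z Y) \<longleftrightarrow>
          (\<exists>f \<alpha>. f \<in> hardy_H2 \<and>
                 (\<forall>z\<in>polydisc. ar_poly R \<phi> z * f z = ma_poly S \<theta> z) \<and>
                 power_series_on_polydisc \<alpha> f \<and>
                 (\<forall>t. AE_rect_convergent M (\<lambda>k \<omega>. \<alpha> k * Z (t - int_vec k) \<omega>)))) \<and>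
         (\<forall>f \<alpha>. f \<in> hardy_H2 \<and>
                 (\<forall>z\<in>polydisc. ar_poly R \<phi> z * f z = ma_poly S \<theta> z) \<and>
                 power_series_on_polydisc \<alpha> f \<and>
                 (\<forall>t. AE_rect_convergent M (\<lambda>k \<omega>. \<alpha> k * Z (t - int_vec k) \<omega>)) \<longrightarrow>
            (let Y = (\<lambda>t \<omega>. rect_suminf (\<lambda>k. \<alpha> k * Z (t - int_vec k) \<omega>)) in
               causal_solution M R \<phi> S \<theta> Z Y \<and> symmetric_field M Y \<and>
               (\<forall>Y'. causal_solution M R \<phi> S \<theta> Z Y' \<and> symmetric_field M Y' \<longrightarrow>
                     (\<forall>t. AE \<omega> in M. Y' t \<omega> = Y t \<omega>))))"
proof -
  interpret prob_space M by fact
  interpret iid_symmetric M Z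
    using assms by unfold_locales (auto simp: iid_field_def symmetric_field_def)
  let ?good = "\<lambda>f \<alpha>. f \<in> hardy_H2 \<and> (\<forall>z\<in>polydisc. ar_poly R \<phi> z * f z = ma_poly S \<theta> z) \<and>
     power_series_on_polydisc \<alpha> f \<and> (\<forall>t. AE_rect_convergent M (\<lambda>k \<omega>. \<alpha> k * Z (t - int_vec k) \<omega>))"
  let ?Y = "\<lambda>\<alpha> t \<omega>. rect_suminf (\<lambda>k. \<alpha> k * Z (t - int_vec k) \<omega>)"
  have nz: "\<not> (AE \<omega> in M. Z 0 \<omega> = 0)"
  proof
    assume "AE \<omega> in M. Z 0 \<omega> = 0"
    then have "AE x in distr M borel (Z 0). x = 0" by (subst AE_distr_iff) auto
    then have "AE x in distr M borel (Z t). x = 0" for t unfolding ident[of t] .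
    then have "AE \<omega> in M. Z t \<omega> = 0" for t by (subst (asm) AE_distr_iff) auto
    then show False using assms(7) unfolding deterministic_field_def by blast
  qed
  have sufficient: "causal_solution M R \<phi> S \<theta> Z (?Y \<alpha>) \<and> symmetric_field M (?Y \<alpha>) \<and>
      (\<forall>Y'. causal_solution M R \<phi> S \<theta> Z Y' \<and> symmetric_field M Y' \<longrightarrow> (\<forall>t. AE \<omega> in M. Y' t \<omega> = ?Y \<alpha> t \<omega>))"
    if good: "?good f \<alpha>" for f \<alpha>
  proof -
    have conv: "AE_rect_convergent M (\<lambda>k \<omega>. \<alpha> k * Z (t - int_vec k) \<omega>)" for t using good by blast
    \<comment> \<open>Here \<open>\<alpha>\<close> is known only through \<open>f\<close>. Comparing
      coefficients in Phi f = Theta recovers the recursion, on which the construction and uniqueness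
      rest.\<close>
    have "\<alpha> k - (\<Sum>n | n \<in> R \<and> n \<le> k. \<phi> n * \<alpha> (k - n)) - ma_coeff S \<theta> k = 0" for k
    proof (rule power_series_coeff_zero)
      fix z :: "complex ^ 'd" assume "z \<in> polydisc"
      then show "((\<lambda>k. (\<alpha> k - (\<Sum>n | n \<in> R \<and> n \<le> k. \<phi> n * \<alpha> (k - n)) - ma_coeff S \<theta> k) * mpow z k) has_sum 0) UNIV"
        using arma_series_identity[of R S \<alpha> f z \<phi> \<theta>] assms good by simp
    qed
    moreover have "a - b - c = 0 \<Longrightarrow> a = c + b" for a b c :: complex by (simp add: algebra_simps)
    ultimately have rec: "arma_recursion R \<phi> S \<theta> \<alpha>"
      unfolding arma_recursion_def by blast
    show ?thesis
      using rect_field_causal[OF conv assms(2,4,5) rec] rect_field_symmetric[OF conv]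
        rect_field_unique[OF conv assms(2-5) rec] by blast
  qed
  have necessary: "\<exists>f \<alpha>. ?good f \<alpha>" if Y: "causal_solution M R \<phi> S \<theta> Z Y" for Y
  proof -
    \<comment> \<open>The formal quotient is available before any convergence is known; square
      summability then provides the function \<open>f\<close>.\<close>
    define \<alpha> where "\<alpha> = arma_coeff R \<phi> S \<theta>"
    have rec: "arma_recursion R \<phi> S \<theta> \<alpha>" unfolding \<alpha>_def by (rule arma_recursion_arma_coeff) fact
    note Cauchy = causal_Cauchy[OF assms(2-5) Y rec]
    obtain A where A: "\<And>F. finite F \<Longrightarrow> (\<Sum>k\<in>F. (norm (\<alpha> k))\<^sup>2) \<le> A"
      using square_summable_coefficients[OF nz Cauchy] by blast
    have "(norm (\<alpha> k))\<^sup>2 \<le> A" for k using A[of "{k}"] by simp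
    then have B: "norm (\<alpha> k) \<le> sqrt A" for k using real_le_rsqrt by blast
    define f where "f z = infsum (\<lambda>k. \<alpha> k * mpow z k) UNIV" for z
    have ps: "power_series_on_polydisc \<alpha> f" unfolding f_def by (rule power_series_infsum[OF B])
    have "ar_poly R \<phi> z * f z = ma_poly S \<theta> z" if z: "z \<in> polydisc" for z
    proof -
      have "\<alpha> k - (\<Sum>n | n \<in> R \<and> n \<le> k. \<phi> n * \<alpha> (k - n)) - ma_coeff S \<theta> k = 0" for k
        by (subst rec[unfolded arma_recursion_def, rule_format, of k]) simp
      then have "((\<lambda>k :: nat ^ 'd. 0 :: complex) has_sum (ar_poly R \<phi> z * f z - ma_poly S \<theta> z)) UNIV"
        using arma_series_identity[OF assms(2,4,5) ps z, of \<phi> \<theta>] by simp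
      moreover have "((\<lambda>k :: nat ^ 'd. 0 :: complex) has_sum 0) UNIV" by simp
      ultimately have "ar_poly R \<phi> z * f z - ma_poly S \<theta> z = 0" by (rule has_sum_unique)
      then show ?thesis by simp
    qed
    moreover have "f \<in> hardy_H2" by (rule hardy_H2_power_series[OF A ps])
    moreover have "AE_rect_convergent M (\<lambda>k \<omega>. \<alpha> k * Z (t - int_vec k) \<omega>)" for t
      by (rule AE_rect_convergentI[OF Cauchy])
    ultimately show ?thesis using ps by blast
  qed
  show ?thesis
    unfolding Let_def using sufficient necessary by blast
qed

end
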